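(* Let $\boldsymbol{\mathcal I}\sim\mathcal H_3(m,n)$ be a random $3\mathsf{SAT}$ instance with $m=\Delta n=n^{1+\delta}$ for a constant $\delta>0$. There is an efficient algorithm that certifies with high probability that $\boldsymbol{\mathcal I}$ has no $\rho$-biased assignment which is $(1-\eta)$-satisfying, where $\rho\gg\sqrt{\log n/\Delta}$ and $\eta=\rho/32$.
   Context: A signed $3$-uniform hypergraph on $[n]$ is a collection of pairs $(c,U)$ with $c\in\{\pm1\}^3$, $U\in[n]^3$; $\mathcal H_3(m,n)$ includes each of the $8n^3$ possible pairs independently with probability $\frac{m}{8n^3}$. With $3\mathsf{SAT}(z)=1-\mathbf 1[z=(1,1,1)]$, an assignment $x\in\{\pm1\}^n$ satisfies clause $(c,U)$ iff $3\mathsf{SAT}(c_1x_{U_1},c_2x_{U_2},c_3x_{U_3})=1$, and is $(1-\eta)$-satisfying if it satisfies at least a $(1-\eta)$ fraction of clauses. $x$ is $\rho$-biased if $\frac1n|\sum_{i=1}^nx_i|\ge\rho$. "Certifies with high probability" means the algorithm always outputs success or failure, success implies the statement holds for the input, and success occurs with probability $1-o(1)$ on the random input. *)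

theory Defs
  imports "HOL-Probability.Probability" "HOL-Library.Log_Nat"
begin

section \<open>Random signed hypergraphs and 3SAT\<close>

type_synonym clause = "(int \<times> int \<times> int) \<times> (nat \<times> nat \<times> nat)"

definition signs :: "int set" where
  "signs = {-1, 1}"

definition clauses :: "nat \<Rightarrow> clause set" where
  "clauses n = (signs \<times> signs \<times> signs) \<times> ({1..n} \<times> {1..n} \<times> {1..n})"

text \<open>\<open>bernoulli_pmf\<close> clips its parameter to \<open>[0,1]\<close>. So for \<open>m > 8 n\<^sup>3\<close>, where the mathematical
  definition is void, this is the point mass at the complete hypergraph.\<close>

definition random_hypergraph :: "real \<Rightarrow> nat \<Rightarrow> clause set pmf" where
  "random_hypergraph m n =
     map_pmf (\<lambda>b. {C \<in> clauses n. b C})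
       (Pi_pmf (clauses n) False (\<lambda>_. bernoulli_pmf (m / (8 * real n ^ 3))))"

definition sat3 :: "int \<times> int \<times> int \<Rightarrow> int" where
  "sat3 z = 1 - of_bool (z = (1, 1, 1))"

fun satisfies :: "(nat \<Rightarrow> int) \<Rightarrow> clause \<Rightarrow> bool" where
  "satisfies x ((c1, c2, c3), (u1, u2, u3)) \<longleftrightarrow> sat3 (c1 * x u1, c2 * x u2, c3 * x u3) = 1"

definition satisfying :: "real \<Rightarrow> clause set \<Rightarrow> (nat \<Rightarrow> int) \<Rightarrow> bool" where
  "satisfying r I x \<longleftrightarrow> real (card {C \<in> I. satisfies x C}) \<ge> r * real (card I)"

definition assignments :: "nat \<Rightarrow> (nat \<Rightarrow> int) set" where
  "assignments n = {x. \<forall>i\<in>{1..n}. x i \<in> signs}"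

definition biased :: "real \<Rightarrow> nat \<Rightarrow> (nat \<Rightarrow> int) \<Rightarrow> bool" where
  "biased \<rho> n x \<longleftrightarrow> 1 / real n * \<bar>\<Sum>i=1..n. real_of_int (x i)\<bar> \<ge> \<rho>"


section \<open>Polynomial-time algorithms\<close>

text \<open>Programs are structured random access machine programs under the logarithmic cost
  criterion: every evaluation of an expression is charged the binary length of all constants,
  addresses and intermediate results it involves. Running time is therefore polynomially related
  to Turing machine running time. The memory consists of integer-indexed arrays of integers,
  named by natural numbers; a given program can mention only finitely many of these names.
  A scalar variable is an array used at index 0 only.\<close>

type_synonym state = "nat \<Rightarrow> int \<Rightarrow> int"

datatype exp =
    Const int
  | Cell nat exp
  | Add exp exp
  | Sub exp exp
  | Mul exp exp
  | Quot exp exp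

datatype prog =
    Skip
  | Assign nat exp exp
  | Seq prog prog
  | Cond exp prog prog
  | Loop exp prog

definition int_size :: "int \<Rightarrow> nat" where
  "int_size k = 1 + floorlog 2 (nat \<bar>k\<bar>)"

fun val :: "exp \<Rightarrow> state \<Rightarrow> int" where
  "val (Const k) s = k"
| "val (Cell a e) s = s a (val e s)"
| "val (Add e f) s = val e s + val f s"
| "val (Sub e f) s = val e s - val f s"
| "val (Mul e f) s = val e s * val f s"
| "val (Quot e f) s = val e s div val f s"

fun cost :: "exp \<Rightarrow> state \<Rightarrow> nat" where
  "cost (Const k) s = int_size k"
| "cost (Cell a e) s = cost e s + int_size (s a (val e s))"
| "cost (Add e f) s = cost e s + cost f s + int_size (val e s + val f s)"
| "cost (Sub e f) s = cost e s + cost f s + int_size (val e s - val f s)"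
| "cost (Mul e f) s = cost e s + cost f s + int_size (val e s * val f s)"
| "cost (Quot e f) s = cost e s + cost f s + int_size (val e s div val f s)"

text \<open>\<open>exec A s t s'\<close>: started in state \<open>s\<close>, program \<open>A\<close> halts in state \<open>s'\<close> after time \<open>t\<close>.
  Tests succeed on positive values.\<close>

inductive exec :: "prog \<Rightarrow> state \<Rightarrow> nat \<Rightarrow> state \<Rightarrow> bool" where
  Skip: "exec Skip s 1 s"
| Assign: "exec (Assign a i e) s (1 + cost i s + cost e s) (s(a := (s a)(val i s := val e s)))"
| Seq: "exec A s t s' \<Longrightarrow> exec B s' u s'' \<Longrightarrow> exec (Seq A B) s (t + u) s''"
| Cond_true: "val e s > 0 \<Longrightarrow> exec A s t s' \<Longrightarrow> exec (Cond e A B) s (1 + cost e s + t) s'"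
| Cond_false: "\<not> val e s > 0 \<Longrightarrow> exec B s t s' \<Longrightarrow> exec (Cond e A B) s (1 + cost e s + t) s'"
| Loop_false: "\<not> val e s > 0 \<Longrightarrow> exec (Loop e A) s (1 + cost e s) s"
| Loop_true: "val e s > 0 \<Longrightarrow> exec A s t s' \<Longrightarrow> exec (Loop e A) s' u s'' \<Longrightarrow>
    exec (Loop e A) s (1 + cost e s + t + u) s''"

inductive_cases exec_SkipE: "exec Skip s t s'"
inductive_cases exec_AssignE: "exec (Assign a i e) s t s'"
inductive_cases exec_SeqE: "exec (Seq A B) s t s'"
inductive_cases exec_CondE: "exec (Cond e A B) s t s'"
inductive_cases exec_LoopE: "exec (Loop e A) s t s'"

lemma exec_deterministic:
  "exec A s t s' \<Longrightarrow> exec A s u s'' \<Longrightarrow> t = u \<and> s' = s''"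
proof (induction arbitrary: u s'' rule: exec.induct)
  case (Skip s)
  from Skip.prems show ?case by (rule exec_SkipE) simp
next
  case (Assign a i e s)
  from Assign.prems show ?case by (rule exec_AssignE) simp
next
  case (Seq A s t s' B v r)
  from Seq.prems obtain t1 s1 v1 where "exec A s t1 s1" "exec B s1 v1 s''" "u = t1 + v1"
    by (rule exec_SeqE)
  with Seq.IH(1)[of t1 s1] Seq.IH(2)[of v1 s''] show ?case by simp
next
  case (Cond_true e s A t s' B)
  from Cond_true.prems Cond_true.hyps(1)
  obtain t1 where "exec A s t1 s''" "u = 1 + cost e s + t1"
    by (auto elim: exec_CondE)
  with Cond_true.IH[of t1 s''] show ?case by simp
next
  case (Cond_false e s B t s' A)
  from Cond_false.prems Cond_false.hyps(1)
  obtain t1 where "exec B s t1 s''" "u = 1 + cost e s + t1"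
    by (auto elim: exec_CondE)
  with Cond_false.IH[of t1 s''] show ?case by simp
next
  case (Loop_false e s A)
  from Loop_false.prems show ?case
    by (rule exec_LoopE) (simp_all add: Loop_false.hyps)
next
  case (Loop_true e s A t s' v r)
  from Loop_true.prems
  obtain t1 s1 v1 where "exec A s t1 s1" "exec (Loop e A) s1 v1 s''" "u = 1 + cost e s + t1 + v1"
    by (rule exec_LoopE) (use Loop_true.hyps(1) in simp_all)
  with Loop_true.IH(1)[of t1 s1] Loop_true.IH(2)[of v1 s''] show ?case by simp
qed

text \<open>The input is a list of integers, stored in array 0 at indices \<open>0, 1, \<dots>\<close>, with its length in
  cell 0 of array 1; all other cells are 0. The output is read from cell 0 of array 0.\<close>

definition initial :: "int list \<Rightarrow> state" where
  "initial xs a i =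
     (if a = 0 \<and> 0 \<le> i \<and> i < int (length xs) then xs ! nat i
      else if a = 1 \<and> i = 0 then int (length xs) else 0)"

definition returns :: "prog \<Rightarrow> int list \<Rightarrow> int \<Rightarrow> bool" where
  "returns A xs v \<longleftrightarrow> (\<exists>t s. exec A (initial xs) t s \<and> s 0 0 = v)"

definition input_size :: "int list \<Rightarrow> nat" where
  "input_size xs = (\<Sum>k\<leftarrow>xs. int_size k)"

definition polynomial_time_on :: "int list set \<Rightarrow> prog \<Rightarrow> bool" where
  "polynomial_time_on X A \<longleftrightarrow>
     (\<exists>c d. \<forall>xs\<in>X. \<exists>t s. exec A (initial xs) t s \<and> t \<le> c * input_size xs ^ d + c)"


section \<open>Certification\<close>

abbreviation failure :: int where "failure \<equiv> 0"
abbreviation success :: int where "success \<equiv> 1"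

text \<open>\<open>X n\<close> is the set of all instances of dimension \<open>n\<close>, \<open>enc n I\<close> the input presented to the
  algorithm for \<open>I \<in> X n\<close>, \<open>D n\<close> a distribution on \<open>X n\<close>, and \<open>P n I\<close> the certified property.\<close>

definition certifies_whp ::
  "prog \<Rightarrow> (nat \<Rightarrow> 'i set) \<Rightarrow> (nat \<Rightarrow> 'i \<Rightarrow> int list) \<Rightarrow> (nat \<Rightarrow> 'i pmf) \<Rightarrow> (nat \<Rightarrow> 'i \<Rightarrow> bool) \<Rightarrow> bool"
where
  "certifies_whp A X enc D P \<longleftrightarrow>
     (\<forall>n. \<forall>I\<in>X n. returns A (enc n I) success \<or> returns A (enc n I) failure) \<and>
     (\<forall>n. \<forall>I\<in>X n. returns A (enc n I) success \<longrightarrow> P n I) \<and>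
     (\<lambda>n. measure_pmf.prob (D n) {I. returns A (enc n I) success}) \<longlonglongrightarrow> 1"

definition instances :: "nat \<Rightarrow> clause set set" where
  "instances n = Pow (clauses n)"

text \<open>An instance is presented by its characteristic sequence, together with \<open>n\<close> and the bias
  parameter \<open>r\<close>. The latter is an arbitrary real number, so the algorithm only receives its
  truncation to \<open>n\<close> binary digits after the point.\<close>

definition encode :: "nat \<Rightarrow> real \<Rightarrow> clause set \<Rightarrow> int list" where
  "encode n r I =
     [int n, \<lfloor>2 ^ n * r\<rfloor>] @
     [of_bool (((c1, c2, c3), (u1, u2, u3)) \<in> I).
        u1 \<leftarrow> [1..<n+1], u2 \<leftarrow> [1..<n+1], u3 \<leftarrow> [1..<n+1],
        c1 \<leftarrow> [-1, 1], c2 \<leftarrow> [-1, 1], c3 \<leftarrow> [-1, 1]]"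

end

(*
Put z_i = c_i x_i in a clause with signs c and assigned values x. The clause is violated iff
(1 + z_1)(1 + z_2)(1 + z_3) = 8, and |x_3 + c_1 c_2 c_3 x_1 x_2| = |z_3 + z_1 z_2| = 1 + z_1 z_2 z_3.
Expanding the product shows that |sum of x_3 over the clauses| is at most 8 times the number of
violated clauses plus the absolute values of seven bilinear forms in x, given by matrices whose
entries are sums of products of the random signs. If every variable occurs in the third position
about equally often, the sum of x_3 is close to (number of clauses / n) times the sum of all x_i,
so it is large for a biased assignment. Hence it suffices to certify that the occurrences are
regular and that the seven norms are small.

A norm is bounded by the Frobenius norm of the (log log n)-fold iterated Gram matrix, a trace of a
power with exponent K between log n and 2 log n + 1; taking the root of order K then loses only a
constant factor, and all numbers involved have polynomial length. The expected trace is a sum over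
closed walks of length 2K. Negating a sign of all clauses on a fixed triple of variables cancels
all walks in which some triple occurs an odd number of times. In the others at most half of the
steps lead to a new triple, and these number at most n (289 Delta K)^K in expectation.
For delta > 2 the instance is eventually the complete hypergraph, and all tested quantities vanish.
*)
theory Submission
  imports Defs "HOL-Real_Asymp.Real_Asymp"
begin

section \<open>The certificate\<close>

text \<open>The bias arrives truncated to an integer \<open>r\<close>, and roots are not integers,
  so every test has cleared denominators and compares powers. With
  \<open>t = r * M / (16 * 2 ^ n)\<close>, where \<open>M\<close> counts the clauses, each of the
  seven forms is certified to be at most \<open>t\<close>, and the regularity defect at most
  \<open>n * t\<close>. Since \<open>t\<close> is at most \<rho> M / 16, the violated clauses
  account for 8 (\<rho> / 32) M = \<rho> M / 4 and the eight errors for \<rho> M / 2. This is less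
  than the \<rho> M that the bias forces, and it explains 32 and 16. Independent are the possible
  clauses, so one triple may carry several clauses with different signs. The cancellation therefore
  acts on words over all possible clauses, weighted by q to the number of distinct clauses; a flip
  of signs preserves this weight. Markov's inequality compares n (289 \<Delta> K)^K with the
  threshold (\<rho>^2 \<Delta>^2 / 4096)^K. The ratio of the bases is of order K / (\<rho>^2
  \<Delta>), and K = O(log n), so it tends to 0 exactly by the growth assumed of \<rho>. Once it is
  below 1/4, its K-th power beats the factor n, since 2^K is at least n.\<close>

text \<open>A pattern \<open>(i, j, p)\<close> stands for the matrix with rows indexed by the \<open>i\<close>-th and columns by the
  \<open>j\<close>-th variable of a clause, whose entries collect the products of the signs selected by \<open>p\<close>.
  Variables are counted from 0 here.\<close>

type_synonym pattern = "nat \<times> nat \<times> bool \<times> bool \<times> bool"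

definition coord :: "nat \<Rightarrow> clause \<Rightarrow> nat" where
  "coord i C = (case C of (_, u1, u2, u3) \<Rightarrow> (if i = 0 then u1 else if i = 1 then u2 else u3) - 1)"

definition csign :: "bool \<times> bool \<times> bool \<Rightarrow> clause \<Rightarrow> int" where
  "csign p C = (case p of (p1, p2, p3) \<Rightarrow> case C of ((c1, c2, c3), _) \<Rightarrow>
     (if p1 then c1 else 1) * (if p2 then c2 else 1) * (if p3 then c3 else 1))"

definition sign_matrix :: "clause set \<Rightarrow> pattern \<Rightarrow> nat \<Rightarrow> nat \<Rightarrow> int" where
  "sign_matrix I \<kappa> u v = (case \<kappa> of (i, j, p) \<Rightarrow>
     \<Sum>C\<in>I. if coord i C = u \<and> coord j C = v then csign p C else 0)"

fun gram :: "nat \<Rightarrow> (nat \<Rightarrow> nat \<Rightarrow> int) \<Rightarrow> nat \<Rightarrow> nat \<Rightarrow> nat \<Rightarrow> int" where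
  "gram n T 0 = T"
| "gram n T (Suc j) = (\<lambda>u v. \<Sum>w<n. gram n T j u w * gram n T j v w)"

definition frob :: "nat \<Rightarrow> (nat \<Rightarrow> nat \<Rightarrow> int) \<Rightarrow> int" where
  "frob n T = (\<Sum>u<n. \<Sum>v<n. (T u v)\<^sup>2)"

definition occurrences :: "clause set \<Rightarrow> nat \<Rightarrow> int" where
  "occurrences I u = int (card {C \<in> I. coord 2 C = u})"

definition irregularity :: "nat \<Rightarrow> clause set \<Rightarrow> int" where
  "irregularity n I = (\<Sum>u<n. (int n * occurrences I u - int (card I))\<^sup>2)"

definition depth :: "nat \<Rightarrow> nat" where
  "depth n = floorlog 2 (floorlog 2 n)"

text \<open>The first three are linear forms in disguise: their column variable is an arbitrary
  other one, and they are paired with the all-ones vector. Six patterns come from the expanded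
  product, the last one from the term added to the third variable. Each selects at least one sign,
  as the cancellation requires.\<close>

definition patterns :: "pattern list" where
  "patterns =
    [(0, 1, True, False, False), (1, 2, False, True, False), (2, 0, False, False, True),
     (0, 1, True, True, False), (0, 2, True, False, True), (1, 2, False, True, True),
     (0, 1, True, True, True)]"

text \<open>In terms of \<open>t = r * card I / (16 * 2 ^ n)\<close>, the second test says that the
  square root of \<open>irregularity n I * n\<close> is at most \<open>n * t\<close>, and the third
  that \<open>n\<close> times the root of order \<open>2 * 2 ^ depth n\<close> of the Frobenius
  quantity is at most \<open>t\<close>.\<close>

definition accepts :: "nat \<Rightarrow> int \<Rightarrow> clause set \<Rightarrow> bool" where
  "accepts n r I \<longleftrightarrow>
     r * int (card I) > 0 \<and>
     irregularity n I * (16 * 2 ^ n)\<^sup>2 \<le> (r * int (card I))\<^sup>2 * int n \<and>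
     (\<forall>\<kappa>\<in>set patterns. frob n (gram n (sign_matrix I \<kappa>) (depth n)) *
        ((16 * 2 ^ n * int n)\<^sup>2) ^ 2 ^ depth n \<le> ((r * int (card I))\<^sup>2) ^ 2 ^ depth n)"

section \<open>Bilinear forms and iterated Gram matrices\<close>

definition bilinear :: "nat \<Rightarrow> (nat \<Rightarrow> nat \<Rightarrow> int) \<Rightarrow> (nat \<Rightarrow> int) \<Rightarrow> (nat \<Rightarrow> int) \<Rightarrow> int" where
  "bilinear n T x y = (\<Sum>u<n. \<Sum>v<n. T u v * x u * y v)"

lemma Cauchy_Schwarz_int: "(\<Sum>i\<in>A. a i * b i)\<^sup>2 \<le> (\<Sum>i\<in>A. (a i)\<^sup>2) * (\<Sum>i\<in>A. (b i :: int)\<^sup>2)"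
proof -
  have "(\<Sum>i\<in>A. real_of_int (a i) * b i)\<^sup>2
      \<le> (\<Sum>i\<in>A. (real_of_int (a i))\<^sup>2) * (\<Sum>i\<in>A. (real_of_int (b i))\<^sup>2)"
    by (rule Cauchy_Schwarz_ineq_sum)
  then have "real_of_int ((\<Sum>i\<in>A. a i * b i)\<^sup>2)
      \<le> real_of_int ((\<Sum>i\<in>A. (a i)\<^sup>2) * (\<Sum>i\<in>A. (b i)\<^sup>2))" by simp
  then show ?thesis by linarith
qed

lemma bilinear_sum_right: "bilinear n T x y = (\<Sum>v<n. y v * (\<Sum>u<n. T u v * x u))"
  unfolding bilinear_def by (subst sum.swap) (simp add: sum_distrib_left mult_ac)

lemma bilinear_square_le:
  assumes "\<And>v. v < n \<Longrightarrow> (y v)\<^sup>2 = 1"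
  shows "(bilinear n T x y)\<^sup>2 \<le> int n * (\<Sum>v<n. (\<Sum>u<n. T u v * x u)\<^sup>2)"
proof -
  have "(\<Sum>v<n. (y v)\<^sup>2) = int n" using assms by simp
  with Cauchy_Schwarz_int[of y "\<lambda>v. \<Sum>u<n. T u v * x u" "{..<n}"] show ?thesis
    by (simp add: bilinear_sum_right)
qed

text \<open>Cauchy-Schwarz against \<open>y\<close> leaves the squared norm of the transpose of
  \<open>T\<close> applied to \<open>x\<close>, which is the form of the Gram matrix at
  \<open>x\<close>. Both arguments are now \<open>x\<close>, so the step can be repeated.\<close>

lemma bilinear_square_le_gram:
  assumes "\<And>v. v < n \<Longrightarrow> (y v)\<^sup>2 = 1"
  shows "(bilinear n T x y)\<^sup>2 \<le> int n * bilinear n (gram n T 1) x x"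
proof -
  have "(\<Sum>v<n. (\<Sum>u<n. T u v * x u)\<^sup>2) = (\<Sum>v<n. \<Sum>u<n. \<Sum>u'<n. T u v * x u * (T u' v * x u'))"
    by (simp add: power2_eq_square sum_product)
  also have "\<dots> = (\<Sum>u<n. \<Sum>v<n. \<Sum>u'<n. T u v * x u * (T u' v * x u'))"
    by (rule sum.swap)
  also have "\<dots> = (\<Sum>u<n. \<Sum>u'<n. \<Sum>v<n. T u v * x u * (T u' v * x u'))"
    by (intro sum.cong refl sum.swap)
  also have "\<dots> = bilinear n (gram n T 1) x x"
    by (simp add: bilinear_def sum_distrib_left sum_distrib_right mult_ac)
  finally show ?thesis using bilinear_square_le[of n y T x] assms by simp
qed

lemma bilinear_square_le_frob:
  assumes "\<And>v. v < n \<Longrightarrow> (x v)\<^sup>2 = 1" "\<And>v. v < n \<Longrightarrow> (y v)\<^sup>2 = 1"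
  shows "(bilinear n T x y)\<^sup>2 \<le> (int n)\<^sup>2 * frob n T"
proof -
  have "(\<Sum>u<n. T u v * x u)\<^sup>2 \<le> (\<Sum>u<n. (T u v)\<^sup>2) * int n" for v
    using Cauchy_Schwarz_int[of "\<lambda>u. T u v" x "{..<n}"] assms(1) by simp
  then have "(\<Sum>v<n. (\<Sum>u<n. T u v * x u)\<^sup>2) \<le> (\<Sum>v<n. (\<Sum>u<n. (T u v)\<^sup>2) * int n)"
    by (rule sum_mono)
  also have "\<dots> = int n * frob n T"
    unfolding frob_def by (subst sum.swap) (simp add: sum_distrib_left mult.commute)
  finally have "int n * (\<Sum>v<n. (\<Sum>u<n. T u v * x u)\<^sup>2) \<le> int n * (int n * frob n T)"
    by (rule mult_left_mono) simp
  with bilinear_square_le[of n y T x] assms(2) show ?thesis by (simp add: power2_eq_square)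
qed

lemma gram_gram: "gram n (gram n T 1) j = gram n T (Suc j)"
  by (induction j) auto

text \<open>Each squaring of the form trades \<open>T\<close> for its Gram matrix at the price of a
  factor \<open>n\<close>. The induction generalises \<open>T\<close> and \<open>y\<close>, because
  the second vector becomes \<open>x\<close> after the first step. Only the last matrix is bounded
  crudely, by its Frobenius norm.\<close>

lemma bilinear_power_le_frob_gram:
  assumes "\<And>v. v < n \<Longrightarrow> (x v)\<^sup>2 = 1" "\<And>v. v < n \<Longrightarrow> (y v)\<^sup>2 = 1"
  shows "((bilinear n T x y)\<^sup>2) ^ 2 ^ j \<le> ((int n)\<^sup>2) ^ 2 ^ j * frob n (gram n T j)"
  using assms(2)
proof (induction j arbitrary: T y)
  case 0
  with assms(1) show ?case by (simp add: bilinear_square_le_frob)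
next
  case (Suc j)
  have "((bilinear n T x y)\<^sup>2) ^ 2 ^ Suc j = (((bilinear n T x y)\<^sup>2)\<^sup>2) ^ 2 ^ j"
    by (simp flip: power_mult)
  also have "\<dots> \<le> ((int n * bilinear n (gram n T 1) x x)\<^sup>2) ^ 2 ^ j"
    by (intro power_mono bilinear_square_le_gram Suc.prems) auto
  also have "\<dots> = ((int n)\<^sup>2) ^ 2 ^ j * ((bilinear n (gram n T 1) x x)\<^sup>2) ^ 2 ^ j"
    by (simp add: power_mult_distrib)
  also have "\<dots> \<le> ((int n)\<^sup>2) ^ 2 ^ j * (((int n)\<^sup>2) ^ 2 ^ j * frob n (gram n (gram n T 1) j))"
    by (intro mult_left_mono Suc.IH assms(1)) auto
  also have "\<dots> = ((int n)\<^sup>2) ^ 2 ^ Suc j * frob n (gram n T (Suc j))"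
    by (simp add: gram_gram mult_2 power_add flip: One_nat_def)
  finally show ?case .
qed

section \<open>From clauses to bilinear forms, and soundness of the tests\<close>

lemma finite_clauses [simp]: "finite (clauses n)"
  by (simp add: clauses_def signs_def)

lemma coord_less: "C \<in> clauses n \<Longrightarrow> coord i C < n"
  by (auto simp: clauses_def coord_def)

lemma bilinear_sign_matrix:
  assumes "I \<subseteq> clauses n"
  shows "bilinear n (sign_matrix I (i, j, p)) x y =
    (\<Sum>C\<in>I. csign p C * x (coord i C) * y (coord j C))"
proof -
  have "bilinear n (sign_matrix I (i, j, p)) x y = (\<Sum>u<n. \<Sum>v<n. \<Sum>C\<in>I.
      (if coord i C = u \<and> coord j C = v then csign p C else 0) * x u * y v)"
    by (simp add: bilinear_def sign_matrix_def sum_distrib_right)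
  also have "\<dots> = (\<Sum>u<n. \<Sum>C\<in>I. \<Sum>v<n.
      (if coord i C = u \<and> coord j C = v then csign p C else 0) * x u * y v)"
    by (intro sum.cong refl sum.swap)
  also have "\<dots> = (\<Sum>C\<in>I. \<Sum>u<n. \<Sum>v<n.
      (if coord i C = u \<and> coord j C = v then csign p C else 0) * x u * y v)"
    by (rule sum.swap)
  also have "\<dots> = (\<Sum>C\<in>I. csign p C * x (coord i C) * y (coord j C))"
  proof (rule sum.cong)
    fix C assume "C \<in> I"
    then have *: "coord i C < n" "coord j C < n" using assms coord_less by blast+
    have "(\<Sum>u<n. \<Sum>v<n. (if coord i C = u \<and> coord j C = v then csign p C else 0) * x u * y v)
      = (\<Sum>u<n. \<Sum>v<n. if coord j C = v then
          (if coord i C = u then csign p C * x u * y v else 0) else 0)"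
      by (intro sum.cong) auto
    also have "\<dots> = csign p C * x (coord i C) * y (coord j C)"
      using * by (simp add: sum.delta')
    finally show "(\<Sum>u<n. \<Sum>v<n. (if coord i C = u \<and> coord j C = v then csign p C else 0) * x u * y v)
      = csign p C * x (coord i C) * y (coord j C)" .
  qed simp
  finally show ?thesis .
qed

lemma sum_occurrences:
  assumes "I \<subseteq> clauses n"
  shows "(\<Sum>u<n. occurrences I u * x u) = (\<Sum>C\<in>I. x (coord 2 C))"
proof -
  have fin: "finite I" using assms finite_subset finite_clauses by blast
  have "(\<Sum>u<n. occurrences I u * x u) = (\<Sum>u<n. \<Sum>C\<in>I. if coord 2 C = u then x u else 0)"
    using fin by (simp add: occurrences_def sum.If_cases Int_def)
  also have "\<dots> = (\<Sum>C\<in>I. \<Sum>u<n. if coord 2 C = u then x u else 0)" by (rule sum.swap)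
  also have "\<dots> = (\<Sum>C\<in>I. x (coord 2 C))"
    using assms coord_less by (intro sum.cong) (auto simp: sum.delta')
  finally show ?thesis .
qed

text \<open>With \<open>z\<^sub>i = c\<^sub>i x\<^sub>i\<close>, a clause is violated iff \<open>(1 + z\<^sub>1)(1 + z\<^sub>2)(1 + z\<^sub>3) = 8\<close>, and
  \<open>|x\<^sub>3 + c\<^sub>1c\<^sub>2c\<^sub>3 x\<^sub>1x\<^sub>2| = |z\<^sub>3 + z\<^sub>1z\<^sub>2| = 1 + z\<^sub>1z\<^sub>2z\<^sub>3\<close>.\<close>

lemma clause_inequality:
  assumes "C \<in> clauses n" and "x \<in> assignments n"
  defines "X \<equiv> \<lambda>i. x (Suc (coord i C))"
  shows "\<bar>X 2 + csign (True, True, True) C * X 0 * X 1\<bar> +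
      csign (True, False, False) C * X 0 + csign (False, True, False) C * X 1 +
      csign (False, False, True) C * X 2 + csign (True, True, False) C * X 0 * X 1 +
      csign (True, False, True) C * X 0 * X 2 + csign (False, True, True) C * X 1 * X 2
    = 8 * of_bool (\<not> satisfies x C)"
proof -
  obtain c1 c2 c3 u1 u2 u3 where C: "C = ((c1, c2, c3), (u1, u2, u3))" by (metis prod.exhaust)
  have u: "u1 \<in> {1..n}" "u2 \<in> {1..n}" "u3 \<in> {1..n}"
    and c: "c1 = 1 \<or> c1 = -1" "c2 = 1 \<or> c2 = -1" "c3 = 1 \<or> c3 = -1"
    using assms(1) by (auto simp: C clauses_def signs_def)
  have X: "X 0 = x u1" "X 1 = x u2" "X 2 = x u3" using u by (auto simp: X_def C coord_def)
  have x: "x u1 = 1 \<or> x u1 = -1" "x u2 = 1 \<or> x u2 = -1" "x u3 = 1 \<or> x u3 = -1"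
    using u assms(2) by (auto simp: assignments_def signs_def)
  show ?thesis unfolding X unfolding C csign_def
    using c x by (elim disjE) (simp_all add: sat3_def)
qed

text \<open>Takes the root of order \<open>2 * K\<close> inside the integers: \<open>f\<close> is
  the Frobenius quantity that links the accepted test with the bound on the form, and eliminating it
  leaves two powers with equal exponents.\<close>

lemma le_of_power_ratio:
  fixes a b c t f :: int
  assumes "f * (c\<^sup>2) ^ K \<le> (b\<^sup>2) ^ K" "(a\<^sup>2) ^ K \<le> (t\<^sup>2) ^ K * f" "0 \<le> b" "K > 0"
  shows "\<bar>a\<bar> * \<bar>c\<bar> \<le> b * \<bar>t\<bar>"
proof -
  have "((\<bar>a\<bar> * \<bar>c\<bar>)\<^sup>2) ^ K = (a\<^sup>2) ^ K * (c\<^sup>2) ^ K" by (simp add: power_mult_distrib)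
  also have "\<dots> \<le> (t\<^sup>2) ^ K * f * (c\<^sup>2) ^ K" using assms(2) by (intro mult_right_mono) auto
  also have "\<dots> \<le> (t\<^sup>2) ^ K * (b\<^sup>2) ^ K"
    using mult_left_mono[OF assms(1), of "(t\<^sup>2) ^ K"] by (simp add: mult_ac)
  also have "\<dots> = ((b * \<bar>t\<bar>)\<^sup>2) ^ K" by (simp add: power_mult_distrib mult_ac)
  finally have "(\<bar>a\<bar> * \<bar>c\<bar>) ^ (2 * K) \<le> (b * \<bar>t\<bar>) ^ (2 * K)" by (simp add: power_mult)
  then show ?thesis using assms(3,4) by (subst (asm) power_mono_iff) auto
qed

lemma pattern_bound:
  assumes "accepts n r I" "\<kappa> \<in> set patterns" "n > 0"
    and "\<And>v. v < n \<Longrightarrow> (x v)\<^sup>2 = 1" "\<And>v. v < n \<Longrightarrow> (y v)\<^sup>2 = 1"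
  shows "16 * 2 ^ n * \<bar>bilinear n (sign_matrix I \<kappa>) x y\<bar> \<le> r * int (card I)"
proof -
  have "\<bar>bilinear n (sign_matrix I \<kappa>) x y\<bar> * \<bar>16 * 2 ^ n * int n\<bar> \<le> r * int (card I) * \<bar>int n\<bar>"
    using assms(1,2) unfolding accepts_def
    by (intro le_of_power_ratio[OF _ bilinear_power_le_frob_gram[of n x y _ "depth n"]])
       (auto simp: assms(4,5))
  with \<open>n > 0\<close> have "16 * 2 ^ n * \<bar>bilinear n (sign_matrix I \<kappa>) x y\<bar> * int n \<le> r * int (card I) * int n"
    by (simp add: abs_mult mult_ac)
  with \<open>n > 0\<close> show ?thesis by simp
qed

text \<open>The difference is the inner product of \<open>x\<close> with the deviations
  \<open>n * occurrences I u - card I\<close>, so Cauchy-Schwarz bounds its square by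
  \<open>irregularity n I * n\<close>.\<close>

lemma irregularity_bound:
  assumes "accepts n r I" "n > 0" "I \<subseteq> clauses n" and "\<And>v. v < n \<Longrightarrow> (x v)\<^sup>2 = 1"
  shows "16 * 2 ^ n * \<bar>int n * (\<Sum>C\<in>I. x (coord 2 C)) - int (card I) * (\<Sum>u<n. x u)\<bar>
    \<le> r * int (card I) * int n"
proof -
  define D where "D = int n * (\<Sum>C\<in>I. x (coord 2 C)) - int (card I) * (\<Sum>u<n. x u)"
  have "D = (\<Sum>u<n. (int n * occurrences I u - int (card I)) * x u)"
    by (simp add: D_def left_diff_distrib sum_subtractf mult.assoc sum_occurrences[OF assms(3)]
        flip: sum_distrib_left)
  then have "D\<^sup>2 \<le> irregularity n I * int n"
    using Cauchy_Schwarz_int[of "\<lambda>u. int n * occurrences I u - int (card I)" x "{..<n}"] assms(4)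
    by (simp add: irregularity_def)
  then have "(16 * 2 ^ n)\<^sup>2 * D\<^sup>2 \<le> (16 * 2 ^ n)\<^sup>2 * (irregularity n I * int n)"
    by (intro mult_left_mono) auto
  also have "\<dots> \<le> (r * int (card I))\<^sup>2 * int n * int n"
    using assms(1) mult_right_mono[of "irregularity n I * (16 * 2 ^ n)\<^sup>2" "(r * int (card I))\<^sup>2 * int n" "int n"]
    unfolding accepts_def by (simp add: mult_ac)
  finally have "(16 * 2 ^ n * \<bar>D\<bar>)\<^sup>2 \<le> (r * int (card I) * int n)\<^sup>2"
    by (simp add: power_mult_distrib power2_eq_square[of "int n"] mult_ac)
  moreover have "0 \<le> r * int (card I) * int n" using assms(1) unfolding accepts_def by simp
  ultimately show ?thesis unfolding D_def by (rule power2_le_imp_le)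
qed

theorem accepts_sound:
  assumes acc: "accepts n \<lfloor>2 ^ n * \<rho>\<rfloor> I" and I: "I \<subseteq> clauses n"
    and x: "x \<in> assignments n" and bias: "biased \<rho> n x"
  shows "\<not> satisfying (1 - \<rho> / 32) I x"
proof
  assume sat: "satisfying (1 - \<rho> / 32) I x"
  define r where "r = \<lfloor>2 ^ n * \<rho>\<rfloor>"
  define M where "M = int (card I)"
  have fin: "finite I" using I finite_subset finite_clauses by blast
  have rM: "r * M > 0" using acc by (simp add: accepts_def r_def M_def)
  then have "M > 0" "r > 0" by (auto simp: zero_less_mult_iff M_def)
  then have "n > 0" using I by (cases n) (auto simp: clauses_def M_def)
  define X where "X = (\<lambda>u. x (Suc u))"
  have X2: "(X u)\<^sup>2 = 1" if "u < n" for u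
    using x that by (auto simp: X_def assignments_def signs_def dest!: bspec[of _ _ "Suc u"])
  define B where "B = (\<lambda>\<kappa> y. bilinear n (sign_matrix I \<kappa>) X y)"
  define t where "t = real_of_int (r * M) / (16 * 2 ^ n)"
  have conv: "real_of_int z \<le> t" if "16 * 2 ^ n * z \<le> r * M" for z
  proof -
    have "real_of_int (16 * 2 ^ n * z) \<le> real_of_int (r * M)" using that by (subst of_int_le_iff)
    then show ?thesis by (simp add: t_def field_simps)
  qed
  have B: "\<bar>real_of_int (B \<kappa> y)\<bar> \<le> t" if "\<kappa> \<in> set patterns" "y = X \<or> y = (\<lambda>_. 1)" for \<kappa> y
    using conv[OF pattern_bound[OF acc that(1) \<open>n > 0\<close>, of X y, folded r_def M_def]] that(2) X2
    by (auto simp: B_def)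
  define S where "S = (\<Sum>C\<in>I. X (coord 2 C))"
  have S: "real n * t \<ge> \<bar>real n * real_of_int S - real_of_int M * real_of_int (\<Sum>u<n. X u)\<bar>"
  proof -
    have "real_of_int (16 * 2 ^ n * \<bar>int n * S - M * (\<Sum>u<n. X u)\<bar>) \<le> real_of_int (r * M * int n)"
      using irregularity_bound[OF acc \<open>n > 0\<close> I X2] unfolding r_def M_def S_def
      by (subst of_int_le_iff)
    then show ?thesis by (simp add: t_def field_simps)
  qed
  have sumB: "B (i, j, p) y = (\<Sum>C\<in>I. csign p C * X (coord i C) * y (coord j C))" for i j p y
    unfolding B_def using I by (rule bilinear_sign_matrix)
  define V where "V = card {C \<in> I. \<not> satisfies x C}"
  have "8 * int V = (\<Sum>C\<in>I. 8 * of_bool (\<not> satisfies x C))"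
    using fin by (simp add: V_def Int_def flip: sum_distrib_left)
  also have "\<dots> = (\<Sum>C\<in>I. \<bar>X (coord 2 C) + csign (True, True, True) C * X (coord 0 C) * X (coord 1 C)\<bar>) +
      B (0, 1, True, False, False) (\<lambda>_. 1) + B (1, 2, False, True, False) (\<lambda>_. 1) +
      B (2, 0, False, False, True) (\<lambda>_. 1) + B (0, 1, True, True, False) X +
      B (0, 2, True, False, True) X + B (1, 2, False, True, True) X"
    unfolding sumB sum.distrib[symmetric] X_def using clause_inequality[OF _ x] I
    by (intro sum.cong refl) (auto simp: subset_iff)
  \<comment> \<open>The triangle inequality moves the absolute value outside the sum over the
    clauses. Inside it remain \<open>S\<close>, which the bias makes large, and the seventh
    form.\<close>
  finally have V: "8 * int V \<ge> \<bar>S + B (0, 1, True, True, True) X\<bar> +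
      B (0, 1, True, False, False) (\<lambda>_. 1) + B (1, 2, False, True, False) (\<lambda>_. 1) +
      B (2, 0, False, False, True) (\<lambda>_. 1) + B (0, 1, True, True, False) X +
      B (0, 2, True, False, True) X + B (1, 2, False, True, True) X"
    using sum_abs[of "\<lambda>C. X (coord 2 C) + csign (True, True, True) C * X (coord 0 C) * X (coord 1 C)" I]
    by (simp add: S_def sumB sum.distrib)
  have "\<bar>real_of_int S\<bar> \<le> 8 * real V + 7 * t"
  proof -
    have "real_of_int (8 * int V) \<ge> real_of_int (\<bar>S + B (0, 1, True, True, True) X\<bar> +
      B (0, 1, True, False, False) (\<lambda>_. 1) + B (1, 2, False, True, False) (\<lambda>_. 1) +
      B (2, 0, False, False, True) (\<lambda>_. 1) + B (0, 1, True, True, False) X +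
      B (0, 2, True, False, True) X + B (1, 2, False, True, True) X)"
      using V by (subst of_int_le_iff)
    moreover have "\<bar>real_of_int (B \<kappa> y)\<bar> \<le> t" if "(\<kappa>, y) \<in>
        {((0, 1, True, False, False), \<lambda>_. 1), ((1, 2, False, True, False), \<lambda>_. 1),
         ((2, 0, False, False, True), \<lambda>_. 1), ((0, 1, True, True, False), X),
         ((0, 2, True, False, True), X), ((1, 2, False, True, True), X),
         ((0, 1, True, True, True), X)}" for \<kappa> y
      using that by (intro B) (auto simp: patterns_def)
    note this[of "(0, 1, True, False, False)" "\<lambda>_. 1"] this[of "(1, 2, False, True, False)" "\<lambda>_. 1"]
      this[of "(2, 0, False, False, True)" "\<lambda>_. 1"] this[of "(0, 1, True, True, False)" X]
      this[of "(0, 2, True, False, True)" X] this[of "(1, 2, False, True, True)" X]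
      this[of "(0, 1, True, True, True)" X]
    ultimately show ?thesis by simp
  qed
  moreover have "real V \<le> \<rho> / 32 * real_of_int M"
  proof -
    have "card I = card {C \<in> I. satisfies x C} + V"
      unfolding V_def using fin by (subst card_Un_disjoint[symmetric]) (auto intro: arg_cong[of _ _ card])
    then have "real_of_int M = real (card {C \<in> I. satisfies x C}) + real V" by (simp add: M_def)
    then show ?thesis using sat by (simp add: satisfying_def M_def algebra_simps)
  qed
  moreover have tle: "t \<le> \<rho> * real_of_int M / 16"
  proof -
    \<comment> \<open>Rounding the bias down only makes the tests stricter, so the truncation cannot
      harm soundness.\<close>
    have "real_of_int r \<le> 2 ^ n * \<rho>" by (simp add: r_def)
    then have "real_of_int r * real_of_int M \<le> 2 ^ n * \<rho> * real_of_int M"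
      using \<open>M > 0\<close> by (intro mult_right_mono) auto
    then show ?thesis by (simp add: t_def field_simps)
  qed
  moreover have "real_of_int M * \<rho> \<le> \<bar>real_of_int S\<bar> + t"
  proof -
    have "(\<Sum>i=1..n. real_of_int (x i)) = real_of_int (\<Sum>u<n. X u)"
      unfolding X_def by (simp add: sum.atLeast1_atMost_eq)
    then have "\<rho> * real n \<le> \<bar>real_of_int (\<Sum>u<n. X u)\<bar>"
      using bias \<open>n > 0\<close> by (simp add: biased_def field_simps)
    then have "real_of_int M * (\<rho> * real n) \<le> real_of_int M * \<bar>real_of_int (\<Sum>u<n. X u)\<bar>"
      using \<open>M > 0\<close> by (intro mult_left_mono) auto
    also have "\<dots> = \<bar>real_of_int M * real_of_int (\<Sum>u<n. X u)\<bar>" using \<open>M > 0\<close> by (simp add: abs_mult)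
    also have "\<dots> \<le> \<bar>real n * real_of_int S\<bar> + real n * t" using S by linarith
    also have "\<bar>real n * real_of_int S\<bar> = real n * \<bar>real_of_int S\<bar>" by (simp add: abs_mult)
    finally have "real n * (real_of_int M * \<rho>) \<le> real n * (\<bar>real_of_int S\<bar> + t)"
      by (simp add: algebra_simps)
    then show ?thesis using \<open>n > 0\<close> by simp
  qed
  moreover have "t > 0" using \<open>M > 0\<close> \<open>r > 0\<close> by (simp add: t_def)
  \<comment> \<open>The facts give \<rho> M \<le> 8 V + 8 t \<le> \<rho> M / 4 + \<rho> M / 2, while
    \<open>t > 0\<close> and \<open>tle\<close> force \<rho> M > 0.\<close>
  ultimately show False by argo
qed

section \<open>Closed walks\<close>

definition words :: "'a set \<Rightarrow> nat \<Rightarrow> 'a list set" where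
  "words A L = {cs. set cs \<subseteq> A \<and> length cs = L}"

lemma in_words [simp]: "cs \<in> words A L \<longleftrightarrow> set cs \<subseteq> A \<and> length cs = L"
  by (simp add: words_def)

lemma words_0 [simp]: "words A 0 = {[]}"
  by (auto simp: words_def)

lemma sum_words_Suc: "(\<Sum>cs\<in>words A (Suc L). f cs) = (\<Sum>C\<in>A. \<Sum>cs\<in>words A L. f (C # cs))"
proof -
  have "words A (Suc L) = (\<lambda>(C, cs). C # cs) ` (A \<times> words A L)"
    by (auto simp: words_def lists_length_Suc_eq[of A L] image_iff)
  moreover have "inj_on (\<lambda>(C, cs). C # cs) (A \<times> words A L)" by (auto simp: inj_on_def)
  ultimately show ?thesis by (simp add: sum.reindex sum.cartesian_product case_prod_unfold)
qed

text \<open>A clause is an edge between its ends \<open>e True C\<close> and \<open>e False C\<close>; the flag of a chain tells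
  at which of the two ends its first edge starts.\<close>

fun chain :: "(bool \<Rightarrow> 'c \<Rightarrow> nat) \<Rightarrow> bool \<Rightarrow> nat \<Rightarrow> 'c list \<Rightarrow> nat \<Rightarrow> bool" where
  "chain e b u [] v \<longleftrightarrow> u = v"
| "chain e b u (C # cs) v \<longleftrightarrow> e b C = u \<and> chain e (\<not> b) (e (\<not> b) C) cs v"

fun chain_sum :: "(bool \<Rightarrow> 'c \<Rightarrow> nat) \<Rightarrow> ('c \<Rightarrow> int) \<Rightarrow> 'c set \<Rightarrow> nat \<Rightarrow> bool \<Rightarrow> nat \<Rightarrow> nat \<Rightarrow> int" where
  "chain_sum e \<sigma> I 0 b u v = of_bool (u = v)"
| "chain_sum e \<sigma> I (Suc L) b u v =
    (\<Sum>C\<in>I. of_bool (e b C = u) * \<sigma> C * chain_sum e \<sigma> I L (\<not> b) (e (\<not> b) C) v)"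

lemma chain_sum_words:
  "chain_sum e \<sigma> I L b u v = (\<Sum>cs\<in>words I L. of_bool (chain e b u cs v) * prod_list (map \<sigma> cs))"
proof (induction L arbitrary: b u)
  case (Suc L)
  show ?case
    by (subst sum_words_Suc) (auto simp: Suc sum_distrib_left mult_ac intro!: sum.cong)
qed simp

text \<open>Splitting a walk after \<open>L\<close> edges is matrix multiplication. The flag has
  then been negated \<open>L\<close> times, which is what \<open>b = even L\<close> expresses: it is
  \<open>b\<close> for even \<open>L\<close> and its negation otherwise.\<close>

lemma chain_sum_add:
  assumes "\<And>C b. C \<in> I \<Longrightarrow> e b C < n" "u < n"
  shows "chain_sum e \<sigma> I (L + L') b u v =
    (\<Sum>w<n. chain_sum e \<sigma> I L b u w * chain_sum e \<sigma> I L' (b = even L) w v)"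
  using assms(2)
proof (induction L arbitrary: b u)
  case 0
  then show ?case by (simp add: sum.delta of_bool_def if_distrib[of "\<lambda>x. x * _"] cong: if_cong)
next
  case (Suc L)
  have "chain_sum e \<sigma> I (Suc L + L') b u v = (\<Sum>C\<in>I. of_bool (e b C = u) * \<sigma> C *
      (\<Sum>w<n. chain_sum e \<sigma> I L (\<not> b) (e (\<not> b) C) w * chain_sum e \<sigma> I L' ((\<not> b) = even L) w v))"
    using Suc.IH assms(1) by (simp cong: sum.cong)
  moreover have "((\<not> b) = even L) = (b = even (Suc L))" by auto
  ultimately have "chain_sum e \<sigma> I (Suc L + L') b u v = (\<Sum>C\<in>I. \<Sum>w<n. of_bool (e b C = u) * \<sigma> C *
      chain_sum e \<sigma> I L (\<not> b) (e (\<not> b) C) w * chain_sum e \<sigma> I L' (b = even (Suc L)) w v)"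
    by (simp only: sum_distrib_left mult.assoc)
  also have "\<dots> = (\<Sum>w<n. \<Sum>C\<in>I. of_bool (e b C = u) * \<sigma> C *
      chain_sum e \<sigma> I L (\<not> b) (e (\<not> b) C) w * chain_sum e \<sigma> I L' (b = even (Suc L)) w v)"
    by (rule sum.swap)
  finally show ?case by (simp add: sum_distrib_right)
qed

lemma chain_sum_1:
  "chain_sum e \<sigma> I 1 b u v = (\<Sum>C\<in>I. of_bool (e b C = u \<and> e (\<not> b) C = v) * \<sigma> C)"
  by (auto intro!: sum.cong)

text \<open>A walk read backwards starts at the end where it stopped, hence with the flag
  \<open>b = even L\<close>, and uses the same edges. In matrix terms this transposes an alternating
  product.\<close>

lemma chain_sum_reverse:
  assumes "\<And>C b. C \<in> I \<Longrightarrow> e b C < n" "u < n" "v < n"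
  shows "chain_sum e \<sigma> I L b u v = chain_sum e \<sigma> I L (b = even L) v u"
  using assms(2,3)
proof (induction L arbitrary: b u v)
  case (Suc L)
  have "chain_sum e \<sigma> I (L + 1) b u v =
      (\<Sum>w<n. chain_sum e \<sigma> I L b u w * chain_sum e \<sigma> I 1 (b = even L) w v)"
    using assms(1) Suc.prems by (intro chain_sum_add) auto
  also have "\<dots> = (\<Sum>w<n. chain_sum e \<sigma> I 1 (b \<noteq> even L) v w * chain_sum e \<sigma> I L (b = even L) w u)"
  proof (rule sum.cong)
    fix w assume "w \<in> {..<n}"
    then have "chain_sum e \<sigma> I L b u w = chain_sum e \<sigma> I L (b = even L) w u"
      using Suc.IH Suc.prems by blast
    moreover have "chain_sum e \<sigma> I 1 (b = even L) w v = chain_sum e \<sigma> I 1 (b \<noteq> even L) v w"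
      unfolding chain_sum_1 by (auto intro!: sum.cong)
    ultimately show "chain_sum e \<sigma> I L b u w * chain_sum e \<sigma> I 1 (b = even L) w v =
        chain_sum e \<sigma> I 1 (b \<noteq> even L) v w * chain_sum e \<sigma> I L (b = even L) w u" by simp
  qed simp
  also have "\<dots> = chain_sum e \<sigma> I (1 + L) (b \<noteq> even L) v u"
    using assms(1) Suc.prems by (subst chain_sum_add[of I e n]) auto
  finally show ?case by simp
qed auto

definition ends :: "nat \<Rightarrow> nat \<Rightarrow> bool \<Rightarrow> clause \<Rightarrow> nat" where
  "ends i j b = coord (if b then i else j)"

text \<open>The \<open>k\<close>-th iterate is an alternating product of \<open>2 ^ k\<close>
  factors, the matrix and its transpose in turn. Multiplying it by its own transpose appends the
  reversed walk, whose flag continues the alternation both for the odd length 1 and for the even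
  lengths after it.\<close>

lemma gram_eq_chain_sum:
  assumes "I \<subseteq> clauses n" "u < n" "v < n"
  shows "gram n (sign_matrix I (i, j, p)) k u v = chain_sum (ends i j) (csign p) I (2 ^ k) True u v"
  using assms(2,3)
proof (induction k arbitrary: u v)
  case 0
  show ?case
    by (auto simp: sign_matrix_def ends_def intro!: sum.cong)
next
  case (Suc k)
  have e: "\<And>C b. C \<in> I \<Longrightarrow> ends i j b C < n" using assms(1) by (auto simp: ends_def coord_less)
  have "chain_sum (ends i j) (csign p) I (2 ^ k + 2 ^ k) True u v =
      (\<Sum>w<n. chain_sum (ends i j) (csign p) I (2 ^ k) True u w *
        chain_sum (ends i j) (csign p) I (2 ^ k) (True = even ((2::nat) ^ k)) w v)"
    using e Suc.prems(1) by (rule chain_sum_add)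
  also have "\<dots> = (\<Sum>w<n. gram n (sign_matrix I (i, j, p)) k u w * gram n (sign_matrix I (i, j, p)) k v w)"
    using chain_sum_reverse[OF e Suc.prems(2), where L = "2 ^ k" and b = True and \<sigma> = "csign p"] Suc
    by (intro sum.cong) auto
  finally show ?case by (simp add: mult_2)
qed

text \<open>The squared Frobenius norm of a matrix is the trace of its Gram matrix, here the next
  iterate; its diagonal entries are the sums over closed walks of twice the length.\<close>

lemma frob_gram_eq_chain_sum:
  assumes "I \<subseteq> clauses n"
  shows "frob n (gram n (sign_matrix I (i, j, p)) k) =
    (\<Sum>u<n. chain_sum (ends i j) (csign p) I (2 * 2 ^ k) True u u)"
proof -
  have "frob n (gram n (sign_matrix I (i, j, p)) k) =
      (\<Sum>u<n. gram n (sign_matrix I (i, j, p)) (Suc k) u u)"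
    by (simp add: frob_def power2_eq_square)
  also have "\<dots> = (\<Sum>u<n. chain_sum (ends i j) (csign p) I (2 ^ Suc k) True u u)"
    using assms by (intro sum.cong gram_eq_chain_sum) auto
  finally show ?thesis by simp
qed

section \<open>Cancellation\<close>

text \<open>Only one sign is negated, the first that \<open>p\<close> selects, so that the product
  of the selected signs is negated exactly once. Clauses on other triples stay fixed.\<close>

definition flip :: "bool \<times> bool \<times> bool \<Rightarrow> nat \<times> nat \<times> nat \<Rightarrow> clause \<Rightarrow> clause" where
  "flip p U C = (if snd C = U then
     (case p of (p1, p2, p3) \<Rightarrow> case C of ((c1, c2, c3), _) \<Rightarrow>
       (if p1 then (-c1, c2, c3) else if p2 then (c1, -c2, c3) else (c1, c2, -c3), U)) else C)"

lemma snd_flip [simp]: "snd (flip p U C) = snd C"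
  by (auto simp: flip_def split: prod.splits)

lemma flip_flip [simp]: "flip p U (flip p U C) = C"
  by (auto simp: flip_def split: prod.splits if_splits)

lemma flip_in_clauses: "C \<in> clauses n \<Longrightarrow> flip p U C \<in> clauses n"
  by (auto simp: flip_def clauses_def signs_def split: prod.splits if_splits)

lemma csign_flip:
  "p \<noteq> (False, False, False) \<Longrightarrow> csign p (flip p U C) = (if snd C = U then - 1 else 1) * csign p C"
  by (auto simp: flip_def csign_def split: prod.splits if_splits)

lemma ends_flip [simp]: "ends i j b (flip p U C) = ends i j b C"
proof -
  have "coord k C = coord k D" if "snd C = snd D" for k C D
    using that by (cases C; cases D) (simp add: coord_def)
  from this[of "flip p U C" C] show ?thesis by (simp add: ends_def)
qed

lemma chain_flip [simp]: "chain (ends i j) b u (map (flip p U) cs) v = chain (ends i j) b u cs v"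
  by (induction cs arbitrary: b u) auto

lemma prod_csign_flip:
  assumes "p \<noteq> (False, False, False)"
  shows "prod_list (map (csign p) (map (flip p U) cs)) =
    (-1) ^ count_list (map snd cs) U * prod_list (map (csign p) cs)"
  by (induction cs) (auto simp: csign_flip[OF assms])

text \<open>Parity is counted by triple and not by clause: \<open>flip\<close> permutes the clauses
  on one triple and preserves only the counts of triples.\<close>

definition even_word :: "clause list \<Rightarrow> bool" where
  "even_word cs \<longleftrightarrow> (\<forall>U. even (count_list (map snd cs) U))"

text \<open>A sign-reversing involution: flip all clauses on one triple of odd multiplicity. The
  walk is kept because ends depend on triples only, the weight because \<open>flip\<close> is
  injective and so keeps the number of distinct clauses, and the product of signs is negated an odd
  number of times.\<close>

lemma sum_odd_words_eq_0:
  fixes q :: "nat \<Rightarrow> real"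
  assumes "p \<noteq> (False, False, False)"
  shows "(\<Sum>cs | cs \<in> words (clauses n) L \<and> \<not> even_word cs.
    of_bool (chain (ends i j) b u cs v) * real_of_int (prod_list (map (csign p) cs)) * q (card (set cs))) = 0"
    (is "sum ?F ?B = 0")
proof -
  \<comment> \<open>The choice depends on the word only through its triples, which flipping keeps.
    The same triple is therefore chosen again, and the map is its own inverse.\<close>
  define U where "U = (\<lambda>cs :: clause list. SOME U. odd (count_list (map snd cs) U))"
  define \<Phi> where "\<Phi> = (\<lambda>cs. map (flip p (U cs)) cs)"
  have snd\<Phi>: "map snd (\<Phi> cs) = map snd cs" for cs by (simp add: \<Phi>_def)
  have U\<Phi>: "U (\<Phi> cs) = U cs" for cs by (simp only: U_def snd\<Phi>)
  have inv: "\<Phi> (\<Phi> cs) = cs" for cs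
  proof -
    have "\<Phi> (\<Phi> cs) = map (flip p (U (\<Phi> cs))) (\<Phi> cs)" by (simp only: \<Phi>_def)
    then show ?thesis unfolding U\<Phi> by (simp add: \<Phi>_def o_def)
  qed
  have in_B: "\<Phi> cs \<in> ?B" if "cs \<in> ?B" for cs
    using that by (auto simp: even_word_def snd\<Phi> simp del: map_map) (auto simp: \<Phi>_def flip_in_clauses)
  have neg: "?F (\<Phi> cs) = - ?F cs" if "cs \<in> ?B" for cs
  proof -
    have odd: "odd (count_list (map snd cs) (U cs))"
      using that someI_ex[of "\<lambda>U. odd (count_list (map snd cs) U)"]
      unfolding U_def even_word_def by blast
    have "inj (flip p (U cs))" by (metis injI flip_flip)
    then have "card (set (\<Phi> cs)) = card (set cs)"
      by (simp add: \<Phi>_def card_image inj_on_subset)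
    moreover have "prod_list (map (csign p) (\<Phi> cs)) = - prod_list (map (csign p) cs)"
      unfolding \<Phi>_def prod_csign_flip[OF assms] using odd by simp
    ultimately show ?thesis by (simp add: \<Phi>_def)
  qed
  have "sum ?F ?B = sum (\<lambda>cs. ?F (\<Phi> cs)) ?B"
    by (rule sum.reindex_bij_witness[where i = \<Phi> and j = \<Phi>]) (use inv in_B in auto)
  also have "\<dots> = - sum ?F ?B" using neg by (simp add: sum_negf)
  finally show ?thesis by simp
qed

section \<open>Counting walks\<close>

text \<open>A chain with free end. The count relaxes the closing condition, so that the number of
  continuations can be bounded edge by edge.\<close>

fun traced :: "(bool \<Rightarrow> 'c \<Rightarrow> nat) \<Rightarrow> bool \<Rightarrow> nat \<Rightarrow> 'c list \<Rightarrow> bool" where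
  "traced e b u [] \<longleftrightarrow> True"
| "traced e b u (C # cs) \<longleftrightarrow> e b C = u \<and> traced e (\<not> b) (e (\<not> b) C) cs"

lemma chain_traced: "chain e b u cs v \<Longrightarrow> traced e b u cs"
  by (induction cs arbitrary: b u) auto

text \<open>\<open>H\<close> is the set of variable triples seen before.\<close>

fun step_cost :: "real \<Rightarrow> real \<Rightarrow> 'b set \<Rightarrow> ('a \<times> 'b) list \<Rightarrow> real" where
  "step_cost a a' H [] = 1"
| "step_cost a a' H (C # cs) =
    (if snd C \<in> H then a' else a) * step_cost a a' (insert (snd C) H) cs"

lemma step_cost_nonneg: "0 \<le> a \<Longrightarrow> 0 \<le> a' \<Longrightarrow> 0 \<le> step_cost a a' H cs"
  by (induction cs arbitrary: H) auto

lemma step_cost_eq: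
  assumes "a' \<noteq> 0"
  shows "step_cost a a' H cs =
    a ^ card (snd ` set cs - H) * a' ^ (length cs - card (snd ` set cs - H))"
proof (induction cs arbitrary: H)
  case (Cons C cs)
  let ?S = "snd ` set cs"
  have le: "card (?S - H') \<le> length cs" for H'
    by (metis card_mono finite_set finite_imageI Diff_subset card_image_le card_length le_trans)
  show ?case
  proof (cases "snd C \<in> H")
    case True
    then have "insert (snd C) H = H" by auto
    with True le[of H] show ?thesis by (simp add: Cons Suc_diff_le)
  next
    case False
    then have "snd ` set (C # cs) - H = insert (snd C) (?S - insert (snd C) H)" by auto
    then have "card (snd ` set (C # cs) - H) = Suc (card (?S - insert (snd C) H))" by simp
    with False show ?thesis by (simp add: Cons)
  qed
qed simp

lemma twice_card_le_length_even:
  assumes "even_word cs"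
  shows "2 * card (snd ` set cs) \<le> length cs"
proof -
  let ?l = "map snd cs"
  have "2 \<le> count_list ?l U" if "U \<in> set ?l" for U
  proof -
    have "count_list ?l U \<noteq> 0" using that by (simp only: count_list_0_iff not_not)
    moreover have "even (count_list ?l U)" using assms by (simp only: even_word_def)
    moreover have "2 \<le> k" if "k \<noteq> 0" "even k" for k :: nat using that by presburger
    ultimately show ?thesis by blast
  qed
  then have "(\<Sum>U\<in>set ?l. 2) \<le> (\<Sum>U\<in>set ?l. count_list ?l U)" by (intro sum_mono)
  also have "\<dots> = length cs" by (simp only: sum_count_set[OF subset_refl finite_set] length_map)
  finally show ?thesis by simp
qed

text \<open>At most half of the steps of an even word are new, so moving a factor \<open>y \<le> 1\<close> from the old to
  the new steps does not decrease the weight. The choice \<open>y = \<surd>(K / \<Delta>)\<close> below balances the two.\<close>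

lemma power_card_le_step_cost:
  assumes "even_word cs" "0 \<le> p" "p \<le> 1" "0 < y" "y \<le> 1"
  shows "p ^ card (set cs) \<le> step_cost (p * y) (1 / y) {} cs"
proof -
  define d where "d = card (snd ` set cs)"
  have d: "2 * d \<le> length cs" using twice_card_le_length_even[OF assms(1)] by (simp add: d_def)
  have "p ^ card (set cs) \<le> p ^ d"
    using assms by (intro power_decreasing) (auto simp: d_def card_image_le)
  also have "\<dots> \<le> p ^ d * (1 / y) ^ (length cs - 2 * d)"
    using assms by (intro mult_le_cancel_left1[THEN iffD2]) auto
  also have "\<dots> = p ^ d * (y * (1 / y)) ^ d * (1 / y) ^ (length cs - 2 * d)"
    using assms by simp
  also have "\<dots> = (p * y) ^ d * (1 / y) ^ (d + (length cs - 2 * d))"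
    unfolding power_mult_distrib power_add by (simp add: mult_ac)
  also have "d + (length cs - 2 * d) = length cs - d" using d by simp
  finally show ?thesis using assms by (simp add: step_cost_eq d_def)
qed

lemma card_signs [simp]: "card signs = 2" and finite_signs [simp]: "finite signs"
  by (simp_all add: signs_def)

lemma card_clauses: "card (clauses n) = 8 * n ^ 3"
  by (simp add: clauses_def card_cartesian_product power3_eq_cube)

lemma card_clauses_coord:
  assumes "u < n"
  shows "card {C \<in> clauses n. coord i C = u} = 8 * n\<^sup>2"
proof -
  let ?s = "signs \<times> signs \<times> signs"
  have u: "x - Suc 0 = u \<longleftrightarrow> x = Suc u" if "Suc 0 \<le> x" for x using that by auto
  consider "i = 0" | "i = 1" | "i \<noteq> 0 \<and> i \<noteq> 1" by blast
  then show ?thesis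
  proof cases
    case 1
    then have "{C \<in> clauses n. coord i C = u} = ?s \<times> {Suc u} \<times> {1..n} \<times> {1..n}"
      using assms by (auto simp: clauses_def coord_def u)
    then show ?thesis by (simp add: card_cartesian_product power2_eq_square)
  next
    case 2
    then have "{C \<in> clauses n. coord i C = u} = ?s \<times> {1..n} \<times> {Suc u} \<times> {1..n}"
      using assms by (auto simp: clauses_def coord_def u)
    then show ?thesis by (simp add: card_cartesian_product power2_eq_square)
  next
    case 3
    then have "{C \<in> clauses n. coord i C = u} = ?s \<times> {1..n} \<times> {1..n} \<times> {Suc u}"
      using assms by (auto simp: clauses_def coord_def u)
    then show ?thesis by (simp add: card_cartesian_product power2_eq_square)
  qed
qed

lemma card_clauses_snd_le:
  assumes "finite H"
  shows "card {C \<in> clauses n. snd C \<in> H} \<le> 8 * card H"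
proof -
  have "{C \<in> clauses n. snd C \<in> H} \<subseteq> (signs \<times> signs \<times> signs) \<times> H"
    by (auto simp: clauses_def)
  then have "card {C \<in> clauses n. snd C \<in> H} \<le> card ((signs \<times> signs \<times> signs) \<times> H)"
    using assms by (intro card_mono) auto
  then show ?thesis by (simp add: card_cartesian_product)
qed

text \<open>Of the clauses, \<open>8 * n^2\<close> have a prescribed variable at the current end,
  which bounds the new steps. At most \<open>2 * K\<close> triples have been seen, each with 8
  clauses, which bounds the old steps by \<open>16 * K\<close>. The invariant
  \<open>card H + L \<le> 2 * K\<close> survives because each step adds at most one triple.\<close>

lemma sum_step_cost_le:
  assumes "u < n" "finite H" "0 \<le> a" "0 \<le> a'" "card H + L \<le> 2 * K"
  shows "(\<Sum>cs\<in>words (clauses n) L. of_bool (traced (ends i j) b u cs) * step_cost a a' H cs)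
    \<le> (8 * real n ^ 2 * a + 16 * real K * a') ^ L"
  using assms(1,2,5)
proof (induction L arbitrary: b u H)
  case (Suc L)
  let ?R = "8 * real n ^ 2 * a + 16 * real K * a'"
  have R: "0 \<le> ?R" using assms by simp
  have "(\<Sum>cs\<in>words (clauses n) (Suc L). of_bool (traced (ends i j) b u cs) * step_cost a a' H cs) =
    (\<Sum>C\<in>clauses n. of_bool (ends i j b C = u) * (if snd C \<in> H then a' else a) *
      (\<Sum>cs\<in>words (clauses n) L. of_bool (traced (ends i j) (\<not> b) (ends i j (\<not> b) C) cs) *
        step_cost a a' (insert (snd C) H) cs))"
    by (subst sum_words_Suc) (auto simp: sum_distrib_left mult_ac intro!: sum.cong)
  also have "\<dots> \<le> (\<Sum>C\<in>clauses n. of_bool (ends i j b C = u) * (if snd C \<in> H then a' else a) * ?R ^ L)"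
  proof (intro sum_mono mult_left_mono)
    fix C assume "C \<in> clauses n"
    then have "ends i j (\<not> b) C < n" by (simp add: ends_def coord_less)
    moreover have "card (insert (snd C) H) + L \<le> 2 * K"
      using Suc.prems by (simp add: card_insert_if)
    ultimately show "(\<Sum>cs\<in>words (clauses n) L. of_bool (traced (ends i j) (\<not> b) (ends i j (\<not> b) C) cs) *
        step_cost a a' (insert (snd C) H) cs) \<le> ?R ^ L"
      using Suc.prems by (intro Suc.IH) auto
  qed (use assms in auto)
  also have "\<dots> \<le> (\<Sum>C\<in>clauses n. of_bool (ends i j b C = u) * a * ?R ^ L + of_bool (snd C \<in> H) * a' * ?R ^ L)"
    using assms R by (intro sum_mono) auto
  also have "\<dots> = (real (card {C \<in> clauses n. ends i j b C = u}) * a +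
      real (card {C \<in> clauses n. snd C \<in> H}) * a') * ?R ^ L"
    by (simp add: sum.distrib distrib_right Int_def flip: sum_distrib_right)
  also have "\<dots> \<le> ?R * ?R ^ L"
  proof (intro mult_right_mono add_mono)
    show "real (card {C \<in> clauses n. ends i j b C = u}) \<le> 8 * real n ^ 2"
      unfolding ends_def using Suc.prems by (simp add: card_clauses_coord)
    have "card {C \<in> clauses n. snd C \<in> H} \<le> 16 * K"
      using card_clauses_snd_le[OF Suc.prems(2), of n] Suc.prems by simp
    then show "real (card {C \<in> clauses n. snd C \<in> H}) \<le> 16 * real K" by linarith
  qed (use assms R in auto)
  finally show ?case by simp
qed simp

lemma finite_words [simp]: "finite A \<Longrightarrow> finite (words A L)"
  using finite_lists_length_eq[of A L] by (simp add: words_def)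

lemma finite_words_filter: "finite A \<Longrightarrow> finite {cs. set cs \<subseteq> A \<and> length cs = L \<and> P cs}"
  by (rule finite_subset[OF _ finite_words[of A L]]) auto

lemma abs_prod_csign_le:
  assumes "cs \<in> words (clauses n) L"
  shows "\<bar>prod_list (map (csign p) cs)\<bar> \<le> 1"
proof -
  have 1: "\<bar>csign p C\<bar> \<le> 1" if "C \<in> clauses n" for C
    using that by (auto simp: csign_def clauses_def signs_def split: prod.splits)
  have "set cs \<subseteq> clauses n \<Longrightarrow> \<bar>prod_list (map (csign p) cs)\<bar> \<le> 1" for cs
  proof (induction cs)
    case (Cons C cs)
    then have "\<bar>csign p C\<bar> * \<bar>prod_list (map (csign p) cs)\<bar> \<le> 1 * 1"
      by (intro mult_mono 1) auto
    then show ?case by (simp add: abs_mult)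
  qed simp
  with assms show ?thesis by simp
qed

text \<open>Signs are bounded by absolute values only after the odd words have cancelled. Without
  the cancellation, words made of new triples alone would contribute about \<Delta>^(2K) per
  starting point instead of (289 \<Delta> K)^K.\<close>

theorem closed_walk_sum_le:
  fixes q \<Delta> :: real
  assumes p: "p \<noteq> (False, False, False)" and q: "0 \<le> q" "q \<le> 1" and K: "K > 0"
    and \<Delta>: "8 * real n ^ 2 * q = \<Delta>" "real K \<le> \<Delta>"
  shows "(\<Sum>u<n. \<Sum>cs\<in>words (clauses n) (2 * K). of_bool (chain (ends i j) True u cs u) *
      real_of_int (prod_list (map (csign p) cs)) * q ^ card (set cs)) \<le> real n * (289 * \<Delta> * real K) ^ K"
proof -
  define y where "y = sqrt (real K / \<Delta>)"
  have "\<Delta> > 0" using K \<Delta> by linarith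
  then have y: "0 < y" "y \<le> 1" using K \<Delta> by (auto simp: y_def)
  \<comment> \<open>New steps contribute \<Delta> y and old ones 16 K / y. The choice of
    \<open>y\<close> makes \<Delta> y = K / y, both equal to the square root of \<Delta> K, so the
    sum has the factor 1 + 16 = 17, and 289 is its square.\<close>
  have rate: "8 * real n ^ 2 * (q * y) + 16 * real K * (1 / y) = 17 * sqrt (\<Delta> * real K)"
  proof -
    have "\<Delta> * real K = \<Delta>\<^sup>2 * (real K / \<Delta>)" using \<open>\<Delta> > 0\<close> by (simp add: power2_eq_square)
    then have 1: "sqrt (\<Delta> * real K) = \<Delta> * y"
      using \<open>\<Delta> > 0\<close> by (simp only: real_sqrt_mult real_sqrt_abs y_def abs_of_pos)
    have "y * y = real K / \<Delta>" using \<open>\<Delta> > 0\<close> by (simp add: y_def)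
    then have "real K = \<Delta> * y * y" using \<open>\<Delta> > 0\<close> by (simp add: field_simps)
    then have 2: "real K / y = \<Delta> * y" using y by (metis nonzero_mult_div_cancel_right less_irrefl)
    have "8 * real n ^ 2 * (q * y) = \<Delta> * y" using \<Delta>(1) by (simp flip: mult.assoc)
    moreover have "16 * real K * (1 / y) = 16 * (real K / y)" by simp
    ultimately show ?thesis unfolding 1 2 by linarith
  qed
  have "(\<Sum>cs\<in>words (clauses n) (2 * K). of_bool (chain (ends i j) True u cs u) *
      real_of_int (prod_list (map (csign p) cs)) * q ^ card (set cs)) \<le> (289 * \<Delta> * real K) ^ K"
    (is "sum ?F ?W \<le> _") if "u < n" for u
  proof -
    have "sum ?F ?W = sum ?F {cs \<in> ?W. even_word cs} + sum ?F {cs \<in> ?W. \<not> even_word cs}"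
      by (subst sum.union_disjoint[symmetric]) (auto simp: finite_words_filter intro!: sum.cong)
    also have "sum ?F {cs \<in> ?W. \<not> even_word cs} = 0"
      using sum_odd_words_eq_0[OF p, where q = "\<lambda>k. q ^ k"] by simp
    also have "sum ?F {cs \<in> ?W. even_word cs} + 0 \<le> (\<Sum>cs | cs \<in> ?W \<and> even_word cs.
        of_bool (traced (ends i j) True u cs) * step_cost (q * y) (1 / y) {} cs)"
      unfolding add_0_right
    proof (rule sum_mono)
      fix cs assume cs: "cs \<in> {cs \<in> ?W. even_word cs}"
      have "real_of_int (prod_list (map (csign p) cs)) \<le> 1"
        using abs_prod_csign_le[of cs n "2 * K" p] cs by auto
      then have "real_of_int (prod_list (map (csign p) cs)) * q ^ card (set cs) \<le> 1 * q ^ card (set cs)"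
        using q by (intro mult_right_mono) auto
      also have "\<dots> \<le> step_cost (q * y) (1 / y) {} cs"
        using power_card_le_step_cost[of cs q y] cs q y by simp
      finally show "?F cs \<le> of_bool (traced (ends i j) True u cs) * step_cost (q * y) (1 / y) {} cs"
        using chain_traced[of "ends i j" True u cs u] step_cost_nonneg[of "q * y" "1 / y" "{}" cs] q y
        by (auto simp: of_bool_def)
    qed
    also have "\<dots> \<le> (\<Sum>cs\<in>?W. of_bool (traced (ends i j) True u cs) * step_cost (q * y) (1 / y) {} cs)"
      using q y by (intro sum_mono2) (auto intro!: step_cost_nonneg)
    also have "\<dots> \<le> (8 * real n ^ 2 * (q * y) + 16 * real K * (1 / y)) ^ (2 * K)"
      using that q y by (intro sum_step_cost_le) auto
    also have "\<dots> = ((17 * sqrt (\<Delta> * real K))\<^sup>2) ^ K" by (simp only: rate power_mult)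
    also have "(17 * sqrt (\<Delta> * real K))\<^sup>2 = 289 * \<Delta> * real K"
      using \<open>\<Delta> > 0\<close> by (simp add: power_mult_distrib)
    finally show ?thesis .
  qed
  then have "(\<Sum>u<n. \<Sum>cs\<in>words (clauses n) (2 * K). of_bool (chain (ends i j) True u cs u) *
      real_of_int (prod_list (map (csign p) cs)) * q ^ card (set cs)) \<le> (\<Sum>u<n. (289 * \<Delta> * real K) ^ K)"
    by (intro sum_mono) auto
  then show ?thesis by simp
qed

section \<open>Moments of the random hypergraph\<close>

lemma prob_le_expectation:
  fixes f :: "'a \<Rightarrow> real"
  assumes "finite (set_pmf D)" "\<And>x. x \<in> set_pmf D \<Longrightarrow> 0 \<le> f x" "c > 0"
  shows "measure_pmf.prob D {x. f x \<ge> c} \<le> measure_pmf.expectation D f / c"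
proof -
  have "AE x in measure_pmf D. 0 \<le> f x" using assms(2) by (simp add: AE_measure_pmf_iff)
  then have "measure (measure_pmf D) {x \<in> space (measure_pmf D). f x \<ge> c} \<le> measure_pmf.expectation D f / c"
    by (intro integral_Markov_inequality_measure) (auto intro: integrable_measure_pmf_finite assms)
  then show ?thesis by simp
qed

lemma set_random_hypergraph: "set_pmf (random_hypergraph m n) \<subseteq> Pow (clauses n)"
  by (auto simp: random_hypergraph_def)

lemma finite_set_random_hypergraph [simp]: "finite (set_pmf (random_hypergraph m n))"
  by (rule finite_subset[OF set_random_hypergraph]) simp

lemma AE_random_hypergraph:
  "(\<And>I. I \<subseteq> clauses n \<Longrightarrow> P I) \<Longrightarrow> AE I in random_hypergraph m n. P I"
  unfolding AE_measure_pmf_iff using set_random_hypergraph[of m n] by (meson PowD subsetD)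

lemma expectation_sum:
  fixes f :: "'b \<Rightarrow> 'a \<Rightarrow> real"
  assumes "finite (set_pmf D)"
  shows "measure_pmf.expectation D (\<lambda>x. \<Sum>i\<in>A. f i x) = (\<Sum>i\<in>A. measure_pmf.expectation D (f i))"
  by (intro Bochner_Integration.integral_sum integrable_measure_pmf_finite assms)

lemma expectation_mult_left:
  fixes f :: "'a \<Rightarrow> real"
  shows "measure_pmf.expectation D (\<lambda>x. c * f x) = c * measure_pmf.expectation D f"
  by simp

text \<open>The bound \<open>m_le\<close> makes \<open>q\<close> a genuine probability, so that no
  clipping occurs. The clipped range is treated separately as the complete hypergraph.\<close>

locale random_instance =
  fixes n :: nat and m q :: real
  assumes m_nonneg: "0 \<le> m" and m_le: "m \<le> 8 * real n ^ 3" and n_pos: "n > 0"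
  defines "q \<equiv> m / (8 * real n ^ 3)"
begin

lemma q_bounds: "0 \<le> q" "q \<le> 1"
  using m_nonneg m_le n_pos by (auto simp: q_def)

abbreviation "\<H> \<equiv> random_hypergraph m n"

lemma expectation_subset:
  assumes "S \<subseteq> clauses n"
  shows "measure_pmf.expectation \<H> (\<lambda>I. of_bool (S \<subseteq> I)) = q ^ card S"
proof -
  let ?B = "\<lambda>C. if C \<in> S then {True} else UNIV"
  have "measure_pmf.expectation \<H> (\<lambda>I. of_bool (S \<subseteq> I)) = measure_pmf.prob \<H> {I. S \<subseteq> I}"
  proof -
    have "(\<lambda>I. of_bool (S \<subseteq> I)) = (indicator {I. S \<subseteq> I} :: _ \<Rightarrow> real)" by (auto simp: indicator_def)
    then show ?thesis by simp
  qed
  also have "\<dots> = measure_pmf.prob (Pi_pmf (clauses n) False (\<lambda>_. bernoulli_pmf q)) (Pi (clauses n) ?B)"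
    unfolding random_hypergraph_def q_def[symmetric] measure_map_pmf
    using assms by (intro arg_cong[of _ _ "measure_pmf.prob _"]) (auto simp: Pi_def)
  also have "\<dots> = (\<Prod>C\<in>clauses n. measure_pmf.prob (bernoulli_pmf q) (?B C))"
    by (rule measure_Pi_pmf_Pi) simp
  also have "\<dots> = (\<Prod>C\<in>clauses n. if C \<in> S then q else 1)"
    using q_bounds by (intro prod.cong) (auto simp: measure_pmf_single)
  also have "\<dots> = q ^ card S"
    using assms by (simp add: prod.If_cases Int_absorb1)
  finally show ?thesis .
qed

text \<open>The sum over words in the random \<open>I\<close> becomes a sum over all words with the
  indicator of \<open>set cs \<subseteq> I\<close>. Its expectation is a power of \<open>q\<close>
  in which a repeated clause counts once, and this is what \<open>closed_walk_sum_le\<close>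
  weighs.\<close>

lemma expectation_frob_le:
  assumes "p \<noteq> (False, False, False)" and "2 ^ k \<le> m / real n"
  shows "measure_pmf.expectation \<H> (\<lambda>I. real_of_int (frob n (gram n (sign_matrix I (i, j, p)) k)))
    \<le> real n * (289 * (m / real n) * 2 ^ k) ^ 2 ^ k"
proof -
  let ?K = "2 ^ k :: nat"
  let ?W = "words (clauses n) (2 * ?K)"
  let ?c = "\<lambda>u cs. of_bool (chain (ends i j) True u cs u) * real_of_int (prod_list (map (csign p) cs))"
  have "measure_pmf.expectation \<H> (\<lambda>I. real_of_int (frob n (gram n (sign_matrix I (i, j, p)) k))) =
    measure_pmf.expectation \<H> (\<lambda>I. \<Sum>u<n. \<Sum>cs\<in>?W. ?c u cs * of_bool (set cs \<subseteq> I))"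
  proof (intro integral_cong_AE)
    have "real_of_int (frob n (gram n (sign_matrix I (i, j, p)) k)) =
        (\<Sum>u<n. \<Sum>cs\<in>?W. ?c u cs * of_bool (set cs \<subseteq> I))" if I: "I \<subseteq> clauses n" for I
    proof -
      have "real_of_int (chain_sum (ends i j) (csign p) I (2 * ?K) True u u) =
          (\<Sum>cs\<in>?W. ?c u cs * of_bool (set cs \<subseteq> I))" for u
      proof -
        have "real_of_int (chain_sum (ends i j) (csign p) I (2 * ?K) True u u) =
            (\<Sum>cs\<in>words I (2 * ?K). ?c u cs * of_bool (set cs \<subseteq> I))"
          by (simp add: chain_sum_words)
        also have "\<dots> = (\<Sum>cs\<in>?W. ?c u cs * of_bool (set cs \<subseteq> I))"
          using I by (intro sum.mono_neutral_left) (auto simp: subset_iff)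
        finally show ?thesis .
      qed
      then show ?thesis by (simp add: frob_gram_eq_chain_sum[OF I])
    qed
    then show "AE I in \<H>. real_of_int (frob n (gram n (sign_matrix I (i, j, p)) k)) =
        (\<Sum>u<n. \<Sum>cs\<in>?W. ?c u cs * of_bool (set cs \<subseteq> I))"
      by (rule AE_random_hypergraph)
  qed auto
  also have "\<dots> = (\<Sum>u<n. \<Sum>cs\<in>?W. ?c u cs * measure_pmf.expectation \<H> (\<lambda>I. of_bool (set cs \<subseteq> I)))"
    by (simp only: expectation_sum[OF finite_set_random_hypergraph] expectation_mult_left)
  also have "\<dots> = (\<Sum>u<n. \<Sum>cs\<in>?W. ?c u cs * q ^ card (set cs))"
    by (intro sum.cong refl arg_cong2[of _ _ _ _ "(*)"] expectation_subset) auto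
  also have "\<dots> \<le> real n * (289 * (m / real n) * real ?K) ^ ?K"
  proof (rule closed_walk_sum_le[OF assms(1)])
    show "8 * real n ^ 2 * q = m / real n"
      using n_pos by (simp add: q_def power2_eq_square power3_eq_cube)
  qed (use q_bounds assms(2) in auto)
  finally show ?thesis by simp
qed

text \<open>Presence indicators of different clauses are independent with mean \<open>q\<close>, so
  the mixed terms vanish and each square contributes the variance \<open>q - q^2\<close>.\<close>

lemma expectation_linear_square:
  fixes a :: "clause \<Rightarrow> real"
  shows "measure_pmf.expectation \<H> (\<lambda>I. (\<Sum>C\<in>clauses n. a C * (of_bool (C \<in> I) - q))\<^sup>2) \<le>
    q * (\<Sum>C\<in>clauses n. (a C)\<^sup>2)"
proof -
  let ?C = "clauses n"
  have "measure_pmf.expectation \<H> (\<lambda>I. (\<Sum>C\<in>?C. a C * (of_bool (C \<in> I) - q))\<^sup>2) =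
    measure_pmf.expectation \<H> (\<lambda>I. \<Sum>C\<in>?C. \<Sum>D\<in>?C. (a C * a D) *
      ((of_bool (C \<in> I) - q) * (of_bool (D \<in> I) - q)))"
    by (simp add: power2_eq_square sum_product mult_ac)
  also have "\<dots> = (\<Sum>C\<in>?C. \<Sum>D\<in>?C. (a C * a D) *
      measure_pmf.expectation \<H> (\<lambda>I. (of_bool (C \<in> I) - q) * (of_bool (D \<in> I) - q)))"
    by (simp only: expectation_sum[OF finite_set_random_hypergraph] expectation_mult_left)
  also have "\<dots> = (\<Sum>C\<in>?C. \<Sum>D\<in>?C. (a C * a D) * (if C = D then q - q\<^sup>2 else 0))"
  proof (intro sum.cong refl arg_cong2[of _ _ _ _ "(*)"])
    fix C D assume CD: "C \<in> ?C" "D \<in> ?C"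
    have int: "integrable \<H> f" for f :: "clause set \<Rightarrow> real"
      by (intro integrable_measure_pmf_finite) simp
    have "measure_pmf.expectation \<H> (\<lambda>I. (of_bool (C \<in> I) - q) * (of_bool (D \<in> I) - q)) =
      measure_pmf.expectation \<H> (\<lambda>I. of_bool ({C, D} \<subseteq> I) - q * of_bool ({C} \<subseteq> I)
        - q * of_bool ({D} \<subseteq> I) + q\<^sup>2)"
      by (intro Bochner_Integration.integral_cong) (auto simp: algebra_simps power2_eq_square)
    also have "\<dots> = measure_pmf.expectation \<H> (\<lambda>I. of_bool ({C, D} \<subseteq> I))
        - q * measure_pmf.expectation \<H> (\<lambda>I. of_bool ({C} \<subseteq> I))
        - q * measure_pmf.expectation \<H> (\<lambda>I. of_bool ({D} \<subseteq> I)) + q\<^sup>2"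
      using int by simp
    also have "\<dots> = (if C = D then q - q\<^sup>2 else 0)"
    proof -
      have "measure_pmf.expectation \<H> (\<lambda>I. of_bool ({C, D} \<subseteq> I)) = q ^ card {C, D}"
        "measure_pmf.expectation \<H> (\<lambda>I. of_bool ({C} \<subseteq> I)) = q ^ card {C}"
        "measure_pmf.expectation \<H> (\<lambda>I. of_bool ({D} \<subseteq> I)) = q ^ card {D}"
        using CD by (intro expectation_subset; simp)+
      then show ?thesis by (simp add: power2_eq_square card_insert_if del: insert_subset)
    qed
    finally show "measure_pmf.expectation \<H> (\<lambda>I. (of_bool (C \<in> I) - q) * (of_bool (D \<in> I) - q)) =
      (if C = D then q - q\<^sup>2 else 0)" .
  qed
  also have "\<dots> = (\<Sum>C\<in>?C. (a C)\<^sup>2 * (q - q\<^sup>2))"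
    by (simp add: if_distrib[of "\<lambda>x. _ * x"] sum.delta power2_eq_square cong: if_cong)
  also have "\<dots> \<le> (\<Sum>C\<in>?C. (a C)\<^sup>2 * q)" by (intro sum_mono mult_left_mono) auto
  finally show ?thesis by (simp add: sum_distrib_left mult.commute)
qed

lemma q_times: "q * (8 * real n ^ 3) = m"
  using n_pos by (simp add: q_def)

lemma expectation_card_variance_le:
  "measure_pmf.expectation \<H> (\<lambda>I. (real (card I) - m)\<^sup>2) \<le> m"
proof -
  have "measure_pmf.expectation \<H> (\<lambda>I. (real (card I) - m)\<^sup>2) =
      measure_pmf.expectation \<H> (\<lambda>I. (\<Sum>C\<in>clauses n. 1 * (of_bool (C \<in> I) - q))\<^sup>2)"
  proof (intro integral_cong_AE)
    have "real (card I) - m = (\<Sum>C\<in>clauses n. 1 * (of_bool (C \<in> I) - q))" if "I \<subseteq> clauses n" for I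
      using that q_times by (simp add: sum_subtractf card_clauses Int_absorb1 mult.commute)
    then show "AE I in \<H>. (real (card I) - m)\<^sup>2 = (\<Sum>C\<in>clauses n. 1 * (of_bool (C \<in> I) - q))\<^sup>2"
      by (intro AE_random_hypergraph) (simp only:)
  qed auto
  also have "\<dots> \<le> q * (\<Sum>C\<in>clauses n. 1\<^sup>2)" by (rule expectation_linear_square)
  also have "\<dots> = m" using q_times by (simp add: card_clauses)
  finally show ?thesis .
qed

lemma expectation_irregularity_le:
  "measure_pmf.expectation \<H> (\<lambda>I. real_of_int (irregularity n I)) \<le> m * real n ^ 2"
proof -
  let ?a = "\<lambda>u C. real n * of_bool (coord 2 C = u) - 1"
  have "measure_pmf.expectation \<H> (\<lambda>I. real_of_int (irregularity n I)) =
      measure_pmf.expectation \<H> (\<lambda>I. \<Sum>u<n. (\<Sum>C\<in>clauses n. ?a u C * (of_bool (C \<in> I) - q))\<^sup>2)"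
  proof (intro integral_cong_AE)
    have "real n * real_of_int (occurrences I u) - real (card I) =
        (\<Sum>C\<in>clauses n. ?a u C * (of_bool (C \<in> I) - q))" if I: "I \<subseteq> clauses n" and "u < n" for I u
    proof -
      have "(\<Sum>C\<in>clauses n. ?a u C * (of_bool (C \<in> I) - q)) =
          (\<Sum>C\<in>clauses n. ?a u C * of_bool (C \<in> I)) - q * (\<Sum>C\<in>clauses n. ?a u C)"
        unfolding right_diff_distrib[of "?a u _"] sum_subtractf[of "\<lambda>C. ?a u C * _ C"]
        by (simp only: mult.commute[of q] sum_distrib_right)
      \<comment> \<open>Every variable is third in exactly an \<open>n\<close>-th of all clauses.
        The coefficients thus sum to zero, and centring the indicators changes nothing.\<close>
      also have "(\<Sum>C\<in>clauses n. ?a u C) = 0"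
        using card_clauses_coord[OF \<open>u < n\<close>, of 2]
        by (simp add: sum_subtractf card_clauses Int_def power2_eq_square power3_eq_cube flip: sum_distrib_left)
      also have "(\<Sum>C\<in>clauses n. ?a u C * of_bool (C \<in> I)) = (\<Sum>C\<in>I. ?a u C)"
        using I by (intro sum.mono_neutral_cong_right) auto
      also have "\<dots> = real n * real_of_int (occurrences I u) - real (card I)"
        using finite_subset[OF I finite_clauses]
        by (simp add: sum_subtractf occurrences_def Int_def flip: sum_distrib_left)
      finally show ?thesis by simp
    qed
    then have "real_of_int (irregularity n I) =
        (\<Sum>u<n. (\<Sum>C\<in>clauses n. ?a u C * (of_bool (C \<in> I) - q))\<^sup>2)" if "I \<subseteq> clauses n" for I
      using that by (simp add: irregularity_def)
    then show "AE I in \<H>. real_of_int (irregularity n I) =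
        (\<Sum>u<n. (\<Sum>C\<in>clauses n. ?a u C * (of_bool (C \<in> I) - q))\<^sup>2)"
      by (rule AE_random_hypergraph)
  qed auto
  also have "\<dots> = (\<Sum>u<n. measure_pmf.expectation \<H>
      (\<lambda>I. (\<Sum>C\<in>clauses n. ?a u C * (of_bool (C \<in> I) - q))\<^sup>2))"
    by (rule expectation_sum) simp
  also have "\<dots> \<le> (\<Sum>u<n. q * (\<Sum>C\<in>clauses n. (?a u C)\<^sup>2))"
    by (intro sum_mono expectation_linear_square)
  also have "\<dots> = q * (\<Sum>C\<in>clauses n. \<Sum>u<n. (?a u C)\<^sup>2)"
    by (subst sum.swap) (simp add: sum_distrib_left)
  also have "\<dots> \<le> q * (\<Sum>C\<in>clauses n. real n ^ 2)"
  proof (intro mult_left_mono sum_mono)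
    fix C assume "C \<in> clauses n"
    then have "coord 2 C < n" by (rule coord_less)
    have "(\<Sum>u<n. (?a u C)\<^sup>2) = (\<Sum>u<n. 1 + (if coord 2 C = u then real n ^ 2 - 2 * real n else 0))"
      by (intro sum.cong) (auto simp: power2_eq_square algebra_simps)
    also have "\<dots> = real n + (real n ^ 2 - 2 * real n)"
      using \<open>coord 2 C < n\<close> by (simp only: sum.distrib sum.delta') simp
    finally show "(\<Sum>u<n. (?a u C)\<^sup>2) \<le> real n ^ 2" by simp
  qed (rule q_bounds)
  also have "\<dots> = q * (8 * real n ^ 3) * real n ^ 2" by (simp add: card_clauses)
  finally show ?thesis by (simp only: q_times)
qed

end

section \<open>Programs that fill arrays by accumulation\<close>

fun weight :: "exp \<Rightarrow> nat" where
  "weight (Const k) = int_size k + 1"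
| "weight (Cell a e) = weight e + 1"
| "weight (Add e f) = weight e + weight f + 1"
| "weight (Sub e f) = weight e + weight f + 1"
| "weight (Mul e f) = weight e + weight f + 1"
| "weight (Quot e f) = weight e + weight f + 1"

definition bounded_by :: "nat \<Rightarrow> state \<Rightarrow> bool" where
  "bounded_by b s \<longleftrightarrow> (\<forall>a x. \<bar>s a x\<bar> < 2 ^ b)"

lemma floorlog_le_of_less_power: "k < 2 ^ b \<Longrightarrow> floorlog 2 k \<le> b"
  by (rule floorlog_leI) auto

lemma int_size_le: "\<bar>k\<bar> < 2 ^ b \<Longrightarrow> int_size k \<le> 1 + b"
proof -
  assume "\<bar>k\<bar> < 2 ^ b"
  then have "nat \<bar>k\<bar> < 2 ^ b" by (simp add: nat_less_iff)
  then show ?thesis by (simp add: int_size_def floorlog_le_of_less_power)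
qed

lemma less_power_int_size: "\<bar>k\<bar> < 2 ^ int_size k"
proof -
  have "nat \<bar>k\<bar> < 2 ^ floorlog 2 (nat \<bar>k\<bar>)" using floorlog_bounds[of "nat \<bar>k\<bar>" 2]
    by (cases "k = 0") (auto simp: floorlog_def)
  then have "\<bar>k\<bar> < 2 ^ floorlog 2 (nat \<bar>k\<bar>)" by (simp add: nat_less_iff)
  also have "\<dots> \<le> 2 ^ int_size k" by (intro power_increasing) (auto simp: int_size_def)
  finally show ?thesis .
qed

lemma abs_div_le_abs: "\<bar>x div y\<bar> \<le> \<bar>x\<bar>" for x y :: int
proof -
  let ?t = "real_of_int x / real_of_int y"
  have "\<bar>?t\<bar> \<le> real_of_int \<bar>x\<bar>"
  proof (cases "y = 0")
    case False
    then have "1 \<le> \<bar>real_of_int y\<bar>" by linarith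
    then have "\<bar>real_of_int x\<bar> * 1 \<le> \<bar>real_of_int x\<bar> * \<bar>real_of_int y\<bar>" by (intro mult_left_mono) auto
    with False show ?thesis by (simp add: abs_divide divide_le_eq)
  qed simp
  then have "\<lfloor>?t\<rfloor> \<le> \<bar>x\<bar>" "- \<bar>x\<bar> \<le> \<lfloor>?t\<rfloor>" by linarith+
  then show ?thesis by (simp add: floor_divide_of_int_eq)
qed

text \<open>Lengths at most add up under the operations, with one spare bit per node for a carry. A
  memory access starts afresh with \<open>b\<close> bits however large the address is, since
  \<open>bounded_by\<close> covers all addresses; a quotient is no longer than its dividend, also
  for division by 0.\<close>

lemma abs_val_less:
  assumes "bounded_by b s" "b \<ge> 1"
  shows "\<bar>val e s\<bar> < 2 ^ (b * weight e)"
proof (induction e)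
  case (Const k)
  have "\<bar>k\<bar> < 2 ^ int_size k" by (rule less_power_int_size)
  also have "\<dots> \<le> 2 ^ (b * weight (Const k))"
  proof (intro power_increasing)
    have "1 * int_size k \<le> b * weight (Const k)" using assms by (intro mult_mono) auto
    then show "int_size k \<le> b * weight (Const k)" by simp
  qed simp
  finally show ?case by simp
next
  case (Cell a e)
  have "\<bar>s a (val e s)\<bar> < 2 ^ b" using assms by (simp add: bounded_by_def)
  also have "\<dots> \<le> 2 ^ (b * weight (Cell a e))" by (intro power_increasing) auto
  finally show ?case by simp
next
  case (Add e f)
  have "\<bar>val e s + val f s\<bar> < 2 ^ (b * weight e) + 2 ^ (b * weight f)" using Add by linarith
  also have "\<dots> \<le> 2 ^ (b * (weight e + weight f)) + 2 ^ (b * (weight e + weight f))"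
    by (intro add_mono power_increasing) auto
  also have "\<dots> = 2 ^ (1 + b * (weight e + weight f))" by simp
  also have "\<dots> \<le> 2 ^ (b * weight (Add e f))" using assms by (intro power_increasing) auto
  finally show ?case by simp
next
  case (Sub e f)
  have "\<bar>val e s - val f s\<bar> < 2 ^ (b * weight e) + 2 ^ (b * weight f)" using Sub by linarith
  also have "\<dots> \<le> 2 ^ (b * (weight e + weight f)) + 2 ^ (b * (weight e + weight f))"
    by (intro add_mono power_increasing) auto
  also have "\<dots> = 2 ^ (1 + b * (weight e + weight f))" by simp
  also have "\<dots> \<le> 2 ^ (b * weight (Sub e f))" using assms by (intro power_increasing) auto
  finally show ?case by simp
next
  case (Mul e f)
  have "\<bar>val e s * val f s\<bar> < 2 ^ (b * weight e) * 2 ^ (b * weight f)"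
    unfolding abs_mult using Mul by (intro mult_strict_mono') auto
  also have "\<dots> = 2 ^ (b * (weight e + weight f))" by (simp add: power_add algebra_simps)
  also have "\<dots> \<le> 2 ^ (b * weight (Mul e f))" by (intro power_increasing) auto
  finally show ?case by simp
next
  case (Quot e f)
  have "\<bar>val e s div val f s\<bar> < 2 ^ (b * weight e)"
    using abs_div_le_abs[of "val e s" "val f s"] Quot by linarith
  also have "\<dots> \<le> 2 ^ (b * weight (Quot e f))"
    by (intro power_increasing) (auto simp: algebra_simps)
  finally show ?case by simp
qed

text \<open>Each node is charged the length of its value, at most \<open>1 + b * weight e\<close>,
  and there are at most \<open>weight e\<close> nodes; hence the square.\<close>

lemma cost_le:
  assumes "bounded_by b s" "b \<ge> 1"
  shows "cost e s \<le> (weight e)\<^sup>2 * (b + 1)"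
proof -
  define B where "B = 1 + b * weight e"
  have size: "int_size (val e' s) \<le> B" if "weight e' \<le> weight e" for e'
  proof -
    have "int_size (val e' s) \<le> 1 + b * weight e'"
      using abs_val_less[OF assms] by (rule int_size_le)
    also have "\<dots> \<le> B" unfolding B_def using that by simp
    finally show ?thesis .
  qed
  have "weight e' \<le> weight e \<Longrightarrow> cost e' s \<le> weight e' * B" for e'
  proof (induction e')
    case (Const k)
    have "int_size k \<le> (int_size k + 1) * B" by (simp add: B_def)
    then show ?case by simp
  next
    case (Cell a e')
    then show ?case using size[of "Cell a e'"] by simp
  next
    case (Add e1 e2)
    then show ?case using size[of "Add e1 e2"] by (simp add: algebra_simps)
  next
    case (Sub e1 e2)
    then show ?case using size[of "Sub e1 e2"] by (simp add: algebra_simps)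
  next
    case (Mul e1 e2)
    then show ?case using size[of "Mul e1 e2"] by (simp add: algebra_simps)
  next
    case (Quot e1 e2)
    then show ?case using size[of "Quot e1 e2"] by (simp add: algebra_simps)
  qed
  from this[of e] have "cost e s \<le> weight e * B" by simp
  also have "B \<le> weight e * (b + 1)"
  proof -
    have "weight e \<ge> 1" by (cases e) auto
    then show ?thesis by (simp add: B_def algebra_simps)
  qed
  finally show ?thesis by (simp add: power2_eq_square algebra_simps)
qed

text \<open>Cell 0 of array 2 is the loop counter.\<close>

abbreviation counter :: exp where
  "counter \<equiv> Cell 2 (Const 0)"

text \<open>A triple \<open>(N, i, e)\<close> is the loop that adds \<open>e\<close> to cell
  \<open>i\<close> of array \<open>q\<close> while the counter runs from 0 below \<open>N\<close>.
  All computations are cast in this form: nested loops are flattened into one counter and unpacked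
  by division, so one lemma yields correctness and time of each of them.\<close>

definition stage :: "nat \<Rightarrow> exp \<times> exp \<times> exp \<Rightarrow> prog" where
  "stage q S = (case S of (N, i, e) \<Rightarrow>
     Seq (Assign 2 (Const 0) (Const 0))
       (Loop (Sub N counter)
         (Seq (Assign q i (Add (Cell q i) e))
           (Assign 2 (Const 0) (Add counter (Const 1))))))"

definition stage_weight :: "nat \<Rightarrow> exp \<times> exp \<times> exp \<Rightarrow> nat" where
  "stage_weight q S = (case S of (N, i, e) \<Rightarrow>
     3 + (weight (Sub N counter))\<^sup>2 + (weight i)\<^sup>2 + (weight (Add (Cell q i) e))\<^sup>2 +
     2 * (weight (Const 0))\<^sup>2 + (weight (Add counter (Const 1)))\<^sup>2)"

text \<open>The memory while array \<open>q\<close> is being filled: the arrays below \<open>q\<close> have their final contents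
  \<open>F\<close>, array \<open>q\<close> contains \<open>g\<close>, and the loop counter is \<open>k\<close>.\<close>

definition memory :: "(nat \<Rightarrow> int \<Rightarrow> int) \<Rightarrow> nat \<Rightarrow> (int \<Rightarrow> int) \<Rightarrow> int \<Rightarrow> state" where
  "memory F q g k = (\<lambda>a x. if a = 2 then (if x = 0 then k else 0)
     else if a < q then F a x else if a = q then g x else 0)"

text \<open>The array after \<open>k\<close> rounds, if round \<open>k'\<close> adds
  \<open>y k'\<close> to cell \<open>idx k'\<close>.\<close>

definition accum :: "(nat \<Rightarrow> int) \<Rightarrow> (nat \<Rightarrow> int) \<Rightarrow> nat \<Rightarrow> int \<Rightarrow> int" where
  "accum idx y k x = (\<Sum>k'<k. if idx k' = x then y k' else 0)"

text \<open>The expressions are evaluated in the partially filled array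
  \<open>accum idx y k\<close>. A stage may therefore read what it has written itself, which makes
  recursions possible. \<open>R\<close> bounds the rounds, \<open>b\<close> the bits, and
  \<open>Y\<close> the single summands.\<close>

definition stage_ok :: "nat \<Rightarrow> nat \<Rightarrow> (nat \<Rightarrow> int \<Rightarrow> int) \<Rightarrow> nat \<Rightarrow> exp \<times> exp \<times> exp \<Rightarrow> bool" where
  "stage_ok b R F q S \<longleftrightarrow> (case S of (Ne, ie, e) \<Rightarrow> \<exists>N idx y Y.
     N \<le> R \<and> int N < 2 ^ b \<and> int N * Y < 2 ^ b \<and> (\<forall>k<N. \<bar>y k\<bar> \<le> Y) \<and> F q = accum idx y N \<and>
     (\<forall>k\<le>N. val Ne (memory F q (accum idx y k) (int k)) = int N) \<and>
     (\<forall>k<N. val ie (memory F q (accum idx y k) (int k)) = idx k \<and>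
            val e (memory F q (accum idx y k) (int k)) = y k))"

lemma accum_0 [simp]: "accum idx y 0 = (\<lambda>_. 0)"
  by (simp add: accum_def fun_eq_iff)

lemma abs_accum_le:
  assumes "\<And>k. k < N \<Longrightarrow> \<bar>y k\<bar> \<le> Y" "k \<le> N"
  shows "\<bar>accum idx y k x\<bar> \<le> int N * Y"
proof (cases "N = 0")
  case False
  then have "0 \<le> Y" using assms(1)[of 0] by simp
  have "\<bar>accum idx y k x\<bar> \<le> (\<Sum>k'<k. \<bar>if idx k' = x then y k' else 0\<bar>)"
    unfolding accum_def by (rule sum_abs)
  also have "\<dots> \<le> (\<Sum>k'<k. Y)" using assms \<open>0 \<le> Y\<close> by (intro sum_mono) auto
  also have "\<dots> \<le> int N * Y" using assms(2) \<open>0 \<le> Y\<close> by (simp add: mult_right_mono)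
  finally show ?thesis .
qed (use assms in simp)

text \<open>The time bound is \<open>N + 1\<close> evaluations of the loop test with their bodies,
  plus the reset of the counter, each within \<open>stage_weight q S * (b + 1)\<close>. The bound on
  the finished array is exported because later stages read it.\<close>

lemma exec_stage:
  assumes ok: "stage_ok b R F q S" and q: "q \<ge> 3" and b: "b \<ge> 1" and c: "\<bar>c\<bar> < 2 ^ b"
    and F: "\<And>a x. a < q \<Longrightarrow> \<bar>F a x\<bar> < 2 ^ b"
  shows "(\<exists>t c'. exec (stage q S) (memory F q (\<lambda>_. 0) c) t (memory F (Suc q) (\<lambda>_. 0) c') \<and>
    t \<le> (R + 2) * stage_weight q S * (b + 1) \<and> \<bar>c'\<bar> < 2 ^ b) \<and> (\<forall>x. \<bar>F q x\<bar> < 2 ^ b)"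
proof -
  obtain Ne ie e where S: "S = (Ne, ie, e)" by (metis prod.exhaust)
  obtain N idx y Y where N: "N \<le> R" "int N < 2 ^ b" "int N * Y < 2 ^ b"
    and Y: "\<And>k. k < N \<Longrightarrow> \<bar>y k\<bar> \<le> Y" and Fq: "F q = accum idx y N"
    and vN: "\<And>k. k \<le> N \<Longrightarrow> val Ne (memory F q (accum idx y k) (int k)) = int N"
    and vi: "\<And>k. k < N \<Longrightarrow> val ie (memory F q (accum idx y k) (int k)) = idx k"
    and ve: "\<And>k. k < N \<Longrightarrow> val e (memory F q (accum idx y k) (int k)) = y k"
    using ok unfolding stage_ok_def S prod.case by metis
  define st where "st k = memory F q (accum idx y k) (int k)" for k
  define st' where "st' k = memory F q (accum idx y (Suc k)) (int k)" for k
  define V where "V = stage_weight q S * (b + 1)"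
  have acc: "\<bar>accum idx y k x\<bar> < 2 ^ b" if "k \<le> N" for k x
    using abs_accum_le[of N y Y k idx x] Y that N(3) by force
  have bnd: "bounded_by b (memory F q (accum idx y k) k')" if "k \<le> N" "\<bar>k'\<bar> < 2 ^ b" for k k'
    using that acc F by (auto simp: bounded_by_def memory_def)
  have bst: "bounded_by b (st k)" if "k \<le> N" for k
    unfolding st_def using that N(2) by (intro bnd) auto
  have bst': "bounded_by b (st' k)" if "k < N" for k
    unfolding st'_def using that N(2) by (intro bnd) auto
  have v_counter: "val counter (st k) = int k" "val counter (st' k) = int k" for k
    by (simp_all add: st_def st'_def memory_def)
  let ?body = "Seq (Assign q ie (Add (Cell q ie) e)) (Assign 2 (Const 0) (Add counter (Const 1)))"
  have body: "exec ?body (st k) (1 + cost ie (st k) + cost (Add (Cell q ie) e) (st k) +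
      (1 + cost (Const 0) (st' k) + cost (Add counter (Const 1)) (st' k))) (st (Suc k))"
    if k: "k < N" for k
  proof (rule exec.Seq)
    have "st' k = (st k)(q := ((st k) q)(val ie (st k) := val (Add (Cell q ie) e) (st k)))"
      using vi[OF k] ve[OF k] q by (auto simp: st_def st'_def memory_def accum_def fun_eq_iff)
    then show "exec (Assign q ie (Add (Cell q ie) e)) (st k)
        (1 + cost ie (st k) + cost (Add (Cell q ie) e) (st k)) (st' k)"
      using exec.Assign[of q ie "Add (Cell q ie) e" "st k"] by simp
    have "st (Suc k) = (st' k)(2 := ((st' k) 2)(val (Const 0) (st' k) := val (Add counter (Const 1)) (st' k)))"
      by (auto simp: st_def st'_def memory_def fun_eq_iff)
    then show "exec (Assign 2 (Const 0) (Add counter (Const 1))) (st' k)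
        (1 + cost (Const 0) (st' k) + cost (Add counter (Const 1)) (st' k)) (st (Suc k))"
      using exec.Assign[of 2 "Const 0" "Add counter (Const 1)" "st' k"] by simp
  qed
  have V_eq: "V = 3 * (b + 1) + (weight (Sub Ne counter))\<^sup>2 * (b + 1) + (weight ie)\<^sup>2 * (b + 1) +
      (weight (Add (Cell q ie) e))\<^sup>2 * (b + 1) + 2 * ((weight (Const 0))\<^sup>2 * (b + 1)) +
      (weight (Add counter (Const 1)))\<^sup>2 * (b + 1)"
    by (simp add: V_def stage_weight_def S algebra_simps)
  \<comment> \<open>The induction is on the number \<open>j\<close> of remaining rounds, since
    \<open>Loop_true\<close> splits off the first round.\<close>
  have loop: "\<exists>t. exec (Loop (Sub Ne counter) ?body) (st (N - j)) t (st N) \<and> t \<le> (j + 1) * V"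
    if "j \<le> N" for j
    using that
  proof (induction j)
    case 0
    have "\<not> val (Sub Ne counter) (st N) > 0"
      using vN[of N] v_counter(1)[of N] by (simp add: st_def)
    then have "exec (Loop (Sub Ne counter) ?body) (st N) (1 + cost (Sub Ne counter) (st N)) (st N)"
      by (rule exec.Loop_false)
    moreover have "1 + cost (Sub Ne counter) (st N) \<le> V"
      using cost_le[OF bst[of N] b, of "Sub Ne counter"] V_eq by simp
    ultimately show ?case by auto
  next
    case (Suc j)
    define k where "k = N - Suc j"
    have k: "k < N" "Suc k = N - j" using Suc.prems by (auto simp: k_def)
    obtain t where t: "exec (Loop (Sub Ne counter) ?body) (st (Suc k)) t (st N)" "t \<le> (j + 1) * V"
      using Suc k(2) by auto
    have "val (Sub Ne counter) (st k) > 0"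
      using vN[of k] v_counter(1)[of k] k by (simp add: st_def)
    from exec.Loop_true[OF this body[OF k(1)] t(1)]
    have "exec (Loop (Sub Ne counter) ?body) (st k) (1 + cost (Sub Ne counter) (st k) +
        (1 + cost ie (st k) + cost (Add (Cell q ie) e) (st k) +
        (1 + cost (Const 0) (st' k) + cost (Add counter (Const 1)) (st' k))) + t) (st N)" .
    moreover have "1 + cost (Sub Ne counter) (st k) +
        (1 + cost ie (st k) + cost (Add (Cell q ie) e) (st k) +
        (1 + cost (Const 0) (st' k) + cost (Add counter (Const 1)) (st' k))) \<le> V"
    proof -
      note c = cost_le[OF bst[of k] b] and c' = cost_le[OF bst'[of k] b]
      have "cost (Sub Ne counter) (st k) \<le> (weight (Sub Ne counter))\<^sup>2 * (b + 1)"
        "cost ie (st k) \<le> (weight ie)\<^sup>2 * (b + 1)"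
        "cost (Add (Cell q ie) e) (st k) \<le> (weight (Add (Cell q ie) e))\<^sup>2 * (b + 1)"
        "cost (Const 0) (st' k) \<le> (weight (Const 0))\<^sup>2 * (b + 1)"
        "cost (Add counter (Const 1)) (st' k) \<le> (weight (Add counter (Const 1)))\<^sup>2 * (b + 1)"
        using k(1) by (intro c c'; simp)+
      moreover have "1 + x1 + (1 + x2 + x3 + (1 + x4 + x5)) \<le>
          3 * (b + 1) + X1 + X2 + X3 + 2 * X4 + X5"
        if "x1 \<le> X1" "x2 \<le> X2" "x3 \<le> X3" "x4 \<le> X4" "x5 \<le> X5"
        for x1 x2 x3 x4 x5 X1 X2 X3 X4 X5 :: nat using that by simp
      ultimately show ?thesis unfolding V_eq by blast
    qed
    then have "1 + cost (Sub Ne counter) (st k) +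
        (1 + cost ie (st k) + cost (Add (Cell q ie) e) (st k) +
        (1 + cost (Const 0) (st' k) + cost (Add counter (Const 1)) (st' k))) + t \<le> (Suc j + 1) * V"
      using t(2) by (simp del: cost.simps)
    ultimately show ?case unfolding k_def[symmetric] by blast
  qed
  obtain t where t: "exec (Loop (Sub Ne counter) ?body) (st 0) t (st N)" "t \<le> (N + 1) * V"
    using loop[of N] by auto
  define s0 where "s0 = memory F q (\<lambda>_. 0) c"
  have "st 0 = s0(2 := (s0 2)(val (Const 0) s0 := val (Const 0) s0))"
    using q by (auto simp: st_def s0_def memory_def fun_eq_iff)
  then have "exec (Assign 2 (Const 0) (Const 0)) s0 (1 + cost (Const 0) s0 + cost (Const 0) s0) (st 0)"
    using exec.Assign[of 2 "Const 0" "Const 0" s0] by simp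
  from exec.Seq[OF this t(1)]
  have "exec (stage q S) s0 (1 + cost (Const 0) s0 + cost (Const 0) s0 + t) (st N)"
    by (simp add: stage_def S)
  moreover have "1 + cost (Const 0) s0 + cost (Const 0) s0 + t \<le> (R + 2) * V"
  proof -
    have "1 + cost (Const 0) s0 + cost (Const 0) s0 \<le> V"
      using cost_le[of b s0 "Const 0"] bnd[of 0 c] b c V_eq by (simp add: s0_def)
    then have "1 + cost (Const 0) s0 + cost (Const 0) s0 + t \<le> (N + 2) * V"
      using t(2) by (simp del: cost.simps)
    also have "\<dots> \<le> (R + 2) * V" using N(1) by (intro mult_right_mono) auto
    finally show ?thesis .
  qed
  moreover have "st N = memory F (Suc q) (\<lambda>_. 0) (int N)"
    using Fq by (auto simp: st_def memory_def fun_eq_iff less_Suc_eq)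
  ultimately have "exec (stage q S) s0 (1 + cost (Const 0) s0 + cost (Const 0) s0 + t)
      (memory F (Suc q) (\<lambda>_. 0) (int N)) \<and>
      1 + cost (Const 0) s0 + cost (Const 0) s0 + t \<le> (R + 2) * stage_weight q S * (b + 1) \<and> \<bar>int N\<bar> < 2 ^ b"
    using N(2) unfolding V_def[symmetric] mult.assoc by simp
  then show ?thesis unfolding s0_def Fq using acc[of N] by blast
qed

fun stages :: "nat \<Rightarrow> (exp \<times> exp \<times> exp) list \<Rightarrow> prog" where
  "stages q [] = Skip"
| "stages q (S # Ss) = Seq (stage q S) (stages (Suc q) Ss)"

fun stages_weight :: "nat \<Rightarrow> (exp \<times> exp \<times> exp) list \<Rightarrow> nat" where
  "stages_weight q [] = 1"
| "stages_weight q (S # Ss) = stage_weight q S + stages_weight (Suc q) Ss"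

lemma exec_stages:
  assumes "\<And>k. k < length Ss \<Longrightarrow> stage_ok b R F (q + k) (Ss ! k)"
    and "q \<ge> 3" "b \<ge> 1" "\<bar>c\<bar> < 2 ^ b" "\<And>a x. a < q \<Longrightarrow> \<bar>F a x\<bar> < 2 ^ b"
  shows "\<exists>t c'. exec (stages q Ss) (memory F q (\<lambda>_. 0) c) t (memory F (q + length Ss) (\<lambda>_. 0) c') \<and>
    t \<le> (R + 2) * stages_weight q Ss * (b + 1) \<and> bounded_by b (memory F (q + length Ss) (\<lambda>_. 0) c')"
  using assms
proof (induction Ss arbitrary: q c)
  case Nil
  then have "bounded_by b (memory F q (\<lambda>_. 0) c)" by (auto simp: bounded_by_def memory_def)
  with exec.Skip[of "memory F q (\<lambda>_. 0) c"] show ?case by fastforce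
next
  case (Cons S Ss)
  have "stage_ok b R F q S" using Cons.prems(1)[of 0] by simp
  from exec_stage[OF this Cons.prems(2-5)]
  obtain t c' where t: "exec (stage q S) (memory F q (\<lambda>_. 0) c) t (memory F (Suc q) (\<lambda>_. 0) c')"
      "t \<le> (R + 2) * stage_weight q S * (b + 1)" "\<bar>c'\<bar> < 2 ^ b" and Fq: "\<And>x. \<bar>F q x\<bar> < 2 ^ b"
    by blast
  have "stage_ok b R F (Suc q + k) (Ss ! k)" if "k < length Ss" for k
    using Cons.prems(1)[of "Suc k"] that by simp
  moreover have "\<bar>F a x\<bar> < 2 ^ b" if "a < Suc q" for a x
    using that Fq Cons.prems(5) by (cases "a = q") auto
  ultimately obtain u c'' where u:
      "exec (stages (Suc q) Ss) (memory F (Suc q) (\<lambda>_. 0) c') u (memory F (Suc q + length Ss) (\<lambda>_. 0) c'')"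
      "u \<le> (R + 2) * stages_weight (Suc q) Ss * (b + 1)"
      "bounded_by b (memory F (Suc q + length Ss) (\<lambda>_. 0) c'')"
    using Cons.IH[of "Suc q" c'] Cons.prems(2,3) t(3) by auto
  have "t + u \<le> (R + 2) * stages_weight q (S # Ss) * (b + 1)"
    using t(2) u(2) by (simp add: algebra_simps)
  with exec.Seq[OF t(1) u(1)] u(3) show ?case by auto
qed

definition verdict :: "exp list \<Rightarrow> prog" where
  "verdict es = foldr (\<lambda>e A. Cond e A (Assign 0 (Const 0) (Const 0))) es (Assign 0 (Const 0) (Const 1))"

lemma exec_verdict:
  assumes "bounded_by b s" "b \<ge> 1"
  shows "\<exists>t s'. exec (verdict es) s t s' \<and> s' 0 0 = of_bool (\<forall>e\<in>set es. val e s > 0) \<and>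
    t \<le> (20 + (\<Sum>e\<leftarrow>es. 1 + (weight e)\<^sup>2)) * (b + 1)"
proof (induction es)
  case Nil
  have "1 + cost (Const 0) s + cost (Const 1) s \<le> 20 * (b + 1)" by (simp add: int_size_def floorlog_def)
  with exec.Assign[of 0 "Const 0" "Const 1" s] show ?case unfolding verdict_def
    by (intro exI[of _ "1 + cost (Const 0) s + cost (Const 1) s"] exI[of _ "s(0 := (s 0)(0 := 1))"])
      (simp add: fun_upd_def del: cost.simps)
next
  case (Cons e es)
  show ?case
  proof (cases "val e s > 0")
    case True
    obtain t s' where t: "exec (verdict es) s t s'" "s' 0 0 = of_bool (\<forall>e\<in>set es. val e s > 0)"
      "t \<le> (20 + (\<Sum>e\<leftarrow>es. 1 + (weight e)\<^sup>2)) * (b + 1)" using Cons by blast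
    have "exec (verdict (e # es)) s (1 + cost e s + t) s'"
      using exec.Cond_true[OF True t(1)] by (simp add: verdict_def)
    moreover have "1 + cost e s + t \<le> (20 + (\<Sum>e\<leftarrow>e # es. 1 + (weight e)\<^sup>2)) * (b + 1)"
      using cost_le[OF assms, of e] t(3) by (simp add: algebra_simps)
    ultimately show ?thesis using t(2) True by (intro exI[of _ "1 + cost e s + t"] exI[of _ s']) simp
  next
    case False
    have "exec (verdict (e # es)) s (1 + cost e s + (1 + cost (Const 0) s + cost (Const 0) s))
        (s(0 := (s 0)(0 := 0)))"
      using exec.Cond_false[OF False exec.Assign[of 0 "Const 0" "Const 0" s]] by (simp add: verdict_def)
    moreover have "1 + cost e s + (1 + cost (Const 0) s + cost (Const 0) s)
        \<le> (20 + (\<Sum>e\<leftarrow>e # es. 1 + (weight e)\<^sup>2)) * (b + 1)"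
      using cost_le[OF assms, of e] by (simp add: algebra_simps int_size_def floorlog_def)
    ultimately show ?thesis using False
      by (intro exI[of _ "1 + cost e s + (1 + cost (Const 0) s + cost (Const 0) s)"]
          exI[of _ "s(0 := (s 0)(0 := 0))"]) (simp add: fun_upd_def del: cost.simps)
  qed
qed

section \<open>The program\<close>

definition Mod :: "exp \<Rightarrow> exp \<Rightarrow> exp" where
  "Mod e f = Sub e (Mul (Quot e f) f)"

definition Square :: "exp \<Rightarrow> exp" where
  "Square e = Mul e e"

text \<open>Expressions have no conditional; \<open>1 div (e + 1)\<close> is 1 for
  \<open>e = 0\<close> and 0 for \<open>e > 0\<close>.\<close>

definition Zero_test :: "exp \<Rightarrow> exp" where
  "Zero_test e = Quot (Const 1) (Add e (Const 1))"

lemma val_Mod [simp]: "val (Mod e f) s = val e s mod val f s"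
  by (simp add: Mod_def minus_div_mult_eq_mod)

lemma val_Square [simp]: "val (Square e) s = (val e s)\<^sup>2"
  by (simp add: Square_def power2_eq_square)

lemma val_Zero_test [simp]: "0 \<le> val e s \<Longrightarrow> val (Zero_test e) s = of_bool (val e s = 0)"
  by (cases "val e s = 0") (auto simp: Zero_test_def)

abbreviation dim :: exp where "dim \<equiv> Cell 0 (Const 0)"
abbreviation dim2 :: exp where "dim2 \<equiv> Mul dim dim"
abbreviation dim3 :: exp where "dim3 \<equiv> Mul dim dim2"
abbreviation clause_count :: exp where "clause_count \<equiv> Mul (Const 8) dim3"
text \<open>The offset 2 skips the header of the input, which holds the dimension and the truncated
  bias.\<close>

abbreviation clause_bit :: exp where "clause_bit \<equiv> Cell 0 (Add counter (Const 2))"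

definition coord_exp :: "nat \<Rightarrow> exp" where
  "coord_exp i = (if i = 0 then Quot (Quot (Quot counter (Const 8)) dim) dim
     else if i = 1 then Mod (Quot (Quot counter (Const 8)) dim) dim
     else Mod (Quot counter (Const 8)) dim)"

definition sign_exp :: "int \<Rightarrow> exp" where
  "sign_exp w = Sub (Mul (Const 2) (Mod (Quot counter (Const w)) (Const 2))) (Const 1)"

definition csign_exp :: "bool \<times> bool \<times> bool \<Rightarrow> exp" where
  "csign_exp p = (case p of (p1, p2, p3) \<Rightarrow>
     Mul (Mul (if p1 then sign_exp 4 else Const 1) (if p2 then sign_exp 2 else Const 1))
       (if p3 then sign_exp 1 else Const 1))"

text \<open>Cells with a negative address are never written and contain 0; this starts the recursions
  below.\<close>

definition repeated_squares :: "nat \<Rightarrow> exp \<Rightarrow> exp \<times> exp \<times> exp" where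
  "repeated_squares q e = (Add (Cell 8 (Const 0)) (Const 1), counter,
     Add (Square (Cell q (Sub counter (Const 1)))) (Mul (Zero_test counter) e))"

definition matrix_stage :: "pattern \<Rightarrow> exp \<times> exp \<times> exp" where
  "matrix_stage \<kappa> = (case \<kappa> of (i, j, p) \<Rightarrow>
     (clause_count, Add (Mul (coord_exp i) dim) (coord_exp j), Mul (csign_exp p) clause_bit))"

text \<open>The entry \<open>(u, v)\<close> of the \<open>j\<close>-th iterate is stored at \<open>j n\<^sup>2 + u n + v\<close>; the counter is
  \<open>((j n + u) n + v) n + w\<close>.\<close>

definition gram_stage :: "nat \<Rightarrow> nat \<Rightarrow> exp \<times> exp \<times> exp" where
  "gram_stage q q' = (Mul (Add (Cell 8 (Const 0)) (Const 1)) dim3, Quot counter dim,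
     Add (Mul (Mul (Zero_test (Quot (Quot (Quot counter dim) dim) dim)) (Zero_test (Mod counter dim)))
            (Cell q' (Quot counter dim)))
       (Mul (Cell q (Sub (Add (Mul (Quot (Quot counter dim) dim) dim) (Mod counter dim)) dim2))
         (Cell q (Sub (Add (Add (Mul (Quot (Quot (Quot counter dim) dim) dim) dim2)
            (Mul (Mod (Quot counter dim) dim) dim)) (Mod counter dim)) dim2))))"

definition frob_stage :: "nat \<Rightarrow> exp \<times> exp \<times> exp" where
  "frob_stage q' = (dim2, Const 0, Square (Cell q' (Add (Mul (Cell 8 (Const 0)) dim2) counter)))"

text \<open>The arrays 3 to 10 contain the number of clauses, the occurrences of the variables, the
  irregularity, the powers of 2, the logarithm of \<open>n\<close>, the depth, and the iterated squares of the
  two sides of the test of the Frobenius norms.\<close>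

definition certifier_stages :: "(exp \<times> exp \<times> exp) list" where
  "certifier_stages =
    [(clause_count, Const 0, clause_bit),
     (clause_count, coord_exp 2, clause_bit),
     (dim, Const 0, Square (Sub (Mul dim (Cell 4 counter)) (Cell 3 (Const 0)))),
     (Add dim (Const 1), counter, Add (Mul (Const 2) (Cell 6 (Sub counter (Const 1)))) (Zero_test counter)),
     (dim, Const 0, Sub (Const 1) (Zero_test (Quot dim (Cell 6 counter)))),
     (dim, Const 0, Sub (Const 1) (Zero_test (Quot (Cell 7 (Const 0)) (Cell 6 counter)))),
     repeated_squares 9 (Square (Mul (Cell 0 (Const 1)) (Cell 3 (Const 0)))),
     repeated_squares 10 (Square (Mul (Mul (Const 16) (Cell 6 dim)) dim))] @
    map matrix_stage patterns @
    map (\<lambda>t. gram_stage (18 + t) (11 + t)) [0..<7] @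
    map (\<lambda>t. frob_stage (18 + t)) [0..<7]"

text \<open>Tests succeed on positive values, so an inequality \<open>x \<le> y\<close> between
  integers is tested as \<open>y + 1 - x\<close>.\<close>

definition certifier_tests :: "exp list" where
  "certifier_tests =
    [Mul (Cell 0 (Const 1)) (Cell 3 (Const 0)),
     Sub (Add (Mul (Square (Mul (Cell 0 (Const 1)) (Cell 3 (Const 0)))) dim) (Const 1))
       (Mul (Cell 5 (Const 0)) (Square (Mul (Const 16) (Cell 6 dim))))] @
    map (\<lambda>t. Sub (Add (Cell 9 (Cell 8 (Const 0))) (Const 1))
      (Mul (Cell (25 + t) (Const 0)) (Cell 10 (Cell 8 (Const 0))))) [0..<7]"

definition certifier :: prog where
  "certifier = Seq (stages 3 certifier_stages) (verdict certifier_tests)"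

section \<open>The encoding of instances\<close>

text \<open>The clause at position \<open>k\<close> of the characteristic sequence: the three lowest
  bits are the signs, the first sign being the most significant, and the rest are three digits in
  base \<open>n\<close>, the third variable varying fastest.\<close>

definition decode :: "nat \<Rightarrow> nat \<Rightarrow> clause" where
  "decode n k =
    ((2 * int (k div 4 mod 2) - 1, 2 * int (k div 2 mod 2) - 1, 2 * int (k mod 2) - 1),
     (Suc (k div 8 div n div n), Suc (k div 8 div n mod n), Suc (k div 8 mod n)))"

text \<open>One level of nested enumeration is a div-mod enumeration. Used three times, it flattens
  the loops over the variables in \<open>encode\<close>.\<close>

lemma concat_map_upt:
  "concat (map (\<lambda>i. map (f i) [0..<L]) [0..<N]) = map (\<lambda>k. f (k div L) (k mod L)) [0..<N * L]"
proof (induction N)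
  case (Suc N)
  show ?case
  proof (cases "L = 0")
    case False
    have "[0..<Suc N * L] = [0..<N * L] @ map (\<lambda>i. i + N * L) [0..<L]"
      using upt_add_eq_append[of 0 "N * L" L] by (simp add: map_add_upt add.commute)
    then show ?thesis using Suc False by (auto simp: o_def)
  qed simp
qed simp

lemma encode_eq:
  "encode n r I = [int n, \<lfloor>2 ^ n * r\<rfloor>] @ map (\<lambda>k. of_bool (decode n k \<in> I)) [0..<8 * n ^ 3]"
proof -
  let ?f = "\<lambda>u1 u2 u3 c. of_bool (((2 * int (c div 4 mod 2) - 1, 2 * int (c div 2 mod 2) - 1,
    2 * int (c mod 2) - 1), (Suc u1, Suc u2, Suc u3)) \<in> I) :: int"
  have u: "[1..<n + 1] = map Suc [0..<n]" by (simp add: map_Suc_upt)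
  have c: "[0..<8] = [0, 1, 2, 3, 4, 5, 6, 7 :: nat]" by (simp add: upt_rec)
  have "encode n r I = [int n, \<lfloor>2 ^ n * r\<rfloor>] @
      concat (map (\<lambda>u1. concat (map (\<lambda>u2. concat (map (\<lambda>u3. map (?f u1 u2 u3) [0..<8]) [0..<n])) [0..<n])) [0..<n])"
    unfolding encode_def u c by (simp add: o_def)
  also have "\<dots> = [int n, \<lfloor>2 ^ n * r\<rfloor>] @ map (\<lambda>k. of_bool (decode n k \<in> I)) [0..<n * (n * (n * 8))]"
    unfolding concat_map_upt
  proof (intro arg_cong2[of _ _ _ _ "(@)"] refl map_cong)
    fix k assume "k \<in> set [0..<n * (n * (n * 8))]"
    have m: "k mod (n * (n * 8)) mod (n * 8) mod 8 = k mod 8" "k mod (n * (n * 8)) mod (n * 8) div 8 = k div 8 mod n"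
      "k mod (n * (n * 8)) div (n * 8) = k div 8 div n mod n" "k div (n * (n * 8)) = k div 8 div n div n"
    proof -
      have 1: "k mod (a * b) div b = k div b mod a" for a b :: nat
        by (cases "b = 0") (simp_all add: mod_mult2_eq[of k b a] mult.commute[of a b])
      have 2: "k mod (n * (n * 8)) mod (n * 8) = k mod (n * 8)" "k mod (n * 8) mod 8 = k mod 8"
        by (simp_all add: mod_mod_cancel)
      have 3: "k div (n * 8) = k div 8 div n" "k div (n * (n * 8)) = k div (n * 8) div n"
        using div_mult2_eq[of k 8 n] div_mult2_eq[of k "n * 8" n] by (simp_all add: mult_ac)
      show "k mod (n * (n * 8)) mod (n * 8) mod 8 = k mod 8" unfolding 2 ..
      show "k mod (n * (n * 8)) mod (n * 8) div 8 = k div 8 mod n" unfolding 2 1 ..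
      show "k mod (n * (n * 8)) div (n * 8) = k div 8 div n mod n" unfolding 1 3 ..
      show "k div (n * (n * 8)) = k div 8 div n div n" unfolding 3 ..
    qed
    have b: "k mod 8 div 4 mod 2 = k div 4 mod 2" "k mod 8 div 2 mod 2 = k div 2 mod 2" "k mod 8 mod 2 = k mod 2"
    proof -
      have 1: "k mod (a * b) div b = k div b mod a" for a b :: nat
        by (cases "b = 0") (simp_all add: mod_mult2_eq[of k b a] mult.commute[of a b])
      show "k mod 8 div 4 mod 2 = k div 4 mod 2" "k mod 8 div 2 mod 2 = k div 2 mod 2"
        using 1[of 2 4] 1[of 4 2] by (simp_all add: mod_mod_cancel)
      show "k mod 8 mod 2 = k mod 2" by (simp add: mod_mod_cancel)
    qed
    show "?f (k div (n * (n * 8))) (k mod (n * (n * 8)) div (n * 8)) (k mod (n * (n * 8)) mod (n * 8) div 8)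
        (k mod (n * (n * 8)) mod (n * 8) mod 8) = of_bool (decode n k \<in> I)"
      unfolding m b decode_def ..
  qed
  also have "n * (n * (n * 8)) = 8 * n ^ 3" by (simp add: power3_eq_cube)
  finally show ?thesis .
qed

lemma decode_in_clauses:
  assumes "k < 8 * n ^ 3"
  shows "decode n k \<in> clauses n"
proof -
  have "n > 0" using assms by (cases n) auto
  have "k < n * n * n * 8" using assms by (simp add: power3_eq_cube)
  then have "k div 8 div n div n < n" by (simp add: less_mult_imp_div_less)
  moreover have s: "2 * int (a mod 2) - 1 \<in> signs" for a :: nat
    by (cases "a mod 2 = 0") (auto simp: signs_def)
  ultimately show ?thesis using \<open>n > 0\<close>
    by (auto simp: decode_def clauses_def Suc_le_eq intro!: s simp del: of_nat_mod)
qed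

text \<open>Injectivity is enough, as \<open>8 * n^3\<close> is also the number of clauses; it holds
  because the three bits determine \<open>k mod 8\<close> and the digits determine
  \<open>k div 8\<close>.\<close>

lemma bij_betw_decode: "bij_betw (decode n) {..<8 * n ^ 3} (clauses n)"
proof -
  have "inj_on (decode n) {..<8 * n ^ 3}"
  proof (rule inj_onI)
    fix k l assume "decode n k = decode n l"
    then have bits: "k div 4 mod 2 = l div 4 mod 2" "k div 2 mod 2 = l div 2 mod 2" "k mod 2 = l mod 2"
      and u: "k div 8 div n div n = l div 8 div n div n" "k div 8 div n mod n = l div 8 div n mod n"
        "k div 8 mod n = l div 8 mod n"
      by (auto simp: decode_def simp del: of_nat_mod)
    have "k div 8 div n = l div 8 div n" using u(1,2) by (metis div_mult_mod_eq)
    then have "k div 8 = l div 8" using u(3) by (metis div_mult_mod_eq)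
    moreover have "i mod 8 = 4 * (i div 4 mod 2) + 2 * (i div 2 mod 2) + i mod 2" for i :: nat
      using mod_mult2_eq[of i 2 4] mod_mult2_eq[of "i div 2" 2 2] div_mult2_eq[of i 2 2] by simp
    ultimately show "k = l" using bits by (metis div_mult_mod_eq)
  qed
  then show ?thesis
    by (simp add: bij_betw_def) (rule card_subset_eq, auto simp: card_image card_clauses decode_in_clauses)
qed

lemma sum_decode:
  fixes g :: "clause \<Rightarrow> int"
  assumes "I \<subseteq> clauses n"
  shows "(\<Sum>k<8 * n ^ 3. g (decode n k) * of_bool (decode n k \<in> I)) = (\<Sum>C\<in>I. g C)"
proof -
  have "(\<Sum>k<8 * n ^ 3. g (decode n k) * of_bool (decode n k \<in> I)) = (\<Sum>C\<in>clauses n. g C * of_bool (C \<in> I))"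
    using bij_betw_decode by (rule sum.reindex_bij_betw)
  also have "\<dots> = (\<Sum>C\<in>I. g C)" using assms by (intro sum.mono_neutral_cong_right) auto
  finally show ?thesis .
qed

lemma val_coord_exp:
  assumes "val dim s = int n" "val counter s = int k"
  shows "val (coord_exp i) s = int (coord i (decode n k))"
  using assms by (simp add: coord_exp_def coord_def decode_def of_nat_div of_nat_mod)

lemma val_csign_exp:
  assumes "val counter s = int k"
  shows "val (csign_exp p) s = csign p (decode n k)"
  using assms
  by (simp add: csign_exp_def sign_exp_def csign_def decode_def of_nat_div of_nat_mod split: prod.split)

section \<open>Correctness and running time of the program\<close>

lemma stage_okI:
  assumes "F q = accum idx y N" "N \<le> R" "int N < 2 ^ b" "int N * Y < 2 ^ b"
    "\<And>k. k < N \<Longrightarrow> \<bar>y k\<bar> \<le> Y"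
    "\<And>k. k \<le> N \<Longrightarrow> val Ne (memory F q (accum idx y k) (int k)) = int N"
    "\<And>k. k < N \<Longrightarrow> val ie (memory F q (accum idx y k) (int k)) = idx k"
    "\<And>k. k < N \<Longrightarrow> val e (memory F q (accum idx y k) (int k)) = y k"
  shows "stage_ok b R F q (Ne, ie, e)"
  unfolding stage_ok_def prod.case using assms by blast

section \<open>Reading accumulated arrays\<close>

lemma accum_int: "accum int y N x = (if 0 \<le> x \<and> x < int N then y (nat x) else 0)"
proof -
  have "accum int y N x = (\<Sum>k<N. if k = nat x \<and> 0 \<le> x then y k else 0)"
    unfolding accum_def by (intro sum.cong) auto
  then show ?thesis by (cases "0 \<le> x") (auto simp: sum.delta nat_less_iff)
qed

lemma accum_const: "accum (\<lambda>_. 0) y N 0 = (\<Sum>k<N. y k)"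
  by (simp add: accum_def)

text \<open>Cell \<open>X\<close> is touched only in the \<open>n\<close> rounds starting at
  \<open>X * n\<close>. After them it is final, even if the array is still being filled.\<close>

lemma accum_div:
  assumes "X * n + n \<le> k" "n > 0"
  shows "accum (\<lambda>k. int (k div n)) y k (int X) = (\<Sum>w<n. y (X * n + w))"
proof -
  have "accum (\<lambda>k. int (k div n)) y k (int X) = (\<Sum>k'\<in>{k'. k' < k \<and> k' div n = X}. y k')"
    unfolding accum_def by (intro sum.mono_neutral_cong_right) (auto split: if_splits)
  also have "{k'. k' < k \<and> k' div n = X} = (\<lambda>w. X * n + w) ` {..<n}"
  proof (intro equalityI subsetI)
    fix k' assume "k' \<in> {k'. k' < k \<and> k' div n = X}"
    then have "k' = X * n + k' mod n" by auto
    with assms(2) show "k' \<in> (\<lambda>w. X * n + w) ` {..<n}" by (metis imageI lessThan_iff mod_less_divisor)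
  qed (use assms in auto)
  also have "(\<Sum>k'\<in>(\<lambda>w. X * n + w) ` {..<n}. y k') = (\<Sum>w<n. y (X * n + w))"
    by (subst sum.reindex) (auto simp: inj_on_def)
  finally show ?thesis .
qed

lemma accum_neg: "x < 0 \<Longrightarrow> accum (\<lambda>k. int (f k)) y k x = 0"
  by (auto simp: accum_def intro!: sum.neutral)

lemma power_le_iff_less_floorlog: "2 ^ i \<le> m \<longleftrightarrow> i < floorlog 2 m"
proof (cases "m = 0")
  case False
  then have b: "2 ^ (floorlog 2 m - 1) \<le> m" "m < 2 ^ floorlog 2 m"
    using floorlog_bounds[of m 2] by auto
  show ?thesis
  proof
    assume "2 ^ i \<le> m"
    with b(2) have "(2::nat) ^ i < 2 ^ floorlog 2 m" by linarith
    then show "i < floorlog 2 m" by simp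
  next
    assume "i < floorlog 2 m"
    then have "(2::nat) ^ i \<le> 2 ^ (floorlog 2 m - 1)" by (intro power_increasing) auto
    with b(1) show "2 ^ i \<le> m" by linarith
  qed
qed (simp add: floorlog_def)

lemma floorlog_le_self: "floorlog 2 m \<le> m"
  by (rule floorlog_le_of_less_power) simp

text \<open>This is how the program computes logarithms: the bit length of \<open>m\<close> is the
  number of powers of 2 not exceeding it, and exponents below \<open>n\<close> suffice for
  \<open>m \<le> n\<close>.\<close>

lemma card_powers_le:
  assumes "m \<le> n"
  shows "card ({..<n} \<inter> {i. 2 ^ i \<le> m}) = floorlog 2 m"
proof -
  have "floorlog 2 m \<le> n" using assms floorlog_le_self[of m] by linarith
  then have "{..<n} \<inter> {i. 2 ^ i \<le> m} = {..<floorlog 2 m}"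
    by (auto simp: power_le_iff_less_floorlog)
  then show ?thesis by simp
qed

lemma power_floorlog_le: "2 ^ floorlog 2 m \<le> 2 * m + 1"
proof (cases "floorlog 2 m = 0")
  case False
  then obtain f where f: "floorlog 2 m = Suc f" by (cases "floorlog 2 m") auto
  then have "2 ^ f \<le> m" by (simp add: power_le_iff_less_floorlog)
  then show ?thesis by (simp add: f)
qed simp

lemma sum_list_ge_length: "(\<And>x. x \<in> set xs \<Longrightarrow> 1 \<le> f x) \<Longrightarrow> length xs \<le> (\<Sum>x\<leftarrow>xs. f x :: nat)"
proof (induction xs)
  case (Cons a xs)
  then have "length xs \<le> sum_list (map f xs)" "1 \<le> f a" by auto
  then show ?case by simp
qed simp

locale certifier_run =
  fixes n :: nat and \<rho> :: real and I :: "clause set"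
  assumes I_subset: "I \<subseteq> clauses n"
begin

definition "input = encode n \<rho> I"
definition "z = input_size input"
definition "r = \<lfloor>2 ^ n * \<rho>\<rfloor>"
definition "M = int (card I)"
definition "J = depth n"
definition "K = (2::nat) ^ J"
text \<open>A common bit bound for all cells. The accumulated quantities are below \<open>z\<close>
  to a power of at most \<open>5 * K\<close>, or have at most \<open>5 * z * K\<close> bits, so 8 is
  generous. As \<open>K \<le> 2 * z\<close>, the bound is quadratic in the input size
  \<open>z\<close>.\<close>

definition "b = 8 * z * K"
definition "T t = sign_matrix I (patterns ! t)"
definition bit :: "nat \<Rightarrow> int" where "bit k = of_bool (decode n k \<in> I)"

text \<open>The summand of round \<open>k\<close> when all iterates are computed in one loop. In
  block 0 the matrix is copied, and \<open>w = 0\<close> ensures that each entry is added once and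
  not \<open>n\<close> times.\<close>

definition gram_term :: "nat \<Rightarrow> nat \<Rightarrow> int" where
  "gram_term t k =
    (let u = k div n div n mod n; v = k div n mod n; w = k mod n in
     case k div n div n div n of
       0 \<Rightarrow> of_bool (w = 0) * T t u v
     | Suc j \<Rightarrow> gram n (T t) j u w * gram n (T t) j v w)"

definition contents :: "nat \<Rightarrow> int \<Rightarrow> int" where
  "contents a =
    (if a < 2 then initial input a
     else if a = 3 then accum (\<lambda>_. 0) bit (8 * n ^ 3)
     else if a = 4 then accum (\<lambda>k. int (coord 2 (decode n k))) bit (8 * n ^ 3)
     else if a = 5 then accum (\<lambda>_. 0) (\<lambda>u. (int n * occurrences I u - M)\<^sup>2) n
     else if a = 6 then accum int (\<lambda>k. 2 ^ k) (n + 1)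
     else if a = 7 then accum (\<lambda>_. 0) (\<lambda>i. of_bool (2 ^ i \<le> n)) n
     else if a = 8 then accum (\<lambda>_. 0) (\<lambda>i. of_bool (2 ^ i \<le> floorlog 2 n)) n
     else if a = 9 then accum int (\<lambda>j. ((r * M)\<^sup>2) ^ 2 ^ j) (J + 1)
     else if a = 10 then accum int (\<lambda>j. ((16 * 2 ^ n * int n)\<^sup>2) ^ 2 ^ j) (J + 1)
     else if 11 \<le> a \<and> a < 18 then (case patterns ! (a - 11) of (i, j, p) \<Rightarrow>
       accum (\<lambda>k. int (coord i (decode n k)) * int n + int (coord j (decode n k)))
         (\<lambda>k. csign p (decode n k) * bit k) (8 * n ^ 3))
     else if 18 \<le> a \<and> a < 25 then accum (\<lambda>k. int (k div n)) (gram_term (a - 18)) ((J + 1) * n ^ 3)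
     else if 25 \<le> a then accum (\<lambda>_. 0) (\<lambda>k. (gram n (T (a - 25)) J (k div n) (k mod n))\<^sup>2) (n\<^sup>2)
     else (\<lambda>_. 0))"

lemma length_input: "length input = 8 * n ^ 3 + 2"
  by (simp add: input_def encode_eq)

lemma size_ge: "8 * n ^ 3 + 2 \<le> z"
proof -
  have "length input \<le> z"
    unfolding z_def input_size_def by (rule sum_list_ge_length) (simp add: int_size_def)
  then show ?thesis by (simp add: length_input)
qed

lemma size_bounds: "n + 2 \<le> z" "2 \<le> z" "n\<^sup>2 \<le> z" "n ^ 3 \<le> z" "8 * n ^ 3 \<le> z"
proof -
  have "n \<le> n ^ 3" "n\<^sup>2 \<le> n ^ 3" by (cases n; simp add: power2_eq_square power3_eq_cube)+
  with size_ge show "n + 2 \<le> z" "2 \<le> z" "n\<^sup>2 \<le> z" "n ^ 3 \<le> z" "8 * n ^ 3 \<le> z" by linarith+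
qed

lemma abs_input_less: "x \<in> set input \<Longrightarrow> \<bar>x\<bar> < 2 ^ z"
proof -
  assume "x \<in> set input"
  then have "int_size x \<le> z" unfolding z_def input_size_def by (intro member_le_sum_list) auto
  then have "(2::int) ^ int_size x \<le> 2 ^ z" by (intro power_increasing) auto
  with less_power_int_size[of x] show ?thesis by linarith
qed

lemma abs_r_less: "\<bar>r\<bar> < 2 ^ z"
  by (rule abs_input_less) (simp add: input_def encode_eq r_def)

lemma depth_le: "J \<le> n"
  using floorlog_le_self[of "floorlog 2 n"] floorlog_le_self[of n] by (simp add: J_def depth_def)

lemma K_bounds: "1 \<le> K" "K \<le> 2 * z"
proof -
  show "1 \<le> K" by (simp add: K_def)
  have "K \<le> 2 * floorlog 2 n + 1" unfolding K_def J_def depth_def by (rule power_floorlog_le)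
  then show "K \<le> 2 * z" using floorlog_le_self[of n] size_bounds(1) by linarith
qed

lemma finite_I: "finite I"
  using I_subset finite_subset finite_clauses by blast

lemma M_bounds: "0 \<le> M" "M \<le> int z"
proof -
  have "card I \<le> card (clauses n)" using I_subset by (intro card_mono) auto
  then show "M \<le> int z" using size_bounds(5) by (simp add: M_def card_clauses)
qed (simp add: M_def)

lemma less_bound_power:
  assumes "x \<le> int z ^ e" "0 < e" "e \<le> 8 * K"
  shows "x < 2 ^ b"
proof -
  have "int z ^ e < (2 ^ z) ^ e" using assms(2) by (intro power_strict_mono) auto
  also have "\<dots> = 2 ^ (z * e)" by (simp add: power_mult)
  also have "\<dots> \<le> 2 ^ b" using assms(3) by (intro power_increasing) (auto simp: b_def)
  finally show ?thesis using assms(1) by linarith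
qed

lemma less_bound: "x \<le> int z \<Longrightarrow> x < 2 ^ b"
  using less_bound_power[of x 1] K_bounds(1) by simp

lemma less_bound_exp: "x < 2 ^ e \<Longrightarrow> e \<le> 8 * z \<Longrightarrow> x < (2::int) ^ b"
proof -
  assume "x < 2 ^ e" "e \<le> 8 * z"
  moreover have "8 * z * 1 \<le> 8 * z * K" using K_bounds(1) by (intro mult_left_mono) auto
  then have "8 * z \<le> b" by (simp add: b_def)
  ultimately have "(2::int) ^ e \<le> 2 ^ b" by (intro power_increasing) auto
  with \<open>x < 2 ^ e\<close> show ?thesis by linarith
qed

lemma initial_dim: "initial input 0 0 = int n"
  and initial_bias: "initial input 0 1 = r"
proof -
  have "1 < length input" by (simp add: length_input)
  then have "initial input 0 0 = input ! 0" "initial input 0 1 = input ! 1"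
    by (auto simp: initial_def)
  then show "initial input 0 0 = int n" "initial input 0 1 = r"
    by (simp_all add: input_def encode_eq r_def)
qed

lemma initial_bit: "initial input 0 (int k + 2) = bit k" if "k < 8 * n ^ 3"
proof -
  have "int k < int (8 * n ^ 3)" using that by (rule of_nat_less_iff[THEN iffD2])
  then have "initial input 0 (int k + 2) = input ! (k + 2)"
    using length_input by (simp add: initial_def nat_add_distrib)
  also have "\<dots> = bit k" using that by (simp add: input_def encode_eq bit_def)
  finally show ?thesis .
qed

lemma contents_0 [simp]: "contents 0 = initial input 0"
  by (simp add: contents_def)

lemma val_counter: "val counter (memory contents q g c) = c"
  by (simp add: memory_def)

lemma abs_bit: "\<bar>bit k\<bar> \<le> 1"
  by (simp add: bit_def)

section \<open>The final arrays hold the intended quantities\<close>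

lemma contents_card: "contents 3 0 = M"
  using sum_decode[OF I_subset, of "\<lambda>_. 1"] by (simp add: contents_def accum_const bit_def M_def)

lemma contents_occurrences: "contents 4 (int u) = occurrences I u"
proof -
  have "contents 4 (int u) = accum (\<lambda>k. int (coord 2 (decode n k))) bit (8 * n ^ 3) (int u)"
    by (simp add: contents_def)
  also have "\<dots> = (\<Sum>k<8 * n ^ 3. of_bool (coord 2 (decode n k) = u) * of_bool (decode n k \<in> I))"
    unfolding accum_def bit_def by (intro sum.cong) auto
  also have "\<dots> = (\<Sum>C\<in>I. of_bool (coord 2 C = u))" using I_subset by (rule sum_decode)
  finally show ?thesis using finite_I by (simp add: occurrences_def Int_def)
qed

lemma contents_irregularity: "contents 5 0 = irregularity n I"
  by (simp add: contents_def accum_const irregularity_def M_def)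

lemma contents_power: "k \<le> n \<Longrightarrow> contents 6 (int k) = 2 ^ k"
  by (simp add: contents_def accum_int)

lemma contents_log: "contents 7 0 = int (floorlog 2 n)"
  by (simp add: contents_def accum_const card_powers_le)

lemma contents_depth: "contents 8 0 = int J"
  by (simp add: contents_def accum_const card_powers_le floorlog_le_self J_def depth_def)

lemma contents_squares:
  "contents 9 (int J) = ((r * M)\<^sup>2) ^ 2 ^ J" "contents 10 (int J) = ((16 * 2 ^ n * int n)\<^sup>2) ^ 2 ^ J"
  by (simp_all add: contents_def accum_int)

lemma contents_matrix:
  assumes "t < 7" "u < n" "v < n"
  shows "contents (11 + t) (int (u * n + v)) = T t u v"
proof -
  obtain i j p where p: "patterns ! t = (i, j, p)" by (metis prod.exhaust)
  have "contents (11 + t) (int (u * n + v)) = (\<Sum>k<8 * n ^ 3.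
      (if coord i (decode n k) = u \<and> coord j (decode n k) = v then csign p (decode n k) else 0) *
      of_bool (decode n k \<in> I))"
  proof -
    have "int (coord i (decode n k)) * int n + int (coord j (decode n k)) = int (u * n + v) \<longleftrightarrow>
        coord i (decode n k) = u \<and> coord j (decode n k) = v" if "k < 8 * n ^ 3" for k
    proof -
      have "coord j (decode n k) < n" using that decode_in_clauses coord_less by blast
      then have "(coord i (decode n k) * n + coord j (decode n k)) div n = coord i (decode n k)"
        "(coord i (decode n k) * n + coord j (decode n k)) mod n = coord j (decode n k)"
        "(u * n + v) div n = u" "(u * n + v) mod n = v" using \<open>v < n\<close> by simp_all
      then have "coord i (decode n k) * n + coord j (decode n k) = u * n + v \<longleftrightarrow>
          coord i (decode n k) = u \<and> coord j (decode n k) = v" by metis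
      then show ?thesis by (metis of_nat_add of_nat_eq_iff of_nat_mult)
    qed
    then have "accum (\<lambda>k. int (coord i (decode n k)) * int n + int (coord j (decode n k)))
         (\<lambda>k. csign p (decode n k) * bit k) (8 * n ^ 3) (int (u * n + v)) = (\<Sum>k<8 * n ^ 3.
      (if coord i (decode n k) = u \<and> coord j (decode n k) = v then csign p (decode n k) else 0) *
      of_bool (decode n k \<in> I))"
      unfolding accum_def bit_def by (intro sum.cong) auto
    then show ?thesis using assms(1) by (simp add: contents_def p)
  qed
  also have "\<dots> = T t u v"
    using sum_decode[OF I_subset, of "\<lambda>C. if coord i C = u \<and> coord j C = v then csign p C else 0"]
    by (simp add: T_def sign_matrix_def p)
  finally show ?thesis .
qed

lemma gram_index:
  assumes "u < n" "v < n" "w < n" and k_def: "k = (j * n\<^sup>2 + u * n + v) * n + w"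
  shows "k div n div n div n = j" "k div n div n mod n = u" "k div n mod n = v" "k mod n = w"
    "k div n div n = j * n + u" "k div n = j * n\<^sup>2 + u * n + v"
proof -
  have n: "n > 0" using assms by auto
  show 1: "k div n = j * n\<^sup>2 + u * n + v" "k mod n = w" using assms n by (auto simp: k_def)
  have "j * n\<^sup>2 + u * n + v = (j * n + u) * n + v" by (simp add: power2_eq_square algebra_simps)
  then show 2: "k div n div n = j * n + u" "k div n mod n = v" unfolding 1 using assms n by auto
  show "k div n div n div n = j" "k div n div n mod n = u" unfolding 2 using assms n by auto
qed

lemma sum_gram_term:
  assumes "u < n" "v < n"
  shows "(\<Sum>w<n. gram_term t ((j * n\<^sup>2 + u * n + v) * n + w)) = gram n (T t) j u v"
proof -
  have "(\<Sum>w<n. gram_term t ((j * n\<^sup>2 + u * n + v) * n + w)) =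
     (\<Sum>w<n. case j of 0 \<Rightarrow> of_bool (w = 0) * T t u v
       | Suc j \<Rightarrow> gram n (T t) j u w * gram n (T t) j v w)"
    using assms gram_index[of u v _ _ j, OF _ _ _ refl] by (intro sum.cong) (simp_all add: gram_term_def)
  also have "\<dots> = gram n (T t) j u v"
    using assms by (cases j) (auto simp: of_bool_def if_distrib[of "\<lambda>x. x * _"] sum.delta cong: if_cong)
  finally show ?thesis .
qed

text \<open>Block \<open>j\<close> is complete after \<open>(j + 1) * n^3\<close> rounds, so the
  rounds of block \<open>j + 1\<close> can already read it from the same array.\<close>

lemma accum_gram_term:
  assumes "u < n" "v < n" "(j + 1) * n ^ 3 \<le> k"
  shows "accum (\<lambda>k. int (k div n)) (gram_term t) k (int (j * n\<^sup>2 + u * n + v)) = gram n (T t) j u v"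
proof -
  have "(j * n\<^sup>2 + u * n + v + 1) * n \<le> (j + 1) * n ^ 3"
  proof -
    have "u * n + v + 1 \<le> u * n + n" using assms by simp
    also have "\<dots> = (u + 1) * n" by simp
    also have "\<dots> \<le> n * n" using assms by (intro mult_right_mono) auto
    finally have "(j * n\<^sup>2 + (u * n + v + 1)) * n \<le> (j * n\<^sup>2 + n * n) * n" by (intro mult_right_mono add_left_mono) auto
    then show ?thesis by (simp add: power2_eq_square power3_eq_cube algebra_simps)
  qed
  then have "(j * n\<^sup>2 + u * n + v) * n + n \<le> k" using assms(3) by simp
  then show ?thesis using assms(1) sum_gram_term[OF assms(1,2)] by (subst accum_div) auto
qed

lemma contents_gram:
  assumes "t < 7" "u < n" "v < n"
  shows "contents (18 + t) (int (J * n\<^sup>2 + u * n + v)) = gram n (T t) J u v"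
  using assms accum_gram_term[of u v J "(J + 1) * n ^ 3"] by (simp add: contents_def)

lemma sum_square_index: "(\<Sum>k<n\<^sup>2. f (k div n) (k mod n)) = (\<Sum>u<n. \<Sum>v<n. f u v)"
proof -
  have "(\<Sum>u<n. \<Sum>k\<in>{u * n..<u * n + n}. f (k div n) (k mod n)) = (\<Sum>k<n * n. f (k div n) (k mod n))"
    by (rule sum.nat_group)
  moreover have "(\<Sum>k\<in>{u * n..<u * n + n}. f (k div n) (k mod n)) = (\<Sum>v<n. f u v)" for u
  proof -
    have "(\<Sum>k\<in>{u * n..<u * n + n}. f (k div n) (k mod n)) =
        (\<Sum>v\<in>{0..<n}. f ((v + u * n) div n) ((v + u * n) mod n))"
      using sum.shift_bounds_nat_ivl[of "\<lambda>k. f (k div n) (k mod n)" 0 "u * n" n]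
      by (simp add: add.commute)
    also have "\<dots> = (\<Sum>v\<in>{0..<n}. f u v)" by (intro sum.cong) auto
    finally show ?thesis by (simp add: lessThan_atLeast0)
  qed
  ultimately show ?thesis by (simp add: power2_eq_square)
qed

lemma contents_frob: "contents (25 + t) 0 = frob n (gram n (T t) J)"
  using sum_square_index[of "\<lambda>u v. (gram n (T t) J u v)\<^sup>2"]
  by (simp add: contents_def accum_const frob_def)

section \<open>Size bounds for the intermediate numbers\<close>

lemma abs_csign: "C \<in> clauses n \<Longrightarrow> \<bar>csign p C\<bar> \<le> 1"
  by (auto simp: csign_def clauses_def signs_def split: prod.splits)

text \<open>A Gram step multiplies two entries and sums over \<open>n \<le> z\<close> indices, so
  the exponent \<open>e\<close> of \<open>z\<close> becomes \<open>2 * e + 1\<close>. Starting from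
  1 this gives 1, 3, 7 and so on.\<close>

lemma abs_gram_le: "u < n \<Longrightarrow> v < n \<Longrightarrow> \<bar>gram n (T t) j u v\<bar> \<le> int z ^ (2 ^ Suc j - 1)"
proof (induction j arbitrary: u v)
  case 0
  obtain i j p where p: "patterns ! t = (i, j, p)" by (metis prod.exhaust)
  have "\<bar>T t u v\<bar> \<le> (\<Sum>C\<in>I. \<bar>if coord i C = u \<and> coord j C = v then csign p C else 0\<bar>)"
    unfolding T_def sign_matrix_def p prod.case by (rule sum_abs)
  also have "\<dots> \<le> (\<Sum>C\<in>I. 1)"
  proof (intro sum_mono)
    fix C assume "C \<in> I"
    then have "\<bar>csign p C\<bar> \<le> 1" using I_subset by (intro abs_csign) auto
    then show "\<bar>if coord i C = u \<and> coord j C = v then csign p C else 0\<bar> \<le> 1" by simp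
  qed
  also have "\<dots> \<le> int z" using M_bounds(2) by (simp add: M_def)
  finally show ?case by simp
next
  case (Suc j)
  let ?e = "2 ^ Suc j - 1 :: nat"
  have "\<bar>gram n (T t) (Suc j) u v\<bar> \<le> (\<Sum>w<n. \<bar>gram n (T t) j u w * gram n (T t) j v w\<bar>)"
    by (simp only: gram.simps sum_abs)
  also have "\<dots> \<le> (\<Sum>w<n. int z ^ ?e * int z ^ ?e)"
    unfolding abs_mult using Suc by (intro sum_mono mult_mono) auto
  also have "\<dots> = int n * int z ^ (?e + ?e)" by (simp only: sum_constant card_lessThan power_add)
  also have "\<dots> \<le> int z * int z ^ (?e + ?e)" using size_bounds(1) by (intro mult_right_mono) auto
  also have "\<dots> = int z ^ (1 + (?e + ?e))" by simp
  also have "1 + (?e + ?e) = 2 ^ Suc (Suc j) - 1"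
  proof -
    have "(1::nat) \<le> 2 ^ Suc j" by simp
    then show ?thesis by (simp only: power_Suc[of 2 "Suc j"])
  qed
  finally show ?case .
qed

lemma abs_gram_le_K:
  assumes "u < n" "v < n" "2 ^ Suc j \<le> e"
  shows "\<bar>gram n (T t) j u v\<bar> \<le> int z ^ e"
proof -
  have "int z ^ (2 ^ Suc j - 1) \<le> int z ^ e"
    using assms(3) size_bounds(2) by (intro power_increasing) auto
  with abs_gram_le[OF assms(1,2), of t j] show ?thesis by linarith
qed

lemma power_le_K: "j \<le> J \<Longrightarrow> 2 ^ j \<le> K"
  by (simp add: K_def)

lemma abs_gram_term_le:
  assumes "k < (J + 1) * n ^ 3"
  shows "\<bar>gram_term t k\<bar> \<le> int z ^ (2 * K)"
proof -
  have n: "n > 0" using assms by (cases n) auto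
  have "k < (J + 1) * n * n * n" using assms by (simp only: power3_eq_cube mult.assoc)
  then have "k div n div n div n < J + 1" by (simp add: less_mult_imp_div_less)
  show ?thesis
  proof (cases "k div n div n div n")
    case 0
    have "\<bar>T t (k div n div n mod n) (k div n mod n)\<bar> \<le> int z ^ (2 * K)"
      using abs_gram_le_K[of "k div n div n mod n" "k div n mod n" 0 "2 * K" t] n K_bounds(1) by simp
    with 0 size_bounds(2) show ?thesis by (simp add: gram_term_def)
  next
    case (Suc j)
    with \<open>k div n div n div n < J + 1\<close> have "2 ^ Suc j \<le> K" by (intro power_le_K) auto
    then have "\<bar>gram n (T t) j u v\<bar> \<le> int z ^ K" if "u < n" "v < n" for u v
      using that by (intro abs_gram_le_K)
    then have "\<bar>gram n (T t) j (k div n div n mod n) (k mod n) * gram n (T t) j (k div n mod n) (k mod n)\<bar>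
        \<le> int z ^ K * int z ^ K"
      unfolding abs_mult using n by (intro mult_mono) auto
    with Suc show ?thesis by (simp add: gram_term_def Let_def mult_2 power_add)
  qed
qed

abbreviation "ok \<equiv> stage_ok b (z\<^sup>2) contents"

lemma z_le_square: "z \<le> z\<^sup>2"
  using size_bounds(2) by (simp add: power2_eq_square)

lemma int_bounds: "8 * int n ^ 3 \<le> int z" "int n + 2 \<le> int z" "(int n)\<^sup>2 \<le> int z"
  using size_bounds(5,1,3)[THEN of_nat_mono, where 'a = int] by simp_all

section \<open>Every stage computes its array\<close>

lemma ok_count: "ok 3 (clause_count, Const 0, clause_bit)"
proof (rule stage_okI[where N = "8 * n ^ 3" and y = bit and Y = 1 and idx = "\<lambda>_. 0"])
  show "8 * n ^ 3 \<le> z\<^sup>2" using size_bounds(5) z_le_square by linarith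
qed (use int_bounds(1) in \<open>auto simp: contents_def memory_def initial_dim initial_bit abs_bit
      power3_eq_cube intro: less_bound\<close>)

lemma ok_occurrences: "ok 4 (clause_count, coord_exp 2, clause_bit)"
proof (rule stage_okI[where N = "8 * n ^ 3" and y = bit and Y = 1 and
      idx = "\<lambda>k. int (coord 2 (decode n k))"])
  show "8 * n ^ 3 \<le> z\<^sup>2" using size_bounds(5) z_le_square by linarith
qed (use int_bounds(1) in \<open>auto simp: contents_def memory_def initial_dim initial_bit abs_bit
      power3_eq_cube val_coord_exp intro: less_bound\<close>)

lemma ok_irregularity: "ok 5 (dim, Const 0, Square (Sub (Mul dim (Cell 4 counter)) (Cell 3 (Const 0))))"
proof (rule stage_okI[where N = n and y = "\<lambda>u. (int n * occurrences I u - M)\<^sup>2" and Y = "int z ^ 4" and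
      idx = "\<lambda>_. 0"])
  show "n \<le> z\<^sup>2" using size_bounds(1) z_le_square by linarith
  show "int n < 2 ^ b" using int_bounds(2) by (intro less_bound) simp
  have "int n * int z ^ 4 \<le> int z * int z ^ 4" using int_bounds(2) by (intro mult_right_mono) auto
  then show "int n * int z ^ 4 < 2 ^ b" using K_bounds(1) by (intro less_bound_power[of _ 5]) (auto simp: eval_nat_numeral)
  fix k
  have occ: "0 \<le> occurrences I k" "occurrences I k \<le> M"
    using finite_I by (auto simp: occurrences_def M_def intro!: card_mono)
  then have "int n * occurrences I k \<le> int z * int z"
    using int_bounds(2) M_bounds by (intro mult_mono) auto
  moreover have "0 \<le> int n * occurrences I k" using occ by simp
  moreover have "M \<le> int z * int z"
    using M_bounds(2) z_le_square[THEN of_nat_mono, where 'a = int] by (simp add: power2_eq_square)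
  ultimately have "\<bar>int n * occurrences I k - M\<bar> \<le> int z * int z" using M_bounds(1) by linarith
  then have "\<bar>int n * occurrences I k - M\<bar>\<^sup>2 \<le> (int z * int z)\<^sup>2" by (intro power_mono) auto
  then show "\<bar>(int n * occurrences I k - M)\<^sup>2\<bar> \<le> int z ^ 4" by (simp add: power4_eq_xxxx power2_eq_square mult_ac)
qed (simp_all add: contents_occurrences contents_card memory_def initial_dim, simp add: contents_def)

lemma ok_powers:
  "ok 6 (Add dim (Const 1), counter, Add (Mul (Const 2) (Cell 6 (Sub counter (Const 1)))) (Zero_test counter))"
proof (rule stage_okI[where N = "n + 1" and y = "\<lambda>k. 2 ^ k" and Y = "2 ^ n" and idx = int])
  show "n + 1 \<le> z\<^sup>2" using size_bounds(1) z_le_square by linarith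
  show "int (n + 1) < 2 ^ b" using int_bounds(2) by (intro less_bound) simp
  have "int (n + 1) * 2 ^ n \<le> int z * 2 ^ n" using int_bounds(2) by (intro mult_right_mono) auto
  also have "\<dots> < 2 ^ z * 2 ^ n" by (intro mult_strict_right_mono) auto
  also have "\<dots> = 2 ^ (z + n)" by (simp add: power_add)
  finally show "int (n + 1) * 2 ^ n < 2 ^ b" using size_bounds(1) by (intro less_bound_exp[of _ "z + n"]) auto
  fix k assume "k < n + 1"
  then show "\<bar>2 ^ k\<bar> \<le> (2 ^ n :: int)" by simp
  show "val (Add (Mul (Const 2) (Cell 6 (Sub counter (Const 1)))) (Zero_test counter))
      (memory contents 6 (accum int (\<lambda>k. 2 ^ k) k) (int k)) = 2 ^ k"
    by (cases k) (simp_all add: memory_def accum_int)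
qed (simp_all add: memory_def initial_dim contents_def)

lemma dim_less: "n < 2 ^ b"
  using less_bound[of "int n"] int_bounds(2) by simp

lemma ok_log: "ok 7 (dim, Const 0, Sub (Const 1) (Zero_test (Quot dim (Cell 6 counter))))"
proof (rule stage_okI[where N = n and y = "\<lambda>i. of_bool (2 ^ i \<le> n)" and Y = 1 and idx = "\<lambda>_. 0"])
  show "n \<le> z\<^sup>2" using size_bounds(1) z_le_square by linarith
  fix k assume "k < n"
  have "int n div 2 ^ k = 0 \<longleftrightarrow> \<not> 2 ^ k \<le> n"
    by (simp add: div_eq_0_iff zdiv_int[of n "2 ^ k", simplified, symmetric] not_le)
  with \<open>k < n\<close> show "val (Sub (Const 1) (Zero_test (Quot dim (Cell 6 counter))))
      (memory contents 7 (accum (\<lambda>_. 0) (\<lambda>i. of_bool (2 ^ i \<le> n)) k) (int k)) = of_bool (2 ^ k \<le> n)"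
    by (simp add: memory_def initial_dim contents_power pos_imp_zdiv_nonneg_iff)
qed (auto simp: contents_def memory_def initial_dim dim_less)

lemma ok_depth: "ok 8 (dim, Const 0, Sub (Const 1) (Zero_test (Quot (Cell 7 (Const 0)) (Cell 6 counter))))"
proof (rule stage_okI[where N = n and y = "\<lambda>i. of_bool (2 ^ i \<le> floorlog 2 n)" and Y = 1 and idx = "\<lambda>_. 0"])
  show "n \<le> z\<^sup>2" using size_bounds(1) z_le_square by linarith
  fix k assume "k < n"
  have "int (floorlog 2 n) div 2 ^ k = 0 \<longleftrightarrow> \<not> 2 ^ k \<le> floorlog 2 n"
    by (simp add: div_eq_0_iff zdiv_int[of "floorlog 2 n" "2 ^ k", simplified, symmetric] not_le)
  with \<open>k < n\<close> show "val (Sub (Const 1) (Zero_test (Quot (Cell 7 (Const 0)) (Cell 6 counter))))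
      (memory contents 8 (accum (\<lambda>_. 0) (\<lambda>i. of_bool (2 ^ i \<le> floorlog 2 n)) k) (int k)) =
      of_bool (2 ^ k \<le> floorlog 2 n)"
    by (simp add: memory_def contents_log contents_power pos_imp_zdiv_nonneg_iff)
qed (auto simp: contents_def memory_def initial_dim dim_less)

lemma ok_squares:
  assumes q: "q \<ge> 9" "contents q = accum int (\<lambda>j. (x\<^sup>2) ^ 2 ^ j) (J + 1)" and x: "\<bar>x\<bar> < 2 ^ (2 * z)"
    and e: "\<And>g c. val e (memory contents q g c) = x\<^sup>2"
  shows "ok q (repeated_squares q e)"
  unfolding repeated_squares_def
proof (rule stage_okI[where N = "J + 1" and y = "\<lambda>j. (x\<^sup>2) ^ 2 ^ j" and Y = "2 ^ (4 * z * K)" and idx = int])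
  show "J + 1 \<le> z\<^sup>2" using size_bounds(1) z_le_square depth_le by linarith
  show "int (J + 1) < 2 ^ b" using int_bounds(2) depth_le by (intro less_bound) simp
  have "int (J + 1) * 2 ^ (4 * z * K) \<le> int z * 2 ^ (4 * z * K)"
    using int_bounds(2) depth_le by (intro mult_right_mono) auto
  also have "\<dots> < 2 ^ z * 2 ^ (4 * z * K)" by (intro mult_strict_right_mono) auto
  also have "\<dots> = 2 ^ (z + 4 * z * K)" by (simp add: power_add)
  also have "\<dots> \<le> 2 ^ b"
  proof (intro power_increasing)
    have "z * 1 \<le> z * K" using K_bounds(1) by (intro mult_left_mono) auto
    then show "z + 4 * z * K \<le> b" by (simp add: b_def)
  qed simp
  finally show "int (J + 1) * 2 ^ (4 * z * K) < 2 ^ b" .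
  have x2: "x\<^sup>2 \<le> 2 ^ (4 * z)"
  proof -
    have "\<bar>x\<bar>\<^sup>2 \<le> (2 ^ (2 * z))\<^sup>2" using x by (intro power_mono) auto
    then show ?thesis by (simp flip: power_mult)
  qed
  fix k assume k: "k < J + 1"
  have "(x\<^sup>2) ^ 2 ^ k \<le> (2 ^ (4 * z)) ^ 2 ^ k" using x2 by (intro power_mono) auto
  also have "\<dots> \<le> (2 ^ (4 * z)) ^ K" using k by (intro power_increasing power_le_K) auto
  finally show "\<bar>(x\<^sup>2) ^ 2 ^ k\<bar> \<le> 2 ^ (4 * z * K)" by (simp add: power_mult)
  show "val (Add (Square (Cell q (Sub counter (Const 1)))) (Mul (Zero_test counter) e))
      (memory contents q (accum int (\<lambda>j. (x\<^sup>2) ^ 2 ^ j) k) (int k)) = (x\<^sup>2) ^ 2 ^ k"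
  proof (cases k)
    case 0
    then show ?thesis using q(1) e by (simp add: val_counter accum_int) (simp add: memory_def accum_int)
  next
    case (Suc j)
    have "((x\<^sup>2) ^ 2 ^ j)\<^sup>2 = (x\<^sup>2) ^ 2 ^ k" by (simp add: Suc flip: power_mult)
    then show ?thesis using q(1) Suc by (simp add: memory_def accum_int)
  qed
qed (use q in \<open>simp_all add: memory_def contents_depth\<close>)

lemma ok_bias_squares: "ok 9 (repeated_squares 9 (Square (Mul (Cell 0 (Const 1)) (Cell 3 (Const 0)))))"
proof (rule ok_squares[where x = "r * M"])
  have "int z < 2 ^ z" by simp
  then have "\<bar>M\<bar> < 2 ^ z" using M_bounds by linarith
  then have "\<bar>r\<bar> * \<bar>M\<bar> < 2 ^ z * 2 ^ z" using abs_r_less by (intro mult_strict_mono') auto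
  then show "\<bar>r * M\<bar> < 2 ^ (2 * z)" by (simp add: abs_mult mult_2 power_add)
qed (simp_all add: contents_card memory_def initial_bias, simp add: contents_def)

lemma ok_threshold_squares: "ok 10 (repeated_squares 10 (Square (Mul (Mul (Const 16) (Cell 6 dim)) dim)))"
proof (rule ok_squares[where x = "16 * 2 ^ n * int n"])
  have "16 * 2 ^ n * int n < 16 * 2 ^ n * 2 ^ n" by (intro mult_strict_left_mono) auto
  also have "\<dots> = 2 ^ (4 + n + n)" by (simp only: power_add) simp
  also have "\<dots> \<le> 2 ^ (2 * z)" using size_bounds(1) by (intro power_increasing) auto
  finally show "\<bar>16 * 2 ^ n * int n\<bar> < 2 ^ (2 * z)" by simp
qed (simp_all add: contents_power memory_def initial_dim, simp add: contents_def)

lemma ok_matrix: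
  assumes "t < 7"
  shows "ok (11 + t) (matrix_stage (patterns ! t))"
proof -
  obtain i j p where p: "patterns ! t = (i, j, p)" by (metis prod.exhaust)
  show ?thesis unfolding matrix_stage_def p prod.case
  proof (rule stage_okI[where N = "8 * n ^ 3" and y = "\<lambda>k. csign p (decode n k) * bit k" and Y = 1 and
        idx = "\<lambda>k. int (coord i (decode n k)) * int n + int (coord j (decode n k))"])
    show "8 * n ^ 3 \<le> z\<^sup>2" using size_bounds(5) z_le_square by linarith
    fix k assume k: "k < 8 * n ^ 3"
    have "\<bar>csign p (decode n k)\<bar> * \<bar>bit k\<bar> \<le> 1 * 1"
      using abs_csign[OF decode_in_clauses[OF k]] abs_bit by (intro mult_mono) auto
    then show "\<bar>csign p (decode n k) * bit k\<bar> \<le> 1" by (simp add: abs_mult)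
    let ?s = "memory contents (11 + t) (accum (\<lambda>k. int (coord i (decode n k)) * int n +
      int (coord j (decode n k))) (\<lambda>k. csign p (decode n k) * bit k) k) (int k)"
    have s: "val dim ?s = int n" "val counter ?s = int k" by (simp_all add: memory_def initial_dim)
    show "val (Add (Mul (coord_exp i) dim) (coord_exp j)) ?s =
        int (coord i (decode n k)) * int n + int (coord j (decode n k))"
      using s val_coord_exp[OF s] by simp
    show "val (Mul (csign_exp p) clause_bit) ?s = csign p (decode n k) * bit k"
      using val_csign_exp[OF s(2)] k by (simp add: memory_def initial_bit)
  qed (use int_bounds(1) assms in \<open>auto simp: contents_def p memory_def initial_dim
      power3_eq_cube intro: less_bound\<close>)
qed

text \<open>In block \<open>j > 0\<close> both factors are read \<open>n^2\<close> cells earlier, in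
  block \<open>j - 1\<close>, which is complete by then. In block 0 only the copied matrix entry
  must contribute.\<close>

lemma ok_gram:
  assumes "t < 7"
  shows "ok (18 + t) (gram_stage (18 + t) (11 + t))"
  unfolding gram_stage_def
proof (rule stage_okI[where N = "(J + 1) * n ^ 3" and y = "gram_term t" and Y = "int z ^ (2 * K)" and
      idx = "\<lambda>k. int (k div n)"])
  have N: "(J + 1) * n ^ 3 \<le> z\<^sup>2"
  proof -
    have "(J + 1) * n ^ 3 \<le> z * z" using size_bounds depth_le by (intro mult_mono) auto
    then show ?thesis by (simp add: power2_eq_square)
  qed
  then show "(J + 1) * n ^ 3 \<le> z\<^sup>2" .
  have N': "int ((J + 1) * n ^ 3) \<le> (int z)\<^sup>2" using N[THEN of_nat_mono, where 'a = int] by simp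
  then show "int ((J + 1) * n ^ 3) < 2 ^ b" using K_bounds(1) by (intro less_bound_power[of _ 2]) auto
  have "int ((J + 1) * n ^ 3) * int z ^ (2 * K) \<le> (int z)\<^sup>2 * int z ^ (2 * K)"
    using N' by (intro mult_right_mono) auto
  also have "\<dots> = int z ^ (2 + 2 * K)" by (simp only: power_add)
  finally show "int ((J + 1) * n ^ 3) * int z ^ (2 * K) < 2 ^ b"
    using K_bounds(1) by (intro less_bound_power[of _ "2 + 2 * K"]) auto
  show "contents (18 + t) = accum (\<lambda>k. int (k div n)) (gram_term t) ((J + 1) * n ^ 3)"
    using assms by (simp add: contents_def)
  fix k
  let ?s = "memory contents (18 + t) (accum (\<lambda>k. int (k div n)) (gram_term t) k) (int k)"
  have s: "val dim ?s = int n" "val counter ?s = int k" by (simp_all add: memory_def initial_dim)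
  show "val (Mul (Add (Cell 8 (Const 0)) (Const 1)) dim3) ?s = int ((J + 1) * n ^ 3)"
    by (simp add: memory_def contents_depth initial_dim power3_eq_cube algebra_simps)
  show "val (Quot counter dim) ?s = int (k div n)"
    using s by (simp add: zdiv_int del: val.simps(2))
  assume k: "k < (J + 1) * n ^ 3"
  then show "\<bar>gram_term t k\<bar> \<le> int z ^ (2 * K)" by (rule abs_gram_term_le)
  have n: "n > 0" using k by (cases n) auto
  define j u v w where "j = k div n div n div n" and "u = k div n div n mod n" and "v = k div n mod n"
    and "w = k mod n"
  have uvw: "u < n" "v < n" "w < n" using n by (auto simp: u_def v_def w_def)
  have jn: "k div n div n = j * n + u" unfolding j_def u_def by simp
  have kn: "k div n = (j * n + u) * n + v" unfolding jn[symmetric] v_def by simp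
  have kn': "k = ((j * n + u) * n + v) * n + w" unfolding kn[symmetric] w_def by simp
  have cell: "val (Cell (18 + t) e) ?s = accum (\<lambda>k. int (k div n)) (gram_term t) k (val e ?s)" for e
    by (simp add: memory_def)
  have cell': "val (Cell (11 + t) e) ?s = contents (11 + t) (val e ?s)" for e
    using assms by (simp add: memory_def)
  have vals: "val (Quot counter dim) ?s = int (k div n)" "val (Mod counter dim) ?s = int w"
    "val (Quot (Quot counter dim) dim) ?s = int (j * n + u)"
    "val (Quot (Quot (Quot counter dim) dim) dim) ?s = int j" "val (Mod (Quot counter dim) dim) ?s = int v"
    using s unfolding jn[symmetric] unfolding j_def v_def w_def
    by (simp_all add: zdiv_int zmod_int power2_eq_square del: val.simps(2))
  let ?a1 = "(int (j * n + u)) * int n + int w - int n * int n"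
  let ?a2 = "int j * (int n * int n) + int v * int n + int w - int n * int n"
  have lhs: "val (Add (Mul (Mul (Zero_test (Quot (Quot (Quot counter dim) dim) dim)) (Zero_test (Mod counter dim)))
            (Cell (11 + t) (Quot counter dim)))
       (Mul (Cell (18 + t) (Sub (Add (Mul (Quot (Quot counter dim) dim) dim) (Mod counter dim)) dim2))
         (Cell (18 + t) (Sub (Add (Add (Mul (Quot (Quot (Quot counter dim) dim) dim) dim2)
            (Mul (Mod (Quot counter dim) dim) dim)) (Mod counter dim)) dim2)))) ?s =
      of_bool (j = 0) * of_bool (w = 0) * contents (11 + t) (int (k div n)) +
      accum (\<lambda>k. int (k div n)) (gram_term t) k ?a1 * accum (\<lambda>k. int (k div n)) (gram_term t) k ?a2"
  proof -
    have z: "val (Zero_test (Quot (Quot (Quot counter dim) dim) dim)) ?s = of_bool (j = 0)"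
      "val (Zero_test (Mod counter dim)) ?s = of_bool (w = 0)"
      by (subst val_Zero_test; simp only: vals; simp)+
    show ?thesis by (simp only: val.simps(3-5) z cell cell' vals s)
  qed
  show "val (Add (Mul (Mul (Zero_test (Quot (Quot (Quot counter dim) dim) dim)) (Zero_test (Mod counter dim)))
            (Cell (11 + t) (Quot counter dim)))
       (Mul (Cell (18 + t) (Sub (Add (Mul (Quot (Quot counter dim) dim) dim) (Mod counter dim)) dim2))
         (Cell (18 + t) (Sub (Add (Add (Mul (Quot (Quot (Quot counter dim) dim) dim) dim2)
            (Mul (Mod (Quot counter dim) dim) dim)) (Mod counter dim)) dim2)))) ?s = gram_term t k"
    unfolding lhs
  proof (cases j)
    case 0
    have "u * n + w < n\<^sup>2"
    proof -
      have "u * n + w < (u + 1) * n" using uvw by simp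
      also have "\<dots> \<le> n * n" using uvw by (intro mult_right_mono) auto
      finally show ?thesis by (simp add: power2_eq_square)
    qed
    then have "int (u * n + w) < int (n\<^sup>2)" by (rule of_nat_less_iff[THEN iffD2])
    \<comment> \<open>A negative address reads 0, so in block 0 the product of the two cells
      vanishes.\<close>
    then have "?a1 < 0" by (simp add: 0 power2_eq_square)
    then have "accum (\<lambda>k. int (k div n)) (gram_term t) k ?a1 = 0" by (rule accum_neg)
    moreover have "contents (11 + t) (int (k div n)) = T t u v"
      using contents_matrix[OF assms uvw(1,2)] by (simp add: kn 0)
    ultimately show "of_bool (j = 0) * of_bool (w = 0) * contents (11 + t) (int (k div n)) +
      accum (\<lambda>k. int (k div n)) (gram_term t) k ?a1 * accum (\<lambda>k. int (k div n)) (gram_term t) k ?a2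
      = gram_term t k"
      using 0 by (simp add: gram_term_def flip: j_def u_def v_def w_def)
  next
    case (Suc i)
    have "(i + 1) * n ^ 3 \<le> k"
    proof -
      have "(i + 1) * n ^ 3 = j * n * n * n" by (simp add: Suc power3_eq_cube algebra_simps)
      also have "\<dots> \<le> ((j * n + u) * n + v) * n + w" by (simp add: algebra_simps)
      finally show ?thesis using kn' by simp
    qed
    moreover have "?a1 = int (i * n\<^sup>2 + u * n + w)" "?a2 = int (i * n\<^sup>2 + v * n + w)"
      by (simp_all add: Suc power2_eq_square algebra_simps)
    ultimately have "accum (\<lambda>k. int (k div n)) (gram_term t) k ?a1 = gram n (T t) i u w"
      "accum (\<lambda>k. int (k div n)) (gram_term t) k ?a2 = gram n (T t) i v w"
      using uvw by (simp_all only: accum_gram_term)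
    then show "of_bool (j = 0) * of_bool (w = 0) * contents (11 + t) (int (k div n)) +
      accum (\<lambda>k. int (k div n)) (gram_term t) k ?a1 * accum (\<lambda>k. int (k div n)) (gram_term t) k ?a2
      = gram_term t k"
      using Suc by (simp add: gram_term_def flip: j_def u_def v_def w_def)
  qed
qed

lemma ok_frob:
  assumes "t < 7"
  shows "ok (25 + t) (frob_stage (18 + t))"
  unfolding frob_stage_def
proof (rule stage_okI[where N = "n\<^sup>2" and y = "\<lambda>k. (gram n (T t) J (k div n) (k mod n))\<^sup>2" and
      Y = "int z ^ (4 * K)" and idx = "\<lambda>_. 0"])
  show "n\<^sup>2 \<le> z\<^sup>2" using size_bounds(1) by (intro power_mono) auto
  show "int (n\<^sup>2) < 2 ^ b" using int_bounds(3) by (intro less_bound) simp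
  have "int (n\<^sup>2) * int z ^ (4 * K) \<le> int z * int z ^ (4 * K)"
    using int_bounds(3) by (intro mult_right_mono) auto
  then show "int (n\<^sup>2) * int z ^ (4 * K) < 2 ^ b"
    using K_bounds(1) by (intro less_bound_power[of _ "1 + 4 * K"]) auto
  show "contents (25 + t) = accum (\<lambda>_. 0) (\<lambda>k. (gram n (T t) J (k div n) (k mod n))\<^sup>2) (n\<^sup>2)"
    by (simp add: contents_def)
  fix k
  let ?s = "memory contents (25 + t) (accum (\<lambda>_. 0) (\<lambda>k. (gram n (T t) J (k div n) (k mod n))\<^sup>2) k) (int k)"
  show "val dim2 ?s = int (n\<^sup>2)" by (simp add: memory_def initial_dim power2_eq_square)
  show "val (Const 0) ?s = 0" by simp
  assume k: "k < n\<^sup>2"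
  then have n: "n > 0" by (cases n) auto
  have kdiv: "k div n < n" "k mod n < n" using k n by (auto simp: power2_eq_square less_mult_imp_div_less)
  have "2 ^ Suc J \<le> 2 * K" by (simp add: K_def)
  then have "\<bar>gram n (T t) J (k div n) (k mod n)\<bar>\<^sup>2 \<le> (int z ^ (2 * K))\<^sup>2"
    using kdiv by (intro power_mono abs_gram_le_K) auto
  then show "\<bar>(gram n (T t) J (k div n) (k mod n))\<^sup>2\<bar> \<le> int z ^ (4 * K)" by (simp flip: power_mult add: mult.commute)
  have "val (Square (Cell (18 + t) (Add (Mul (Cell 8 (Const 0)) dim2) counter))) ?s =
      (contents (18 + t) (int (J * n\<^sup>2 + k)))\<^sup>2"
    using assms by (simp add: memory_def contents_depth initial_dim power2_eq_square)
  also have "J * n\<^sup>2 + k = J * n\<^sup>2 + (k div n) * n + k mod n" by simp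
  finally show "val (Square (Cell (18 + t) (Add (Mul (Cell 8 (Const 0)) dim2) counter))) ?s =
      (gram n (T t) J (k div n) (k mod n))\<^sup>2"
    using assms kdiv by (simp only: contents_gram)
qed

lemma length_patterns: "length patterns = 7"
  by (simp add: patterns_def)

lemma nth_stages:
  "t < 7 \<Longrightarrow> certifier_stages ! (8 + t) = matrix_stage (patterns ! t)"
  "t < 7 \<Longrightarrow> certifier_stages ! (15 + t) = gram_stage (18 + t) (11 + t)"
  "t < 7 \<Longrightarrow> certifier_stages ! (22 + t) = frob_stage (18 + t)"
  by (simp_all add: certifier_stages_def nth_append length_patterns del: upt_rec_numeral)

lemma length_stages: "length certifier_stages = 29"
  by (simp add: certifier_stages_def length_patterns)

lemma stages_ok:
  assumes "k < length certifier_stages"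
  shows "ok (3 + k) (certifier_stages ! k)"
proof -
  consider "k < 8" | t where "t < 7" "k = 8 + t" | t where "t < 7" "k = 15 + t" | t where "t < 7" "k = 22 + t"
  proof -
    have "k < 29" using assms by (simp add: length_stages)
    then have "k < 8 \<or> (k - 8 < 7 \<and> k = 8 + (k - 8)) \<or> (k - 15 < 7 \<and> k = 15 + (k - 15)) \<or>
        (k - 22 < 7 \<and> k = 22 + (k - 22))" by arith
    with that show thesis by blast
  qed
  then show ?thesis
  proof cases
    case 1
    then consider "k = 0" | "k = 1" | "k = 2" | "k = 3" | "k = 4" | "k = 5" | "k = 6" | "k = 7" by linarith
    then show ?thesis
      using ok_count ok_occurrences ok_irregularity ok_powers ok_log ok_depth ok_bias_squares
        ok_threshold_squares
      by cases (simp_all add: certifier_stages_def)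
  next
    case (2 t)
    with ok_matrix[of t] show ?thesis by (simp add: nth_stages)
  next
    case (3 t)
    with ok_gram[of t] show ?thesis by (simp add: nth_stages)
  next
    case (4 t)
    with ok_frob[of t] show ?thesis by (simp add: nth_stages)
  qed
qed

lemma initial_eq_memory: "initial input = memory contents 3 (\<lambda>_. 0) 0"
  by (auto simp: memory_def contents_def initial_def fun_eq_iff)

lemma tests_iff_accepts:
  "(\<forall>e\<in>set certifier_tests. val e (memory contents 32 (\<lambda>_. 0) c) > 0) \<longleftrightarrow> accepts n r I"
proof -
  let ?s = "memory contents 32 (\<lambda>_. 0) c"
  let ?e1 = "Mul (Cell 0 (Const 1)) (Cell 3 (Const 0))"
  let ?e2 = "Sub (Add (Mul (Square (Mul (Cell 0 (Const 1)) (Cell 3 (Const 0)))) dim) (Const 1))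
       (Mul (Cell 5 (Const 0)) (Square (Mul (Const 16) (Cell 6 dim))))"
  let ?e3 = "\<lambda>t. Sub (Add (Cell 9 (Cell 8 (Const 0))) (Const 1))
      (Mul (Cell (25 + t) (Const 0)) (Cell 10 (Cell 8 (Const 0))))"
  have split: "(\<forall>e\<in>set certifier_tests. Q e) \<longleftrightarrow> Q ?e1 \<and> Q ?e2 \<and> (\<forall>t<7. Q (?e3 t))" for Q
    unfolding certifier_tests_def set_append set_map list.set set_upt by fastforce
  have 1: "val ?e1 ?s > 0 \<longleftrightarrow> r * int (card I) > 0"
    by (simp add: memory_def contents_card initial_bias M_def)
  have 2: "val ?e2 ?s > 0 \<longleftrightarrow> irregularity n I * (16 * 2 ^ n)\<^sup>2 \<le> (r * int (card I))\<^sup>2 * int n"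
    by (simp add: memory_def contents_card contents_irregularity contents_power initial_bias initial_dim M_def)
  have 3: "val (?e3 t) ?s > 0 \<longleftrightarrow>
    frob n (gram n (T t) J) * ((16 * 2 ^ n * int n)\<^sup>2) ^ 2 ^ J \<le> ((r * M)\<^sup>2) ^ 2 ^ J" if "t < 7" for t
    using that by (simp add: memory_def contents_frob contents_depth contents_squares)
  have 4: "(\<forall>\<kappa>\<in>set patterns. P \<kappa>) \<longleftrightarrow> (\<forall>t<7. P (patterns ! t))" for P
    by (simp add: all_set_conv_all_nth length_patterns)
  show ?thesis unfolding split 1 2 accepts_def 4 using 3 unfolding J_def T_def M_def by blast
qed

text \<open>A stage takes at most \<open>z^2\<close> rounds on numbers of \<open>b\<close> bits with
  \<open>b + 1 \<le> 17 * z^2\<close>, hence the exponent 4; 51 is 3 times 17, from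
  \<open>z^2 + 2 \<le> 3 * z^2\<close>. The remaining factors depend only on the fixed
  program.\<close>

theorem exec_certifier:
  "\<exists>t s. exec certifier (initial input) t s \<and> s 0 0 = of_bool (accepts n r I) \<and>
    t \<le> (51 * stages_weight 3 certifier_stages +
      17 * (20 + (\<Sum>e\<leftarrow>certifier_tests. 1 + (weight e)\<^sup>2))) * z ^ 4"
proof -
  let ?S = "stages_weight 3 certifier_stages" and ?V = "20 + (\<Sum>e\<leftarrow>certifier_tests. 1 + (weight e)\<^sup>2)"
  have b: "b \<ge> 1" using size_bounds(2) K_bounds(1) by (simp add: b_def)
  have bounds: "\<bar>contents a x\<bar> < 2 ^ b" if "a < 3" for a x
  proof -
    have "\<bar>initial input a x\<bar> < 2 ^ z"
    proof -
      consider "a = 0 \<and> 0 \<le> x \<and> x < int (length input)" | "a = 1 \<and> x = 0" | "initial input a x = 0"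
        unfolding initial_def by presburger
      then show ?thesis
      proof cases
        case 1
        then have "initial input a x \<in> set input" by (auto simp: initial_def intro!: nth_mem)
        then show ?thesis by (rule abs_input_less)
      next
        case 2
        have "length input < 2 ^ z" unfolding length_input using size_ge less_exp[of z] by (rule le_less_trans)
        then show ?thesis using 2 by (simp add: initial_def)
      qed simp
    qed
    then have "\<bar>initial input a x\<bar> < 2 ^ b" by (rule less_bound_exp) simp
    then show ?thesis using that by (auto simp: contents_def)
  qed
  obtain t c where t: "exec (stages 3 certifier_stages) (initial input) t (memory contents 32 (\<lambda>_. 0) c)"
    "t \<le> (z\<^sup>2 + 2) * ?S * (b + 1)" "bounded_by b (memory contents 32 (\<lambda>_. 0) c)"
    using exec_stages[of certifier_stages b "z\<^sup>2" contents 3 0] stages_ok b bounds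
    by (auto simp: initial_eq_memory length_stages)
  obtain u s where u: "exec (verdict certifier_tests) (memory contents 32 (\<lambda>_. 0) c) u s"
    "s 0 0 = of_bool (accepts n r I)" "u \<le> ?V * (b + 1)"
    using exec_verdict[OF t(3) b, of certifier_tests] unfolding tests_iff_accepts by blast
  have z: "1 \<le> z\<^sup>2" using size_bounds(2) by simp
  have "b + 1 \<le> 17 * z\<^sup>2"
  proof -
    have "z * K \<le> z * (2 * z)" using K_bounds(2) by (intro mult_left_mono) auto
    then have "b \<le> 16 * z\<^sup>2" by (simp add: b_def power2_eq_square)
    then show ?thesis using z by linarith
  qed
  moreover have "z\<^sup>2 + 2 \<le> 3 * z\<^sup>2" using z by linarith
  ultimately have "(z\<^sup>2 + 2) * (b + 1) \<le> (3 * z\<^sup>2) * (17 * z\<^sup>2)" "1 * (b + 1) \<le> z\<^sup>2 * (17 * z\<^sup>2)"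
    using z by (intro mult_mono; simp)+
  then have *: "(z\<^sup>2 + 2) * (b + 1) \<le> 51 * z ^ 4" "b + 1 \<le> 17 * z ^ 4"
    by (simp_all add: power4_eq_xxxx power2_eq_square mult_ac)
  have "t \<le> ?S * ((z\<^sup>2 + 2) * (b + 1))" using t(2) by (simp only: mult_ac)
  also have "\<dots> \<le> ?S * (51 * z ^ 4)" using *(1) by (rule mult_left_mono) simp
  finally have "t \<le> ?S * (51 * z ^ 4)" .
  moreover have "u \<le> ?V * (17 * z ^ 4)" using u(3) mult_left_mono[OF *(2), of ?V] by linarith
  ultimately have "t + u \<le> ?S * (51 * z ^ 4) + ?V * (17 * z ^ 4)" by (rule add_mono)
  moreover have "S * (51 * y) + V * (17 * y) = (51 * S + 17 * V) * y" for S V y :: nat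
    by (simp add: algebra_simps)
  ultimately have "t + u \<le> (51 * ?S + 17 * ?V) * z ^ 4" by metis
  moreover have "exec certifier (initial input) (t + u) s"
    unfolding certifier_def using t(1) u(1) by (rule exec.Seq)
  ultimately show ?thesis using u(2) by blast
qed

end

section \<open>The probability of success\<close>

lemma coord_flip: "coord i (flip p U C) = coord i C"
  using ends_flip[of i i True] by (simp add: ends_def)

text \<open>Flipping every clause on its own triple permutes the complete hypergraph and negates
  each entry.\<close>

lemma sign_matrix_complete:
  assumes "p \<noteq> (False, False, False)"
  shows "sign_matrix (clauses n) (i, j, p) u v = 0"
proof -
  let ?f = "\<lambda>C. if coord i C = u \<and> coord j C = v then csign p C else 0"
  let ?\<Phi> = "\<lambda>C. flip p (snd C) C"
  have "sum ?f (clauses n) = sum (\<lambda>C. ?f (?\<Phi> C)) (clauses n)"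
    by (rule sum.reindex_bij_witness[where i = ?\<Phi> and j = ?\<Phi>]) (auto simp: flip_in_clauses simp del: split_paired_All)
  also have "\<dots> = - sum ?f (clauses n)"
    by (simp add: coord_flip csign_flip[OF assms] sum_negf[symmetric] if_distrib[of uminus] cong: if_cong)
  finally show ?thesis by (simp add: sign_matrix_def)
qed

lemma gram_zero: "(\<And>u v. T u v = 0) \<Longrightarrow> gram n T j u v = 0"
  by (induction j arbitrary: u v) auto

lemma accepts_complete:
  assumes "r > 0" "n > 0"
  shows "accepts n r (clauses n)"
proof -
  have "occurrences (clauses n) u = 8 * (int n)\<^sup>2" if "u < n" for u
    using card_clauses_coord[OF that, of 2] by (simp add: occurrences_def)
  then have "irregularity n (clauses n) = 0"
    by (simp add: irregularity_def card_clauses power2_eq_square power3_eq_cube)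
  moreover have "frob n (gram n (sign_matrix (clauses n) \<kappa>) k) = 0" if "\<kappa> \<in> set patterns" for \<kappa> k
    using that by (auto simp: frob_def patterns_def sign_matrix_complete gram_zero)
  ultimately show ?thesis using assms by (simp add: accepts_def card_clauses)
qed

lemma random_hypergraph_complete:
  assumes "m \<ge> 8 * real n ^ 3" "n > 0" "I \<in> set_pmf (random_hypergraph m n)"
  shows "I = clauses n"
proof -
  have p: "m / (8 * real n ^ 3) \<ge> 1" using assms by (simp add: field_simps)
  have "pmf (bernoulli_pmf (m / (8 * real n ^ 3))) False = 0"
    using p by (simp add: bernoulli_pmf.rep_eq)
  then have "False \<notin> set_pmf (bernoulli_pmf (m / (8 * real n ^ 3)))" by (simp add: set_pmf_iff)
  then have "b C" if b: "b \<in> set_pmf (Pi_pmf (clauses n) False (\<lambda>_. bernoulli_pmf (m / (8 * real n ^ 3))))"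
    and C: "C \<in> clauses n" for b C
  proof -
    have "b \<in> PiE_dflt (clauses n) False (set_pmf \<circ> (\<lambda>_. bernoulli_pmf (m / (8 * real n ^ 3))))"
      using subsetD[OF set_Pi_pmf_subset'[OF finite_clauses] b] .
    then have "b C \<in> set_pmf (bernoulli_pmf (m / (8 * real n ^ 3)))"
      using C unfolding PiE_dflt_def comp_def by blast
    with \<open>False \<notin> _\<close> show "b C" by (cases "b C") simp_all
  qed
  then show ?thesis using assms(3) by (auto simp: random_hypergraph_def)
qed

context random_instance
begin

text \<open>A rejection requires a clause count far from \<open>m\<close>, an irregularity of at
  least \<open>w\<close>, or one of seven Frobenius quantities of at least \<open>f\<close>. The
  three summands come from the variance of the count and from Markov's inequality for the other two
  kinds of events.\<close>

lemma prob_rejects_le: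
  assumes pos: "m > 0" "\<rho> > 0" and r: "2 ^ n * \<rho> \<ge> 2"
    and K: "2 ^ depth n \<le> m / real n"
    and small: "4 * 289 * 4096 * 2 ^ depth n \<le> \<rho>\<^sup>2 * (m / real n)"
  shows "measure_pmf.prob \<H> {I. \<not> accepts n \<lfloor>2 ^ n * \<rho>\<rfloor> I} \<le>
    4 / m + 4096 / (\<rho>\<^sup>2 * (m / real n)) + 7 / real n"
proof -
  define r where "r = real_of_int \<lfloor>2 ^ n * \<rho>\<rfloor>"
  define K where "K = (2::nat) ^ depth n"
  define \<Delta> where "\<Delta> = m / real n"
  \<comment> \<open>With at least \<open>m / 2\<close> clauses, \<open>r * card I\<close> is at
    least \<open>2 ^ n * \<rho> * m / 4\<close>: one half is lost to rounding the bias, one to the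
    count. Together with the 16 of the tests this gives the 4096 = (4 * 16)^2 here and in
    \<open>f\<close>.\<close>
  define w where "w = \<rho>\<^sup>2 * m\<^sup>2 * real n / 4096"
  define f where "f = (\<rho>\<^sup>2 * \<Delta>\<^sup>2 / 4096) ^ K"
  have \<Delta>: "\<Delta> > 0" using pos n_pos by (simp add: \<Delta>_def)
  let ?A = "{I. (real (card I) - m)\<^sup>2 \<ge> (m / 2)\<^sup>2}"
  let ?W = "{I. real_of_int (irregularity n I) \<ge> w}"
  let ?F = "\<lambda>\<kappa>. {I. real_of_int (frob n (gram n (sign_matrix I \<kappa>) (depth n))) \<ge> f}"
  have "r \<ge> 2 ^ n * \<rho> / 2" "r \<ge> 0" using r unfolding r_def by linarith+
  have sub: "{I. \<not> accepts n \<lfloor>2 ^ n * \<rho>\<rfloor> I} \<subseteq> ?A \<union> ?W \<union> (\<Union>\<kappa>\<in>set patterns. ?F \<kappa>)"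
  proof
    fix I assume I: "I \<in> {I. \<not> accepts n \<lfloor>2 ^ n * \<rho>\<rfloor> I}"
    show "I \<in> ?A \<union> ?W \<union> (\<Union>\<kappa>\<in>set patterns. ?F \<kappa>)"
    proof (cases "I \<in> ?A")
      case False
      have M: "real (card I) \<ge> m / 2"
      proof (rule ccontr)
        assume "\<not> real (card I) \<ge> m / 2"
        then have "(m / 2)\<^sup>2 \<le> (m - real (card I))\<^sup>2" using pos by (intro power_mono) auto
        with False show False by (simp add: power2_commute)
      qed
      define Q where "Q = 2 ^ n * \<rho> * m / 4"
      have Q: "Q > 0" using pos by (simp add: Q_def)
      have "(2 ^ n * \<rho> / 2) * (m / 2) \<le> r * real (card I)"
        using \<open>r \<ge> 2 ^ n * \<rho> / 2\<close> \<open>r \<ge> 0\<close> M pos by (intro mult_mono) auto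
      then have rM: "Q \<le> r * real (card I)" by (simp add: Q_def)
      have "0 < r * real (card I)" using rM Q by linarith
      then have "0 < \<lfloor>2 ^ n * \<rho>\<rfloor> * int (card I)"
        unfolding r_def by (metis of_int_0_less_iff of_int_mult of_int_of_nat_eq)
      with I consider
        "\<not> irregularity n I * (16 * 2 ^ n)\<^sup>2 \<le> (\<lfloor>2 ^ n * \<rho>\<rfloor> * int (card I))\<^sup>2 * int n" |
        \<kappa> where "\<kappa> \<in> set patterns" "\<not> frob n (gram n (sign_matrix I \<kappa>) (depth n)) *
          ((16 * 2 ^ n * int n)\<^sup>2) ^ 2 ^ depth n \<le> ((\<lfloor>2 ^ n * \<rho>\<rfloor> * int (card I))\<^sup>2) ^ 2 ^ depth n"
        unfolding accepts_def by blast
      then show ?thesis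
      proof cases
        case 1
        then have "real_of_int ((\<lfloor>2 ^ n * \<rho>\<rfloor> * int (card I))\<^sup>2 * int n) \<le> real_of_int (irregularity n I * (16 * 2 ^ n)\<^sup>2)"
          by (subst of_int_le_iff) linarith
        then have "(r * real (card I))\<^sup>2 * real n \<le> real_of_int (irregularity n I) * (16 * 2 ^ n)\<^sup>2"
          by (simp add: r_def)
        moreover have "Q\<^sup>2 * real n \<le> (r * real (card I))\<^sup>2 * real n"
          using rM Q by (intro mult_right_mono power_mono) auto
        moreover have "Q\<^sup>2 * real n = w * (16 * 2 ^ n)\<^sup>2"
          by (simp add: Q_def w_def power_mult_distrib power_divide)
        ultimately have "w * (16 * 2 ^ n)\<^sup>2 \<le> real_of_int (irregularity n I) * (16 * 2 ^ n)\<^sup>2" by linarith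
        then have "w \<le> real_of_int (irregularity n I)" by (rule mult_right_le_imp_le) simp
        then show ?thesis by simp
      next
        case (2 \<kappa>)
        let ?f = "frob n (gram n (sign_matrix I \<kappa>) (depth n))"
        have "real_of_int (((\<lfloor>2 ^ n * \<rho>\<rfloor> * int (card I))\<^sup>2) ^ K) \<le> real_of_int (?f * ((16 * 2 ^ n * int n)\<^sup>2) ^ K)"
          using 2(2) unfolding K_def by (subst of_int_le_iff) linarith
        then have "((r * real (card I))\<^sup>2) ^ K \<le> real_of_int ?f * ((16 * 2 ^ n * real n)\<^sup>2) ^ K"
          by (simp add: r_def)
        moreover have "(Q\<^sup>2) ^ K \<le> ((r * real (card I))\<^sup>2) ^ K"
          using rM Q by (intro power_mono) auto
        moreover have "(Q\<^sup>2) ^ K = f * ((16 * 2 ^ n * real n)\<^sup>2) ^ K"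
        proof -
          have "Q\<^sup>2 = \<rho>\<^sup>2 * \<Delta>\<^sup>2 / 4096 * (16 * 2 ^ n * real n)\<^sup>2"
            using n_pos by (simp add: Q_def \<Delta>_def power_mult_distrib power_divide)
          then show ?thesis by (simp only: f_def power_mult_distrib)
        qed
        ultimately have "f * ((16 * 2 ^ n * real n)\<^sup>2) ^ K \<le> real_of_int ?f * ((16 * 2 ^ n * real n)\<^sup>2) ^ K"
          by linarith
        then have "f \<le> real_of_int ?f" by (rule mult_right_le_imp_le) (use n_pos in simp)
        then show ?thesis using 2(1) by blast
      qed
    qed simp
  qed
  have "measure_pmf.prob \<H> {I. \<not> accepts n \<lfloor>2 ^ n * \<rho>\<rfloor> I} \<le>
      measure_pmf.prob \<H> (?A \<union> ?W \<union> (\<Union>\<kappa>\<in>set patterns. ?F \<kappa>))"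
    using sub by (intro measure_pmf.finite_measure_mono) auto
  also have "\<dots> \<le> measure_pmf.prob \<H> (?A \<union> ?W) + measure_pmf.prob \<H> (\<Union>\<kappa>\<in>set patterns. ?F \<kappa>)"
    by (rule measure_subadditive) auto
  also have "\<dots> \<le> (measure_pmf.prob \<H> ?A + measure_pmf.prob \<H> ?W) +
      (\<Sum>\<kappa>\<in>set patterns. measure_pmf.prob \<H> (?F \<kappa>))"
    by (intro add_mono measure_subadditive measure_pmf.finite_measure_subadditive_finite) auto
  also have "\<dots> \<le> (4 / m + 4096 / (\<rho>\<^sup>2 * \<Delta>)) + (\<Sum>\<kappa>\<in>set patterns. 1 / real n)"
  proof (intro add_mono sum_mono)
    have "measure_pmf.prob \<H> ?A \<le> measure_pmf.expectation \<H> (\<lambda>I. (real (card I) - m)\<^sup>2) / (m / 2)\<^sup>2"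
      using pos by (intro prob_le_expectation) auto
    also have "\<dots> \<le> m / (m / 2)\<^sup>2" by (intro divide_right_mono expectation_card_variance_le) auto
    also have "\<dots> = 4 / m" using pos by (simp add: power2_eq_square)
    finally show "measure_pmf.prob \<H> ?A \<le> 4 / m" .
    have "w > 0" using pos n_pos by (simp add: w_def)
    then have "measure_pmf.prob \<H> ?W \<le> measure_pmf.expectation \<H> (\<lambda>I. real_of_int (irregularity n I)) / w"
      by (intro prob_le_expectation) (auto simp: irregularity_def sum_nonneg)
    also have "\<dots> \<le> m * real n ^ 2 / w"
      using \<open>w > 0\<close> by (intro divide_right_mono expectation_irregularity_le) auto
    also have "\<dots> = 4096 / (\<rho>\<^sup>2 * \<Delta>)"
      using pos n_pos by (simp add: w_def \<Delta>_def power2_eq_square mult_ac)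
    finally show "measure_pmf.prob \<H> ?W \<le> 4096 / (\<rho>\<^sup>2 * \<Delta>)" .
  next
    fix \<kappa> assume \<kappa>: "\<kappa> \<in> set patterns"
    obtain i j p where p: "\<kappa> = (i, j, p)" by (metis prod.exhaust)
    have "p \<noteq> (False, False, False)" using \<kappa> by (auto simp: p patterns_def)
    have "f > 0" using pos \<Delta> by (simp add: f_def)
    then have "measure_pmf.prob \<H> (?F \<kappa>) \<le>
        measure_pmf.expectation \<H> (\<lambda>I. real_of_int (frob n (gram n (sign_matrix I \<kappa>) (depth n)))) / f"
      by (intro prob_le_expectation) (auto simp: frob_def sum_nonneg)
    also have "\<dots> \<le> real n * (289 * \<Delta> * real K) ^ K / f"
      using \<open>f > 0\<close> expectation_frob_le[OF \<open>p \<noteq> _\<close> assms(4), of i j]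
      by (intro divide_right_mono) (auto simp: p \<Delta>_def K_def)
    also have "\<dots> = real n * (289 * \<Delta> * real K / (\<rho>\<^sup>2 * \<Delta>\<^sup>2 / 4096)) ^ K"
      by (simp only: f_def power_divide[of "_ * real K"] times_divide_eq_right)
    also have "289 * \<Delta> * real K / (\<rho>\<^sup>2 * \<Delta>\<^sup>2 / 4096) = 289 * 4096 * real K / (\<rho>\<^sup>2 * \<Delta>)"
      using \<Delta> pos by (simp add: power2_eq_square)
    also have "real n * (289 * 4096 * real K / (\<rho>\<^sup>2 * \<Delta>)) ^ K \<le> real n * (1 / 4) ^ K"
    proof (intro mult_left_mono power_mono)
      show "289 * 4096 * real K / (\<rho>\<^sup>2 * \<Delta>) \<le> 1 / 4"
        using small \<Delta> pos by (simp add: divide_le_eq \<Delta>_def[symmetric] K_def)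
    qed (use \<Delta> pos in auto)
    \<comment> \<open>The exponent \<open>K\<close> exceeds the bit length of \<open>n\<close>, so
      \<open>2 ^ K\<close> is at least \<open>n\<close> and \<open>4 ^ K\<close> at least
      \<open>n^2\<close>. This is why the base was pushed down to 1/4.\<close>
    also have "\<dots> \<le> real n * (1 / real n ^ 2)"
    proof (intro mult_left_mono)
      have "floorlog 2 n < K"
        using power_le_iff_less_floorlog[of "depth n" "floorlog 2 n"] by (auto simp: K_def depth_def not_le)
      moreover have "n < 2 ^ floorlog 2 n"
        using power_le_iff_less_floorlog[of "floorlog 2 n" n] by (auto simp: not_le)
      ultimately have "n \<le> 2 ^ K" using power_increasing[of "floorlog 2 n" K "2::nat"] by linarith
      then have "real n \<le> 2 ^ K" by (metis of_nat_le_iff of_nat_numeral of_nat_power)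
      then have "real n ^ 2 \<le> (2 ^ K)\<^sup>2" by (intro power_mono) auto
      also have "\<dots> = 4 ^ K" by (simp add: power_mult[symmetric] mult.commute[of K] power_mult)
      finally show "(1 / 4) ^ K \<le> 1 / real n ^ 2" using n_pos by (simp add: power_divide frac_le)
    qed simp
    also have "\<dots> = 1 / real n" by (simp add: power2_eq_square)
    finally show "measure_pmf.prob \<H> (?F \<kappa>) \<le> 1 / real n" .
  qed
  also have "(\<Sum>\<kappa>\<in>set patterns. 1 / real n) \<le> 7 / real n"
  proof -
    have "card (set patterns) \<le> 7" using card_length[of patterns] by (simp add: patterns_def)
    then have "real (card (set patterns)) \<le> 7" by linarith
    then show ?thesis by (simp add: divide_right_mono)
  qed
  finally show ?thesis by (simp add: \<Delta>_def)
qed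

end

section \<open>Asymptotics of the success probability\<close>

lemma power_depth_le_ln:
  assumes "n \<ge> 3"
  shows "real (2 ^ depth n) \<le> 6 * ln (real n)"
proof -
  have "ln (real n) \<ge> 1"
  proof -
    have "exp 1 \<le> real n" using exp_le assms by linarith
    then show ?thesis using assms by (simp add: ln_ge_iff)
  qed
  have "real (floorlog 2 n) \<le> log 2 (real n) + 1"
    using assms by (simp add: floorlog_def)
  also have "log 2 (real n) \<le> 3 / 2 * ln (real n)"
  proof -
    have "ln 2 \<ge> (2 / 3 :: real)" using ln2_ge_two_thirds .
    then have "ln (real n) * (2 / 3) \<le> ln (real n) * ln 2"
      using \<open>ln (real n) \<ge> 1\<close> by (intro mult_left_mono) auto
    then show ?thesis by (simp add: log_def field_simps)
  qed
  finally have "real (2 * floorlog 2 n + 1) \<le> 3 * ln (real n) + 3" by simp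
  moreover have "real (2 ^ depth n) \<le> real (2 * floorlog 2 n + 1)"
    unfolding depth_def by (subst of_nat_le_iff) (rule power_floorlog_le)
  ultimately show ?thesis using \<open>ln (real n) \<ge> 1\<close> by linarith
qed

lemma prob_accepts_tendsto_1:
  fixes \<delta> :: real and \<Delta> m \<rho> :: "nat \<Rightarrow> real"
  assumes \<delta>: "\<delta> > 0" and \<Delta>: "\<And>n. m n = \<Delta> n * real n" and m: "\<And>n. m n = real n powr (1 + \<delta>)"
    and \<rho>: "filterlim (\<lambda>n. \<rho> n / sqrt (ln (real n) / \<Delta> n)) at_top sequentially"
  shows "(\<lambda>n. measure_pmf.prob (random_hypergraph (m n) n) {I. accepts n \<lfloor>2 ^ n * \<rho> n\<rfloor> I}) \<longlonglongrightarrow> 1"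
proof -
  define L where "L = (\<lambda>n. \<rho> n / sqrt (ln (real n) / \<Delta> n))"
  have L: "filterlim L at_top sequentially" using \<rho> by (simp add: L_def)
  have ev_n: "eventually (\<lambda>n. n \<ge> 3) sequentially" by (rule eventually_ge_at_top)
  \<comment> \<open>Any threshold would do whose square is at least 4 * 289 * 4096 * 6, where 6 is
    the constant of \<open>power_depth_le_ln\<close>.\<close>
  have ev_L: "eventually (\<lambda>n. L n \<ge> 10 ^ 5) sequentially"
    using L by (simp add: filterlim_at_top)
  have ev_K: "eventually (\<lambda>n. 6 * ln (real n) \<le> real n powr \<delta>) sequentially"
    using \<delta> by real_asymp
  \<comment> \<open>Eventually \<open>\<rho> n\<close> is at least n^(-\<delta>/2), so
    \<open>n\<close> binary digits suffice to lose at most half of it in rounding.\<close>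
  have ev_r: "eventually (\<lambda>n. 2 ^ n * real n powr (- \<delta> / 2) \<ge> (2::real)) sequentially"
    by real_asymp
  have basic: "\<Delta> n = real n powr \<delta>" "ln (real n) \<ge> 1" "\<rho> n > 0" "\<rho> n ^ 2 * \<Delta> n = L n ^ 2 * ln (real n)"
    "2 ^ n * \<rho> n \<ge> 2" if n: "n \<ge> 3" "L n \<ge> 10 ^ 5" "2 ^ n * real n powr (- \<delta> / 2) \<ge> 2" for n
  proof -
    have "\<Delta> n * real n = real n powr \<delta> * real n" using \<Delta>[of n] m[of n] n by (simp add: powr_add)
    then show D: "\<Delta> n = real n powr \<delta>" using n by simp
    have "exp 1 \<le> real n" using exp_le n by linarith
    then show l: "ln (real n) \<ge> 1" using n by (simp add: ln_ge_iff)
    have "\<Delta> n > 0" using D n by simp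
    define s where "s = sqrt (ln (real n) / \<Delta> n)"
    have s: "s > 0" using l \<open>\<Delta> n > 0\<close> by (simp add: s_def)
    have R: "\<rho> n = L n * s" using s by (simp add: L_def s_def[symmetric])
    then show "\<rho> n > 0" using s n by simp
    have "s\<^sup>2 = ln (real n) / \<Delta> n" using l \<open>\<Delta> n > 0\<close> by (simp add: s_def)
    then show "\<rho> n ^ 2 * \<Delta> n = L n ^ 2 * ln (real n)" using \<open>\<Delta> n > 0\<close> by (simp add: R power_mult_distrib)
    have "real n powr (- \<delta> / 2) \<le> s"
    proof (rule power2_le_imp_le)
      have "(real n powr (- \<delta> / 2))\<^sup>2 = 1 / \<Delta> n"
        using n by (simp add: D powr_minus_divide powr_half_sqrt powr_powr power2_eq_square flip: powr_add)
      also have "\<dots> \<le> s\<^sup>2" using l \<open>\<Delta> n > 0\<close> by (simp add: \<open>s\<^sup>2 = _\<close> divide_right_mono)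
      finally show "(real n powr (- \<delta> / 2))\<^sup>2 \<le> s\<^sup>2" .
    qed (use s in simp)
    also have "s \<le> \<rho> n" using n s by (simp add: R)
    finally have "2 ^ n * real n powr (- \<delta> / 2) \<le> 2 ^ n * \<rho> n" by (intro mult_left_mono) auto
    with n(3) show "2 ^ n * \<rho> n \<ge> 2" by linarith
  qed
  show ?thesis
  \<comment> \<open>For \<delta> > 2 the parameter is eventually clipped to 1 and the instance is
    complete. Otherwise \<open>m n\<close> is at most \<open>n^3\<close> for
    \<open>n \<ge> 3\<close>, and the moment bounds apply.\<close>
  proof (cases "\<delta> > 2")
    case True
    have "eventually (\<lambda>n. 8 * real n ^ 3 \<le> real n powr (1 + \<delta>)) sequentially"
      using True by real_asymp
    then have "eventually (\<lambda>n. 1 = measure_pmf.prob (random_hypergraph (m n) n) {I. accepts n \<lfloor>2 ^ n * \<rho> n\<rfloor> I}) sequentially"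
      using ev_n ev_L ev_r
    proof eventually_elim
      case (elim n)
      have "\<lfloor>2 ^ n * \<rho> n\<rfloor> > 0" using basic(5)[OF elim(2,3,4)] by linarith
      then have "AE I in random_hypergraph (m n) n. I \<in> {I. accepts n \<lfloor>2 ^ n * \<rho> n\<rfloor> I}"
        using random_hypergraph_complete[of n "m n"] accepts_complete[of "\<lfloor>2 ^ n * \<rho> n\<rfloor>" n] elim m[of n]
        by (auto simp: AE_measure_pmf_iff)
      then show ?case using measure_pmf.prob_eq_1[of "{I. accepts n \<lfloor>2 ^ n * \<rho> n\<rfloor> I}" "random_hypergraph (m n) n"]
        by simp
    qed
    then show ?thesis by (rule tendsto_eventually[OF eventually_mono]) simp
  next
    case False
    have ev: "eventually (\<lambda>n. 1 - (4 / real n powr (1 + \<delta>) + 4096 / L n + 7 / real n) \<le>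
        measure_pmf.prob (random_hypergraph (m n) n) {I. accepts n \<lfloor>2 ^ n * \<rho> n\<rfloor> I}) sequentially"
      using ev_n ev_L ev_K ev_r
    proof eventually_elim
      case (elim n)
      note b = basic[OF elim(1,2,4)]
      have mn: "m n > 0" using elim(1) by (simp add: m)
      have Dm: "m n / real n = \<Delta> n" using elim(1) by (simp add: \<Delta>)
      have instance_n: "random_instance n (m n)"
      proof
        have "m n \<le> real n powr 3" unfolding m using False elim(1) by (intro powr_mono) auto
        also have "\<dots> = real n ^ 3" using elim(1) powr_realpow[of "real n" 3] by simp
        finally show "m n \<le> 8 * real n ^ 3" using zero_le_power[of "real n" 3] by linarith
      qed (use mn elim(1) in auto)
      have K: "2 ^ depth n \<le> 6 * ln (real n)" using power_depth_le_ln[OF elim(1)] by simp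
      have "measure_pmf.prob (random_hypergraph (m n) n) {I. \<not> accepts n \<lfloor>2 ^ n * \<rho> n\<rfloor> I} \<le>
          4 / m n + 4096 / (\<rho> n ^ 2 * (m n / real n)) + 7 / real n"
      proof (rule random_instance.prob_rejects_le[OF instance_n])
        show "2 ^ depth n \<le> m n / real n" unfolding Dm b(1) using K elim(3) by linarith
        have "4 * 289 * 4096 * 2 ^ depth n \<le> (10 ^ 5)\<^sup>2 * ln (real n)" using K b(2) by simp
        also have "\<dots> \<le> L n ^ 2 * ln (real n)"
          using elim(2) b(2) by (intro mult_right_mono power_mono) auto
        finally show "4 * 289 * 4096 * 2 ^ depth n \<le> \<rho> n ^ 2 * (m n / real n)" unfolding Dm b(4) .
      qed (use mn b in auto)
      also have "4096 / (\<rho> n ^ 2 * (m n / real n)) \<le> 4096 / L n"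
      proof -
        have "L n * 1 \<le> L n * (L n * ln (real n))"
        proof (rule mult_left_mono)
          have "1 * 1 \<le> L n * ln (real n)" using elim(2) b(2) by (intro mult_mono) auto
          then show "1 \<le> L n * ln (real n)" by simp
        qed (use elim(2) in simp)
        then have "L n \<le> \<rho> n ^ 2 * (m n / real n)" unfolding Dm b(4) by (simp add: power2_eq_square mult.assoc)
        then show ?thesis using elim(2) by (intro frac_le) auto
      qed
      finally have "measure_pmf.prob (random_hypergraph (m n) n) {I. \<not> accepts n \<lfloor>2 ^ n * \<rho> n\<rfloor> I} \<le>
          4 / real n powr (1 + \<delta>) + 4096 / L n + 7 / real n" by (simp add: m)
      then show ?case
        using measure_pmf.prob_compl[of "{I. accepts n \<lfloor>2 ^ n * \<rho> n\<rfloor> I}" "random_hypergraph (m n) n"]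
        by (simp add: Compl_eq_Diff_UNIV[symmetric] Collect_neg_eq[symmetric])
    qed
    have "(\<lambda>n. 4 / real n powr (1 + \<delta>)) \<longlonglongrightarrow> 0" using \<delta> by real_asymp
    moreover have "(\<lambda>n. 7 / real n) \<longlonglongrightarrow> 0" by real_asymp
    moreover have "(\<lambda>n. 4096 / L n) \<longlonglongrightarrow> 0" by (rule tendsto_divide_0[OF tendsto_const filterlim_at_top_imp_at_infinity[OF L]])
    ultimately have "(\<lambda>n. 1 - (4 / real n powr (1 + \<delta>) + 4096 / L n + 7 / real n)) \<longlonglongrightarrow> 1 - (0 + 0 + 0)"
      by (intro tendsto_intros)
    then show ?thesis
      by (intro tendsto_sandwich[OF ev always_eventually _ tendsto_const]) auto
  qed
qed

text \<open>\<open>returns\<close> speaks of some halting run. Determinism identifies it with the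
  run of \<open>exec_certifier\<close>, so that the answer is unique.\<close>

lemma returns_certifier:
  assumes "I \<in> instances n"
  shows "returns certifier (encode n \<rho> I) v \<longleftrightarrow> v = of_bool (accepts n \<lfloor>2 ^ n * \<rho>\<rfloor> I)"
proof -
  interpret certifier_run n \<rho> I by standard (use assms in \<open>auto simp: instances_def\<close>)
  obtain t s where t: "exec certifier (initial (encode n \<rho> I)) t s"
    "s 0 0 = of_bool (accepts n \<lfloor>2 ^ n * \<rho>\<rfloor> I)"
    using exec_certifier unfolding input_def r_def by blast
  show ?thesis
  proof
    assume "returns certifier (encode n \<rho> I) v"
    then obtain t' s' where "exec certifier (initial (encode n \<rho> I)) t' s'" "s' 0 0 = v"
      unfolding returns_def by blast
    with exec_deterministic[OF t(1)] t(2) show "v = of_bool (accepts n \<lfloor>2 ^ n * \<rho>\<rfloor> I)" by auto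
  next
    assume "v = of_bool (accepts n \<lfloor>2 ^ n * \<rho>\<rfloor> I)"
    with t have "exec certifier (initial (encode n \<rho> I)) t s \<and> s 0 0 = v" by simp
    then show "returns certifier (encode n \<rho> I) v" unfolding returns_def by blast
  qed
qed

lemma polynomial_time_certifier:
  "polynomial_time_on (\<Union>n. encode n (\<rho> n) ` instances n) certifier"
proof -
  let ?c = "51 * stages_weight 3 certifier_stages + 17 * (20 + (\<Sum>e\<leftarrow>certifier_tests. 1 + (weight e)\<^sup>2))"
  have "\<exists>t s. exec certifier (initial xs) t s \<and> t \<le> ?c * input_size xs ^ 4 + ?c"
    if xs: "xs \<in> (\<Union>n. encode n (\<rho> n) ` instances n)" for xs
  proof -
    obtain n I where I: "I \<in> instances n" "xs = encode n (\<rho> n) I" using xs by blast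
    interpret certifier_run n "\<rho> n" I by standard (use I in \<open>auto simp: instances_def\<close>)
    show ?thesis using exec_certifier unfolding z_def input_def I(2)[symmetric] by (meson trans_le_add1)
  qed
  then show ?thesis unfolding polynomial_time_on_def by blast
qed

theorem theorem6p1:
  fixes \<delta> :: real and \<Delta> m \<rho> \<eta> :: "nat \<Rightarrow> real"
  assumes "\<delta> > 0"
    and "\<And>n. m n = \<Delta> n * real n"
    and "\<And>n. m n = real n powr (1 + \<delta>)"
    and "filterlim (\<lambda>n. \<rho> n / sqrt (ln (real n) / \<Delta> n)) at_top sequentially"
    and "\<And>n. \<eta> n = \<rho> n / 32"
  shows "\<exists>A.
    polynomial_time_on (\<Union>n. encode n (\<rho> n) ` instances n) A \<and>
    certifies_whp A instances (\<lambda>n. encode n (\<rho> n)) (\<lambda>n. random_hypergraph (m n) n)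
      (\<lambda>n I. \<not> (\<exists>x\<in>assignments n. biased (\<rho> n) n x \<and> satisfying (1 - \<eta> n) I x))"
proof (intro exI conjI)
  show "polynomial_time_on (\<Union>n. encode n (\<rho> n) ` instances n) certifier"
    by (rule polynomial_time_certifier)
  have "measure_pmf.prob (random_hypergraph (m n) n) {I. returns certifier (encode n (\<rho> n) I) success} =
      measure_pmf.prob (random_hypergraph (m n) n) {I. accepts n \<lfloor>2 ^ n * \<rho> n\<rfloor> I}" for n
    using set_random_hypergraph[of "m n" n]
    by (intro measure_pmf.finite_measure_eq_AE)
      (auto simp: AE_measure_pmf_iff returns_certifier instances_def subset_iff)
  with prob_accepts_tendsto_1[OF assms(1-4)]
  show "certifies_whp certifier instances (\<lambda>n. encode n (\<rho> n)) (\<lambda>n. random_hypergraph (m n) n)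
      (\<lambda>n I. \<not> (\<exists>x\<in>assignments n. biased (\<rho> n) n x \<and> satisfying (1 - \<eta> n) I x))"
    unfolding certifies_whp_def using accepts_sound[of _ "\<rho> _"]
    by (auto simp: returns_certifier assms(5) instances_def)
qed

end
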